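(* Let $n\ge1$, $q\in\mathbb Z/4\mathbb Z$ and $s\in\mathbb C$. As $\mathfrak g$-modules: (1) If $q\not\equiv n\pmod 4$ and $q\not\equiv -n\pmod 4$, then $H_0$ is the unique irreducible submodule of $H$. (2) If $q\equiv n\pmod 4$ and $q\not\equiv-n\pmod 4$, then a composition series for $H$ is $$0\subset H_0^+\subset H_0\subset H_0\oplus H^+\subset H.$$ (3) If $q\not\equiv n\pmod 4$ and $q\equiv-n\pmod 4$, then a composition series for $H$ is $$0\subset H_0^-\subset H_0\subset H_0\oplus H^-\subset H.$$ (4) If $q\equiv n\pmod 4$ and $q\equiv-n\pmod 4$, then a composition series for $H$ is $$0\subset H_0^-\subset H_0^+\oplus H_0^-\subset H_0\subset H_0\oplus H^-\subset H_0\oplus H^-\oplus H^+\subset H.$$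
   Context: Coordinates are $\theta\in\mathbb R$, $y\in\mathbb R^n$, $\rho=\|y\|$. $\mathcal H_k(\mathbb R^n)$ is the space of harmonic polynomials of homogeneous degree $k$ on $\mathbb R^n$; the index $k$ runs over $\mathbb Z^{\ge0}$ for $n\ge3$, over $\mathbb Z$ for $n=2$, and over $\{0,1\}$ for $n=1$ (where $\mathcal H_k=0$ for $k\ge2$), these being the indices in the decomposition $C^\infty(S^{n-1})_{O(n)\text{-finite}}=\bigoplus_k\mathcal H_k(S^{n-1})$, with $\mathcal H_k(S^{n-1})$ the restrictions to the sphere. With ${}_1F_1(a,b,z)=\sum_{j\ge0}\frac{(a)_j}{(b)_j}\frac{z^j}{j!}$, put for $h_k\in\mathcal H_k(\mathbb R^n)$ $$F_{m,l,k}(\theta,y)=e^{-im\theta/2}e^{-is\rho^2}\rho^{2l}h_k(y)\,{}_1F_1\!\Big(\tfrac{m+4l+2k+n}{4},\,2l+k+\tfrac n2,\,2is\rho^2\Big).$$ Let $H_{l,k}$ be the span of all $F_{m,l,k}$ with $m\in\mathbb Z$, $m\equiv2k+q\pmod 4$ and $h_k\in\mathcal H_k(\mathbb R^n)$. If $q\equiv n\pmod 4$, let $H^+_{l,k}\subset H_{l,k}$ be the span of those with $m\ge 2k+4l+n$; if $q\equiv-n\pmod 4$, let $H^-_{l,k}\subset H_{l,k}$ be the span of those with $m\le-(2k+4l+n)$. Define $$H_0=\bigoplus_{k\ge0}H_{0,k},\quad H_0^\pm=\bigoplus_{k\ge0}H_{0,k}^\pm,\quad H^\pm=\bigoplus_{k\ge0,\,l\ge1}H^\pm_{l,k},\quad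 H=\bigoplus_{k\ge0,\,l\ge0}H_{l,k}$$ (the $+$ spaces when $q\equiv n$, the $-$ spaces when $q\equiv-n \pmod 4$). When $n=2$, the sums are taken over $k\in\mathbb Z$ instead of $k\ge0$. $\mathfrak g=(\mathfrak{sl}(2,\mathbb R)\times\mathfrak{so}(n))\ltimes\mathfrak h_{2n+1}$, with $\mathfrak h_{2n+1}$ the $(2n+1)$-dimensional Heisenberg algebra, is the Lie algebra of $(\widetilde{SL(2,\mathbb R)}\times O(n))\ltimes H_{2n+1}$, where $H_{2n+1}$ here denotes the Heisenberg group and $\widetilde{SL(2,\mathbb R)}$ the double cover. It acts, after complexification, by differential operators as follows. The basis $\kappa=i(e^--e^+)$, $\eta^\pm=\frac12(h\pm i(e^++e^-))$ of $\mathfrak{sl}_2(\mathbb C)$ (with $h,e^+,e^-$ the standard basis) acts by $$\kappa=i\partial_\theta,\qquad \eta^\pm=\tfrac12e^{\mp2i\theta}\Big(-E_n\mp i\partial_\theta-\big(\tfrac n2\pm2is\|y\|^2\big)\Big),\quad E_n=\sum_j y_j\partial_{y_j};$$ writing elements of $\mathfrak h_{2n+1}^{\mathbb C}$ as $(u,v,w)$ with $u,v\in\mathbb C^n$, $w\in\mathbb C$, and $e_j$ for the standard basis of $\mathbb C^n$, $E_j^{\mp}=(\pm ie_j,e_j,0)$ acts by $e^{\pm i\theta}(\mp i\partial_{y_j}-2sy_j)$ and $(0,0,w)$ acts by the scalar $sw$; $\mathfrak{so}(n)$ acts by differentiating the action $(u.F)(\theta,y)=F(\theta,u^{-1}y)$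 of $O(n)$. A composition series is a finite strictly increasing chain of submodules whose successive quotients are irreducible.
   Formalization: Assumes s ≠ 0 (for s = 0, H_{0,0} is a proper submodule of H_0 and all four claims fail); in (4) with n = 2 the chain is a composition series for 𝔤 together with O(2), as H_0/(H_0^+⊕H_0^-) splits over 𝔤 into parts k>0 and k<0. *)

theory Defs
  imports
    "HOL-Analysis.Analysis"
    "HOL-Number_Theory.Cong"
    "HOL-Library.Function_Algebras"
begin

section \<open>Modules over a Lie algebra, quotients, composition series\<close>

text \<open>
  A complex vector space on which the elements of the set \<open>gm_ops\<close> act. Carriers and
  operations are explicit so that submodules and quotients of a module are again of this kind.
\<close>

record ('x, 'a) gmod =
  gm_ops :: "'x set"
  gm_carrier :: "'a set"
  gm_zero :: 'a
  gm_add :: "'a \<Rightarrow> 'a \<Rightarrow> 'a"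
  gm_scale :: "complex \<Rightarrow> 'a \<Rightarrow> 'a"
  gm_act :: "'x \<Rightarrow> 'a \<Rightarrow> 'a"

definition gm_submodule :: "('x, 'a) gmod \<Rightarrow> 'a set \<Rightarrow> bool" where
  "gm_submodule M N \<longleftrightarrow>
     N \<subseteq> gm_carrier M \<and> gm_zero M \<in> N \<and>
     (\<forall>a\<in>N. \<forall>b\<in>N. gm_add M a b \<in> N) \<and>
     (\<forall>c. \<forall>a\<in>N. gm_scale M c a \<in> N) \<and>
     (\<forall>x\<in>gm_ops M. \<forall>a\<in>N. gm_act M x a \<in> N)"

definition gm_restrict :: "('x, 'a) gmod \<Rightarrow> 'a set \<Rightarrow> ('x, 'a) gmod" where
  "gm_restrict M N = M\<lparr>gm_carrier := N\<rparr>"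

definition gm_irreducible :: "('x, 'a) gmod \<Rightarrow> bool" where
  "gm_irreducible M \<longleftrightarrow>
     gm_carrier M \<noteq> {gm_zero M} \<and>
     (\<forall>N. gm_submodule M N \<longrightarrow> N = {gm_zero M} \<or> N = gm_carrier M)"

definition gm_coset :: "('x, 'a) gmod \<Rightarrow> 'a set \<Rightarrow> 'a \<Rightarrow> 'a set" where
  "gm_coset M N a = {gm_add M a v | v. v \<in> N}"

text \<open>
  The operations on cosets are written without choosing representatives: for a submodule \<open>N\<close>,
  the union below consists of a single coset.
\<close>

definition gm_quotient :: "('x, 'a) gmod \<Rightarrow> 'a set \<Rightarrow> ('x, 'a set) gmod" where
  "gm_quotient M N =
     \<lparr> gm_ops = gm_ops M,
       gm_carrier = gm_coset M N ` gm_carrier M,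
       gm_zero = N,
       gm_add = (\<lambda>A B. \<Union>a\<in>A. \<Union>b\<in>B. gm_coset M N (gm_add M a b)),
       gm_scale = (\<lambda>c A. \<Union>a\<in>A. gm_coset M N (gm_scale M c a)),
       gm_act = (\<lambda>x A. \<Union>a\<in>A. gm_coset M N (gm_act M x a)) \<rparr>"

definition gm_composition_series :: "('x, 'a) gmod \<Rightarrow> 'a set list \<Rightarrow> bool" where
  "gm_composition_series M Vs \<longleftrightarrow>
     Vs \<noteq> [] \<and> hd Vs = {gm_zero M} \<and> last Vs = gm_carrier M \<and>
     (\<forall>V\<in>set Vs. gm_submodule M V) \<and>
     (\<forall>i. Suc i < length Vs \<longrightarrow>
        Vs ! i \<subset> Vs ! Suc i \<and>
        gm_irreducible (gm_quotient (gm_restrict M (Vs ! Suc i)) (Vs ! i)))"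


section \<open>The function space and the differential operators\<close>

text \<open>
  Throughout, \<open>n = CARD('n)\<close>, and functions \<open>F \<theta> y\<close> of \<open>\<theta> \<in> \<real>\<close>, \<open>y \<in> \<real>\<^sup>n\<close> are complex-valued.
\<close>

type_synonym 'n func = "real \<Rightarrow> real ^ 'n \<Rightarrow> complex"

definition fscale :: "complex \<Rightarrow> 'n::finite func \<Rightarrow> 'n func" where
  "fscale c F = (\<lambda>\<theta> y. c * F \<theta> y)"

interpretation cfun: vector_space "fscale :: complex \<Rightarrow> 'n::finite func \<Rightarrow> 'n func"
  by unfold_locales (auto simp: fscale_def fun_eq_iff algebra_simps)

definition dtheta :: "'n::finite func \<Rightarrow> 'n func" where
  "dtheta F = (\<lambda>\<theta> y. vector_derivative (\<lambda>t. F t y) (at \<theta>))"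

definition pdiff :: "'n::finite \<Rightarrow> (real ^ 'n \<Rightarrow> complex) \<Rightarrow> real ^ 'n \<Rightarrow> complex" where
  "pdiff j h = (\<lambda>y. vector_derivative (\<lambda>t. h (y + t *\<^sub>R axis j 1)) (at 0))"

definition euler :: "'n::finite func \<Rightarrow> 'n func" where
  "euler F = (\<lambda>\<theta> y. \<Sum>j\<in>UNIV. of_real (y $ j) * pdiff j (F \<theta>) y)"

definition op_kappa :: "'n::finite func \<Rightarrow> 'n func" where
  "op_kappa F = (\<lambda>\<theta> y. \<i> * dtheta F \<theta> y)"

definition op_eta_plus :: "complex \<Rightarrow> 'n::finite func \<Rightarrow> 'n func" where
  "op_eta_plus s F = (\<lambda>\<theta> y. 1/2 * exp (- 2 * \<i> * of_real \<theta>) *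
     (- euler F \<theta> y - \<i> * dtheta F \<theta> y
      - (of_nat CARD('n) / 2 + 2 * \<i> * s * of_real ((norm y)\<^sup>2)) * F \<theta> y))"

definition op_eta_minus :: "complex \<Rightarrow> 'n::finite func \<Rightarrow> 'n func" where
  "op_eta_minus s F = (\<lambda>\<theta> y. 1/2 * exp (2 * \<i> * of_real \<theta>) *
     (- euler F \<theta> y + \<i> * dtheta F \<theta> y
      - (of_nat CARD('n) / 2 - 2 * \<i> * s * of_real ((norm y)\<^sup>2)) * F \<theta> y))"

text \<open>\<open>op_E_minus s j\<close> is the action of \<open>(\<i> e\<^sub>j, e\<^sub>j, 0)\<close>, \<open>op_E_plus s j\<close> that of \<open>(-\<i> e\<^sub>j, e\<^sub>j, 0)\<close>.\<close>

definition op_E_minus :: "complex \<Rightarrow> 'n::finite \<Rightarrow> 'n func \<Rightarrow> 'n func" where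
  "op_E_minus s j F = (\<lambda>\<theta> y. exp (\<i> * of_real \<theta>) *
     (- \<i> * pdiff j (F \<theta>) y - 2 * s * of_real (y $ j) * F \<theta> y))"

definition op_E_plus :: "complex \<Rightarrow> 'n::finite \<Rightarrow> 'n func \<Rightarrow> 'n func" where
  "op_E_plus s j F = (\<lambda>\<theta> y. exp (- \<i> * of_real \<theta>) *
     (\<i> * pdiff j (F \<theta>) y - 2 * s * of_real (y $ j) * F \<theta> y))"

text \<open>
  A skew matrix \<open>A\<close> acts by the derivative at \<open>t = 0\<close> of \<open>F(\<theta>, exp(-tA) y)\<close>, which is minus the
  derivative of \<open>F(\<theta>, \<cdot>)\<close> at \<open>y\<close> in the direction \<open>A y\<close>.
\<close>

definition op_so :: "real ^ 'n ^ 'n \<Rightarrow> 'n::finite func \<Rightarrow> 'n func" where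
  "op_so A F = (\<lambda>\<theta> y. - (\<Sum>j\<in>UNIV. of_real ((A *v y) $ j) * pdiff j (F \<theta>) y))"

text \<open>
  The elements of \<open>(sl(2,\<real>) \<times> so(n)) \<ltimes> h\<^sub>2\<^sub>n\<^sub>+\<^sub>1\<close> are tuples \<open>(X, A, u, v, w)\<close>.
\<close>

type_synonym 'n schr = "(real ^ 2 ^ 2) \<times> (real ^ 'n ^ 'n) \<times> (real ^ 'n) \<times> (real ^ 'n) \<times> real"

definition schr_algebra :: "'n::finite schr set" where
  "schr_algebra = {(X, A, u, v, w). trace X = 0 \<and> transpose A = - A}"

text \<open>
  For \<open>s = 0\<close>, \<open>(u, v, w)\<close> kills every function of \<open>\<theta>\<close> alone, and those of them that lie in \<open>H_zero\<close> (or in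
  \<open>H_zero_plus\<close>, \<open>H_zero_minus\<close>) below form a proper nonzero submodule.
  Irreducibility therefore requires \<open>s \<noteq> 0\<close>.

  The action is the linear extension of the operators above. For \<open>X = a h + b e\<^sup>+ + c e\<^sup>-\<close>,
  \<open>X = \<i>(b-c)/2 \<kappa> + (a - \<i>(b+c)/2) \<eta>\<^sup>+ + (a + \<i>(b+c)/2) \<eta>\<^sup>-\<close>, because
  \<open>h = \<eta>\<^sup>+ + \<eta>\<^sup>-\<close>, \<open>e\<^sup>+ + e\<^sup>- = -\<i>(\<eta>\<^sup>+ - \<eta>\<^sup>-)\<close> and \<open>e\<^sup>- - e\<^sup>+ = -\<i>\<kappa>\<close>. Similarly
  \<open>(u, v, 0) = \<Sum>\<^sub>j (v\<^sub>j - \<i>u\<^sub>j)/2 (\<i>e\<^sub>j, e\<^sub>j, 0) + (v\<^sub>j + \<i>u\<^sub>j)/2 (-\<i>e\<^sub>j, e\<^sub>j, 0)\<close>.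
\<close>

definition act_sl2 :: "complex \<Rightarrow> real ^ 2 ^ 2 \<Rightarrow> 'n::finite func \<Rightarrow> 'n func" where
  "act_sl2 s X F =
     (let a = of_real (X $ 1 $ 1); b = of_real (X $ 1 $ 2); c = of_real (X $ 2 $ 1) in
        fscale (\<i> * (b - c) / 2) (op_kappa F) +
        fscale (a - \<i> * (b + c) / 2) (op_eta_plus s F) +
        fscale (a + \<i> * (b + c) / 2) (op_eta_minus s F))"

definition act_heis ::
    "complex \<Rightarrow> real ^ 'n \<Rightarrow> real ^ 'n \<Rightarrow> real \<Rightarrow> 'n::finite func \<Rightarrow> 'n func" where
  "act_heis s u v w F =
     (\<Sum>j\<in>UNIV.
        fscale ((of_real (v $ j) - \<i> * of_real (u $ j)) / 2) (op_E_minus s j F) +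
        fscale ((of_real (v $ j) + \<i> * of_real (u $ j)) / 2) (op_E_plus s j F)) +
     fscale (s * of_real w) F"

definition schr_act :: "complex \<Rightarrow> 'n::finite schr \<Rightarrow> 'n func \<Rightarrow> 'n func" where
  "schr_act s = (\<lambda>(X, A, u, v, w) F. act_sl2 s X F + op_so A F + act_heis s u v w F)"

definition schr_module :: "complex \<Rightarrow> 'n::finite func set \<Rightarrow> ('n schr, 'n func) gmod" where
  "schr_module s W =
     \<lparr> gm_ops = schr_algebra, gm_carrier = W, gm_zero = 0, gm_add = (+),
       gm_scale = fscale, gm_act = schr_act s \<rparr>"


text \<open>
  The variant in which the group \<open>O(n)\<close> acts as well, by \<open>(u.F)(\<theta>, y) = F(\<theta>, u\<^sup>-\<^sup>1 y)\<close>. It matters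
  only for \<open>n = 2\<close>, \<open>q \<equiv> 2 (mod 4)\<close>: there the \<open>k = 0\<close> part of \<open>H_zero\<close> lies in
  \<open>H_zero_plus + H_zero_minus\<close>, so the parts \<open>k > 0\<close> and \<open>k < 0\<close> of the quotient of \<open>H_zero\<close> by
  that sum are separate submodules for the Lie algebra, and only a reflection exchanges them.
\<close>

definition schr_O_module ::
    "complex \<Rightarrow> 'n::finite func set \<Rightarrow> ('n schr + real ^ 'n ^ 'n, 'n func) gmod" where
  "schr_O_module s W =
     \<lparr> gm_ops = schr_algebra <+> {u. orthogonal_matrix u}, gm_carrier = W,
       gm_zero = 0, gm_add = (+), gm_scale = fscale,
       gm_act = case_sum (schr_act s) (\<lambda>u F \<theta> y. F \<theta> (matrix_inv u *v y)) \<rparr>"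


section \<open>The spaces\<close>

definition harmonic_poly :: "nat \<Rightarrow> (real ^ 'n::finite \<Rightarrow> complex) \<Rightarrow> bool" where
  "harmonic_poly d h \<longleftrightarrow>
     polynomial_function h \<and>
     (\<forall>t y. h (t *\<^sub>R y) = of_real (t ^ d) * h y) \<and>
     (\<forall>y. (\<Sum>j\<in>UNIV. pdiff j (pdiff j h) y) = 0)"

definition harm_indices :: "'n::finite itself \<Rightarrow> int set" where
  "harm_indices _ = (if CARD('n) = 1 then {0, 1} else if CARD('n) = 2 then UNIV else {0..})"

text \<open>
  For \<open>n = 2\<close> the index \<open>k \<in> \<int>\<close> labels the line spanned by the function that restricts to
  \<open>e\<^bsup>\<i>k\<phi>\<^esup>\<close> on the circle. It consists of harmonic polynomials of degree \<open>\<bar>k\<bar>\<close>, so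
  \<open>\<bar>k\<bar>\<close> is the degree that enters all formulas below; \<open>\<bar>k\<bar> = k\<close> if \<open>n \<noteq> 2\<close>.
  The two coordinates of the plane are taken in an arbitrary fixed order; the other order
  exchanges \<open>k\<close> and \<open>-k\<close>.
\<close>

definition planar :: "real ^ 'n::finite \<Rightarrow> complex" where
  "planar y = Complex (y $ from_nat_into UNIV 0) (y $ from_nat_into UNIV 1)"

definition harm_space :: "int \<Rightarrow> (real ^ 'n::finite \<Rightarrow> complex) set" where
  "harm_space k =
     {h. harmonic_poly (nat \<bar>k\<bar>) h \<and>
         (CARD('n) = 2 \<longrightarrow>
            (\<exists>c. \<forall>y. h y = c * (if k \<ge> 0 then planar y else cnj (planar y)) ^ nat \<bar>k\<bar>))}"

definition hyp1F1 :: "complex \<Rightarrow> complex \<Rightarrow> complex \<Rightarrow> complex" where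
  "hyp1F1 a b z = (\<Sum>j. pochhammer a j / pochhammer b j * (z ^ j / fact j))"

definition basic_fun ::
    "complex \<Rightarrow> int \<Rightarrow> nat \<Rightarrow> int \<Rightarrow> (real ^ 'n::finite \<Rightarrow> complex) \<Rightarrow> 'n func" where
  "basic_fun s m l k h = (\<lambda>\<theta> y.
     exp (- \<i> * of_int m * of_real \<theta> / 2) * exp (- \<i> * s * of_real ((norm y)\<^sup>2)) *
     of_real (norm y ^ (2 * l)) * h y *
     hyp1F1 ((of_int m + 4 * of_nat l + 2 * of_int \<bar>k\<bar> + of_nat CARD('n)) / 4)
            (2 * of_nat l + of_int \<bar>k\<bar> + of_nat CARD('n) / 2)
            (2 * \<i> * s * of_real ((norm y)\<^sup>2)))"

text \<open>The integer \<open>q\<close> stands for its class modulo \<open>4\<close>.\<close>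

definition H_comp :: "complex \<Rightarrow> int \<Rightarrow> nat \<Rightarrow> int \<Rightarrow> 'n::finite func set" where
  "H_comp s q l k =
     cfun.span {basic_fun s m l k h | m h. [m = 2 * k + q] (mod 4) \<and> h \<in> harm_space k}"

definition H_comp_plus :: "complex \<Rightarrow> int \<Rightarrow> nat \<Rightarrow> int \<Rightarrow> 'n::finite func set" where
  "H_comp_plus s q l k =
     cfun.span {basic_fun s m l k h | m h. [m = 2 * k + q] (mod 4) \<and> h \<in> harm_space k \<and>
       m \<ge> 2 * \<bar>k\<bar> + 4 * int l + int CARD('n)}"

definition H_comp_minus :: "complex \<Rightarrow> int \<Rightarrow> nat \<Rightarrow> int \<Rightarrow> 'n::finite func set" where
  "H_comp_minus s q l k =
     cfun.span {basic_fun s m l k h | m h. [m = 2 * k + q] (mod 4) \<and> h \<in> harm_space k \<and>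
       m \<le> - (2 * \<bar>k\<bar> + 4 * int l + int CARD('n))}"

definition H_zero :: "complex \<Rightarrow> int \<Rightarrow> 'n::finite func set" where
  "H_zero s q = cfun.span (\<Union>k\<in>harm_indices TYPE('n). H_comp s q 0 k)"

definition H_zero_plus :: "complex \<Rightarrow> int \<Rightarrow> 'n::finite func set" where
  "H_zero_plus s q = cfun.span (\<Union>k\<in>harm_indices TYPE('n). H_comp_plus s q 0 k)"

definition H_zero_minus :: "complex \<Rightarrow> int \<Rightarrow> 'n::finite func set" where
  "H_zero_minus s q = cfun.span (\<Union>k\<in>harm_indices TYPE('n). H_comp_minus s q 0 k)"

definition H_plus :: "complex \<Rightarrow> int \<Rightarrow> 'n::finite func set" where
  "H_plus s q = cfun.span (\<Union>k\<in>harm_indices TYPE('n). \<Union>l\<in>{1..}. H_comp_plus s q l k)"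

definition H_minus :: "complex \<Rightarrow> int \<Rightarrow> 'n::finite func set" where
  "H_minus s q = cfun.span (\<Union>k\<in>harm_indices TYPE('n). \<Union>l\<in>{1..}. H_comp_minus s q l k)"

definition H_all :: "complex \<Rightarrow> int \<Rightarrow> 'n::finite func set" where
  "H_all s q = cfun.span (\<Union>k\<in>harm_indices TYPE('n). \<Union>l. H_comp s q l k)"

definition subspace_sum :: "'n::finite func set \<Rightarrow> 'n func set \<Rightarrow> 'n func set" where
  "subspace_sum U V = {a + b | a b. a \<in> U \<and> b \<in> V}"

definition sum_is_direct :: "'n::finite func set \<Rightarrow> 'n func set \<Rightarrow> bool" where
  "sum_is_direct U V \<longleftrightarrow> U \<inter> V = {0}"

end

theory Submission
  imports Defs
begin

text \<open>
  Let \<open>V(m,l,k)\<close> be the space of the functions \<open>F\<^bsub>m,l,k\<^esub>\<close>, and put \<open>A = m + 4l + 2\<bar>k\<bar> + n\<close>,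
  \<open>C = 4l + 2\<bar>k\<bar> + n - m\<close>, so that the parameters of the hypergeometric function are \<open>a = A/4\<close> and
  \<open>b\<close> with \<open>b - a = C/4\<close>. The contiguous relations and the harmonic decomposition
  \<open>y\<^sub>j h = h\<^sup>+ + \<parallel>y\<parallel>\<^sup>2 h\<^sup>-\<close> express \<open>\<eta>\<^sup>\<plusminus>\<close> and the Heisenberg operators through moves between the
  \<open>V(m,l,k)\<close>: \<open>\<eta>\<^sup>\<plusminus>\<close> leads to \<open>m \<plusminus> 4\<close>, and \<open>E\<^sub>j\<^sup>\<plusminus>\<close> leads to \<open>m \<plusminus> 2\<close> and
  \<open>(l,k+1)\<close>, \<open>(l-1,k+1)\<close>, \<open>(l,k-1)\<close>, \<open>(l+1,k-1)\<close>. For \<open>s \<noteq> 0\<close> the coefficient of a move that raises \<open>A\<close>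
  (or \<open>C\<close>) vanishes if \<open>A = 0\<close> (or \<open>C = 0\<close>), the moves that change \<open>l\<close> need \<open>l \<ge> 1\<close>, and there are
  no further obstructions.

  The operators \<open>\<kappa>\<close>, \<open>\<eta>\<^sup>+\<eta>\<^sup>-\<close> and the Casimir operator of \<open>so(n)\<close> (for \<open>n = 2\<close>, the rotation) separate the
  \<open>V(m,l,k)\<close>, and a submodule that meets one of them contains it, because one can move down to \<open>k - 1\<close>
  and back. Hence submodules are sets of indices closed under the moves. Moves change \<open>A\<close> and \<open>C\<close> by
  multiples of \<open>4\<close>, so for integral \<open>a\<close> (or \<open>b - a\<close>) they never leave \<open>A \<le> 0\<close> (or \<open>C \<le> 0\<close>), nor \<open>l = 0\<close>; apart from that
  any two indices are connected, except that for \<open>n = 2\<close>, \<open>l = 0\<close>, \<open>A, C > 0\<close> and integral \<open>a\<close> the sign of \<open>k\<close>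
  is preserved, and only a reflection changes it.
\<close>

text \<open>Two coincidences of eigenvalues threaten the separation. For \<open>n = 1\<close> the
  Casimir operator vanishes for both \<open>k = 0\<close> and \<open>k = 1\<close>, but at equal
  \<open>m\<close> the congruence modulo 4 fixes the parity of \<open>k\<close>; for
  \<open>n = 2\<close> it cannot tell \<open>k\<close> from \<open>-k\<close>, hence the rotation.
  The eigenvalue of \<eta>+ \<eta>- is unchanged under B -> 4 - B, where B = 4l + 2|k| + n, but B +
  B' = 4 forces both \<open>l\<close> to be 0. Each Heisenberg move changes exactly one of
  \<open>A\<close>, \<open>C\<close>, and by 4: it raises one or lowers the other. A target in the
  neighbouring row therefore has two possible sources, and connectivity becomes a question about
  pairs of integers. Going from \<open>k\<close> to \<open>k + 1\<close>, both sources are lost only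
  at A = C = 4, where they are (0, 4) and (4, 0); as A + C = 8l + 4|k| + 2n at the target, this
  means n = 2, l = 0 and a source row with k = 0. The exceptional case comes from there. The
  operators are total functions built on \<open>vector_derivative\<close>, so they are linear on
  differentiable functions only; every linearity argument is confined to these.\<close>

section \<open>The confluent hypergeometric function and its contiguous relations\<close>

definition hyp_coeff :: "complex \<Rightarrow> complex \<Rightarrow> nat \<Rightarrow> complex" where
  "hyp_coeff a b j = pochhammer a j / pochhammer b j / fact j"

lemma shifted_neq_0:
  assumes "Re b > 0"
  shows "b + of_nat j \<noteq> 0"
proof -
  have "Re (b + of_nat j) > 0" using assms by simp
  then show ?thesis by (metis less_irrefl zero_complex.simps(1))
qed

lemma pochhammer_neq_0:
  assumes "Re b > 0"
  shows "pochhammer b j \<noteq> 0"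
  using shifted_neq_0[OF assms] by (induction j) (auto simp: pochhammer_Suc)

lemma hyp_coeff_Suc:
  "hyp_coeff a b (Suc j) = hyp_coeff a b j * ((a + of_nat j) / ((b + of_nat j) * of_nat (Suc j)))"
  by (simp add: hyp_coeff_def pochhammer_Suc)

lemma summable_hyp_coeff:
  assumes b: "Re b > 0"
  shows "summable (\<lambda>j. hyp_coeff a b j * z ^ j)"
proof -
  \<comment> \<open>This \<open>M\<close> bounds |a + j| / |b + j| uniformly in j: the bounds |a|
    \<le> M Re b and j \<le> M j add up. The ratio of consecutive terms is then at most M |z| / (j +
    1), which \<open>K\<close> makes at most 1/2.\<close>
  define M where "M = max 1 (norm a / Re b)"
  obtain K :: nat where K: "2 * M * norm z \<le> real K"
    using real_arch_simple by blast
  have M1: "M \<ge> 1" by (simp add: M_def)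
  have ratio: "norm (a + of_nat j) \<le> M * norm (b + of_nat j)" for j
  proof -
    have "norm a \<le> M * Re b"
      using b by (simp add: M_def pos_divide_le_eq[symmetric])
    moreover have "real j \<le> M * real j" using M1 by (simp add: mult_le_cancel_right1)
    moreover have "Re b + real j \<le> norm (b + of_nat j)"
      using complex_Re_le_cmod[of "b + of_nat j"] by simp
    moreover have "norm (a + of_nat j) \<le> norm a + real j"
      by (metis norm_of_nat norm_triangle_ineq)
    ultimately have "norm (a + of_nat j) \<le> M * (Re b + real j)"
      by (simp add: distrib_left)
    also have "\<dots> \<le> M * norm (b + of_nat j)"
      using \<open>Re b + real j \<le> _\<close> M1 by (intro mult_left_mono) auto
    finally show ?thesis .
  qed
  show ?thesis
  proof (rule summable_ratio_test[of "1/2" K])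
    fix j assume j: "K \<le> j"
    have pos: "norm (b + of_nat j) > 0" using shifted_neq_0[OF b] by simp
    have "norm (hyp_coeff a b (Suc j) * z ^ Suc j) =
        norm (hyp_coeff a b j * z ^ j) * (norm (a + of_nat j) / norm (b + of_nat j) * norm z / real (Suc j))"
      by (simp add: hyp_coeff_Suc norm_mult norm_divide norm_power mult_ac del: of_nat_Suc)
    also have "\<dots> \<le> norm (hyp_coeff a b j * z ^ j) * (1/2)"
    proof (intro mult_left_mono norm_ge_zero)
      have "norm (a + of_nat j) / norm (b + of_nat j) \<le> M"
        using ratio pos by (simp add: pos_divide_le_eq)
      then have "norm (a + of_nat j) / norm (b + of_nat j) * norm z \<le> M * norm z"
        by (intro mult_right_mono) auto
      also have "\<dots> \<le> real (Suc j) / 2" using K j by simp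
      finally show "norm (a + of_nat j) / norm (b + of_nat j) * norm z / real (Suc j) \<le> 1/2"
        by (subst pos_divide_le_eq) auto
    qed
    finally show "norm (hyp_coeff a b (Suc j) * z ^ Suc j) \<le> 1/2 * norm (hyp_coeff a b j * z ^ j)"
      by simp
  qed simp
qed

lemma hyp1F1_sums:
  assumes "Re b > 0"
  shows "(\<lambda>j. hyp_coeff a b j * z ^ j) sums hyp1F1 a b z"
  using summable_sums[OF summable_hyp_coeff[OF assms, of a z]]
  by (simp add: hyp1F1_def hyp_coeff_def)

lemma hyp1F1_0:
  assumes "Re b > 0"
  shows "hyp1F1 a b 0 = 1"
  using sums_unique2[OF hyp1F1_sums[OF assms, of a 0] powser_sums_zero]
  by (simp add: hyp_coeff_def)

lemma hyp1F1_shift_sums: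
  assumes "Re b > 0"
  shows "(\<lambda>j. (if j = 0 then 0 else hyp_coeff a b (j - 1)) * z ^ j) sums (z * hyp1F1 a b z)"
proof -
  have "(\<lambda>j. z * (hyp_coeff a b j * z ^ j)) sums (z * hyp1F1 a b z)"
    by (intro sums_mult hyp1F1_sums assms)
  then show ?thesis
    by (subst sums_Suc_iff[symmetric, where f = "\<lambda>j. (if j = 0 then 0 else hyp_coeff a b (j - 1)) * z ^ j", simplified])
       (simp add: mult_ac)
qed

text \<open>The derivative is introduced by its closed form, so that each derivative left over in a
  contiguous relation already is a hypergeometric function with both parameters raised.\<close>

definition hyp1F1' :: "complex \<Rightarrow> complex \<Rightarrow> complex \<Rightarrow> complex" where
  "hyp1F1' a b z = a / b * hyp1F1 (a + 1) (b + 1) z"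

lemma diffs_hyp_coeff:
  assumes "Re b > 0"
  shows "diffs (hyp_coeff a b) j = a / b * hyp_coeff (a + 1) (b + 1) j"
proof -
  have "b \<noteq> 0" using shifted_neq_0[OF assms, of 0] by simp
  then show ?thesis
    by (simp add: diffs_def hyp_coeff_def pochhammer_rec field_simps del: of_nat_Suc)
qed

lemma hyp1F1_deriv:
  assumes b: "Re b > 0"
  shows "(hyp1F1 a b has_field_derivative hyp1F1' a b z) (at z)"
proof -
  have "((\<lambda>z. \<Sum>j. hyp_coeff a b j * z ^ j) has_field_derivative
      (\<Sum>j. diffs (hyp_coeff a b) j * z ^ j)) (at z)"
    by (rule termdiffs_strong_converges_everywhere) (rule summable_hyp_coeff[OF b])
  moreover have "(\<lambda>z. \<Sum>j. hyp_coeff a b j * z ^ j) = hyp1F1 a b"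
    using hyp1F1_sums[OF b] by (simp add: sums_iff fun_eq_iff)
  moreover have "(\<lambda>j. diffs (hyp_coeff a b) j * z ^ j) sums hyp1F1' a b z"
    using sums_mult[OF hyp1F1_sums[of "b + 1" "a + 1" z], of "a / b"] b
    by (simp add: diffs_hyp_coeff hyp1F1'_def mult_ac)
  ultimately show ?thesis by (simp add: sums_iff)
qed

lemma hyp1F1'_sums:
  assumes b: "Re b > 0"
  shows "(\<lambda>j. of_nat j * hyp_coeff a b j * z ^ j) sums (z * hyp1F1' a b z)"
proof -
  have "(\<lambda>j. z * (diffs (hyp_coeff a b) j * z ^ j)) sums (z * hyp1F1' a b z)"
    using sums_mult[OF sums_mult[OF hyp1F1_sums[of "b + 1" "a + 1" z], of "a / b"], of z] b
    by (simp add: diffs_hyp_coeff hyp1F1'_def mult_ac)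
  then show ?thesis
    by (subst sums_Suc_iff[symmetric, where f = "\<lambda>j. of_nat j * hyp_coeff a b j * z ^ j", simplified])
       (simp add: diffs_def mult_ac)
qed

text \<open>The contiguous relations compare coefficients of power series.\<close>

lemma hyp1F1_raise_a:
  assumes "Re b > 0"
  shows "z * hyp1F1' a b z + a * hyp1F1 a b z = a * hyp1F1 (a + 1) b z"
proof -
  have "(of_nat j + a) * hyp_coeff a b j = a * hyp_coeff (a + 1) b j" for j
  proof -
    have "pochhammer a j * (a + of_nat j) = a * pochhammer (a + 1) j"
      by (metis pochhammer_Suc pochhammer_rec)
    then show ?thesis
      unfolding hyp_coeff_def by (metis (no_types) add.commute mult.commute times_divide_eq_right)
  qed
  then have "(\<lambda>j. of_nat j * hyp_coeff a b j * z ^ j + a * (hyp_coeff a b j * z ^ j)) =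
      (\<lambda>j. a * (hyp_coeff (a + 1) b j * z ^ j))"
    by (metis (no_types) distrib_right mult.assoc)
  then show ?thesis
    using sums_add[OF hyp1F1'_sums[OF assms, of a z] sums_mult[OF hyp1F1_sums[OF assms, of a z], of a]]
      sums_mult[OF hyp1F1_sums[OF assms, of "a + 1" z], of a] by (metis (no_types) sums_unique2)
qed

lemma hyp1F1_lower_a:
  assumes "Re b > 0"
  shows "z * hyp1F1' a b z - z * hyp1F1 a b z + (b - a) * hyp1F1 a b z = (b - a) * hyp1F1 (a - 1) b z"
proof -
  have *: "of_nat j * hyp_coeff a b j - (if j = 0 then 0 else hyp_coeff a b (j - 1)) + (b - a) * hyp_coeff a b j
      = (b - a) * hyp_coeff (a - 1) b j" for j
  proof (cases j)
    case (Suc i)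
    let ?f = "hyp_coeff a b i"
    \<comment> \<open>The common factor of the three coefficients, with the denominators of index i
      + 1 already in place; what remains is a polynomial identity in a, b and i.\<close>
    define f where "f = pochhammer a i / pochhammer b i / fact i / ((b + of_nat i) * of_nat (Suc i))"
    have 1: "hyp_coeff a b (Suc i) = f * (a + of_nat i)"
      by (simp add: hyp_coeff_def f_def pochhammer_Suc mult_ac)
    have 2: "hyp_coeff (a - 1) b (Suc i) = f * (a - 1)"
      by (simp add: hyp_coeff_def f_def pochhammer_rec[of "a - 1"] pochhammer_Suc[of b] mult_ac)
    have 3: "hyp_coeff a b i = f * ((b + of_nat i) * of_nat (Suc i))"
      using shifted_neq_0[OF assms, of i] by (simp add: hyp_coeff_def f_def del: of_nat_Suc)
    show ?thesis by (simp add: Suc 1 2 3 algebra_simps)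
  qed (simp add: hyp_coeff_def)
  have "(\<lambda>j. of_nat j * hyp_coeff a b j * z ^ j - (if j = 0 then 0 else hyp_coeff a b (j - 1)) * z ^ j
        + (b - a) * (hyp_coeff a b j * z ^ j)) = (\<lambda>j. (b - a) * (hyp_coeff (a - 1) b j * z ^ j))"
  proof
    fix j
    show "of_nat j * hyp_coeff a b j * z ^ j - (if j = 0 then 0 else hyp_coeff a b (j - 1)) * z ^ j
        + (b - a) * (hyp_coeff a b j * z ^ j) = (b - a) * (hyp_coeff (a - 1) b j * z ^ j)"
      using arg_cong[OF *[of j], of "\<lambda>x. x * z ^ j"] by (simp only: algebra_simps)
  qed
  then show ?thesis
    using sums_add[OF sums_diff[OF hyp1F1'_sums[OF assms, of a z] hyp1F1_shift_sums[OF assms, of a z]]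
        sums_mult[OF hyp1F1_sums[OF assms, of a z], of "b - a"]]
      sums_mult[OF hyp1F1_sums[OF assms, of "a - 1" z], of "b - a"] by (metis (no_types) sums_unique2)
qed

lemma hyp1F1_lower_b:
  assumes b: "Re b > 1"
  shows "z * hyp1F1' a b z + (b - 1) * hyp1F1 a b z = (b - 1) * hyp1F1 a (b - 1) z"
proof -
  have b0: "Re b > 0" and b1: "Re (b - 1) > 0" using b by auto
  have *: "(of_nat j + (b - 1)) * hyp_coeff a b j = (b - 1) * hyp_coeff a (b - 1) j" for j
  proof -
    have "pochhammer (b - 1) j * (b - 1 + of_nat j) = (b - 1) * pochhammer b j"
      by (metis (no_types) diff_add_cancel pochhammer_Suc pochhammer_rec)
    then show ?thesis
      using pochhammer_neq_0[OF b0, of j] pochhammer_neq_0[OF b1, of j]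
      unfolding hyp_coeff_def by (simp add: divide_simps) (simp add: algebra_simps)
  qed
  then have "(\<lambda>j. of_nat j * hyp_coeff a b j * z ^ j + (b - 1) * (hyp_coeff a b j * z ^ j)) =
      (\<lambda>j. (b - 1) * (hyp_coeff a (b - 1) j * z ^ j))"
    by (metis (no_types) distrib_right mult.assoc)
  then show ?thesis
    using sums_add[OF hyp1F1'_sums[OF b0, of a z] sums_mult[OF hyp1F1_sums[OF b0, of a z], of "b - 1"]]
      sums_mult[OF hyp1F1_sums[OF b1, of a z], of "b - 1"] by (metis (no_types) sums_unique2)
qed

text \<open>Kummer's transformation, which replaces a by b - a and z by -z, turns the formula for
  the derivative into this one, with F' - F in place of F'. Coefficientwise, F' has (a + j) / (b +
  j) times the coefficient of F, and subtracting 1 gives -(b - a) / (b + j).\<close>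

lemma hyp1F1_raise_b:
  assumes b: "Re b > 0"
  shows "hyp1F1' a b z - hyp1F1 a b z = - ((b - a) / b) * hyp1F1 a (b + 1) z"
proof -
  have b1: "Re (b + 1) > 0" using b by auto
  have *: "diffs (hyp_coeff a b) j - hyp_coeff a b j = - ((b - a) / b) * hyp_coeff a (b + 1) j" for j
  proof -
    have "b \<noteq> 0" using shifted_neq_0[OF b, of 0] by simp
    have p: "pochhammer b j * (b + of_nat j) = b * pochhammer (b + 1) j"
      by (metis pochhammer_Suc pochhammer_rec)
    have "diffs (hyp_coeff a b) j - hyp_coeff a b j = hyp_coeff a b j * (- (b - a) / (b + of_nat j))"
    proof -
      have "diffs (hyp_coeff a b) j = hyp_coeff a b j * ((a + of_nat j) / (b + of_nat j))"
        by (simp add: diffs_def hyp_coeff_Suc del: of_nat_Suc)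
      then show ?thesis using shifted_neq_0[OF b, of j] by (simp add: field_simps)
    qed
    also have "\<dots> = - ((b - a) / b) * hyp_coeff a (b + 1) j"
    proof -
      have "pochhammer b j = b * pochhammer (b + 1) j / (b + of_nat j)"
        using p shifted_neq_0[OF b, of j] by (simp add: field_simps)
      then show ?thesis
        using \<open>b \<noteq> 0\<close> shifted_neq_0[OF b, of j] pochhammer_neq_0[OF b1, of j]
        by (simp add: hyp_coeff_def field_simps)
    qed
    finally show ?thesis .
  qed
  have "(\<lambda>j. diffs (hyp_coeff a b) j * z ^ j) sums hyp1F1' a b z"
    using sums_mult[OF hyp1F1_sums[of "b + 1" "a + 1" z], of "a / b"] b
    by (simp add: diffs_hyp_coeff hyp1F1'_def mult_ac)
  from sums_diff[OF this hyp1F1_sums[OF b, of a z]]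
  have "(\<lambda>j. - ((b - a) / b) * (hyp_coeff a (b + 1) j * z ^ j)) sums (hyp1F1' a b z - hyp1F1 a b z)"
    by (simp only: left_diff_distrib[symmetric] * mult.assoc)
  then show ?thesis
    using sums_mult[OF hyp1F1_sums[OF b1, of a z], of "- ((b - a) / b)"] sums_unique2 by blast
qed

text \<open>The image of \<open>hyp1F1_lower_b\<close> under Kummer's transformation. The relations
  come in such pairs because \<open>op_E_plus\<close> leads to F' and \<open>op_E_minus\<close> to
  F' - F.\<close>

lemma hyp1F1_lower_a_b:
  assumes b: "Re b > 1"
  shows "z * hyp1F1' a b z - z * hyp1F1 a b z + (b - 1) * hyp1F1 a b z = (b - 1) * hyp1F1 (a - 1) (b - 1) z"
proof -
  have b0: "Re b > 0" and b1: "Re (b - 1) > 0" using b by auto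
  have *: "of_nat j * hyp_coeff a b j - (if j = 0 then 0 else hyp_coeff a b (j - 1)) + (b - 1) * hyp_coeff a b j
      = (b - 1) * hyp_coeff (a - 1) (b - 1) j" for j
  proof (cases j)
    case (Suc i)
    define f where "f = pochhammer a i / pochhammer b i / fact i / ((b + of_nat i) * of_nat (Suc i))"
    have nz: "b + of_nat i \<noteq> 0" "b - 1 \<noteq> 0"
      using shifted_neq_0[OF b0, of i] shifted_neq_0[OF b1, of 0] by auto
    have 1: "hyp_coeff a b (Suc i) = f * (a + of_nat i)"
      by (simp add: hyp_coeff_def f_def pochhammer_Suc mult_ac)
    have 2: "(b - 1) * hyp_coeff (a - 1) (b - 1) (Suc i) = f * (a - 1) * (b + of_nat i)"
      using nz pochhammer_neq_0[OF b0, of i]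
      by (simp add: hyp_coeff_def f_def pochhammer_rec[of "a - 1"] pochhammer_rec[of "b - 1"] mult_ac)
    have 3: "hyp_coeff a b i = f * ((b + of_nat i) * of_nat (Suc i))"
      using nz by (simp add: hyp_coeff_def f_def del: of_nat_Suc)
    have "of_nat (Suc i) * hyp_coeff a b (Suc i) - hyp_coeff a b i + (b - 1) * hyp_coeff a b (Suc i)
        = f * (a - 1) * (b + of_nat i)"
      by (simp add: 1 3 algebra_simps)
    with 2 show ?thesis by (simp add: Suc)
  qed (simp add: hyp_coeff_def)
  have "(\<lambda>j. of_nat j * hyp_coeff a b j * z ^ j - (if j = 0 then 0 else hyp_coeff a b (j - 1)) * z ^ j
        + (b - 1) * (hyp_coeff a b j * z ^ j)) = (\<lambda>j. (b - 1) * (hyp_coeff (a - 1) (b - 1) j * z ^ j))"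
  proof
    fix j
    show "of_nat j * hyp_coeff a b j * z ^ j - (if j = 0 then 0 else hyp_coeff a b (j - 1)) * z ^ j
        + (b - 1) * (hyp_coeff a b j * z ^ j) = (b - 1) * (hyp_coeff (a - 1) (b - 1) j * z ^ j)"
      using arg_cong[OF *[of j], of "\<lambda>x. x * z ^ j"] by (simp only: algebra_simps)
  qed
  then show ?thesis
    using sums_add[OF sums_diff[OF hyp1F1'_sums[OF b0, of a z] hyp1F1_shift_sums[OF b0, of a z]]
        sums_mult[OF hyp1F1_sums[OF b0, of a z], of "b - 1"]]
      sums_mult[OF hyp1F1_sums[OF b1, of "a - 1" z], of "b - 1"] by (metis (no_types) sums_unique2)
qed

section \<open>Harmonic polynomials\<close>

lemma vec_eq_sum_axis: "y = (\<Sum>j\<in>UNIV. (y $ j) *\<^sub>R axis j (1::real))"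
  by (simp add: vec_eq_iff axis_def if_distrib cong: if_cong)

lemma norm_vec_sq: "(norm (y :: real ^ 'n::finite))\<^sup>2 = (\<Sum>j\<in>UNIV. (y $ j)\<^sup>2)"
  by (simp add: norm_vec_def L2_set_def sum_nonneg)

text \<open>Keeps the embedded square of the norm a single term, the variable x of all radial
  functions below.\<close>

declare of_real_power [simp del]

lemma complex_norm_sq:
  "complex_of_real ((norm (y :: real ^ 'n::finite))\<^sup>2) = (\<Sum>j\<in>UNIV. of_real (y $ j) * of_real (y $ j))"
  by (simp only: norm_vec_sq) (simp add: power2_eq_square)

lemma pdiff_eq:
  assumes "(h has_derivative h') (at y)"
  shows "pdiff j h y = h' (axis j 1)"
proof -
  have 0: "((\<lambda>t::real. y + t *\<^sub>R axis j 1) has_derivative (\<lambda>t. t *\<^sub>R axis j 1)) (at 0)"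
    by (auto intro!: derivative_eq_intros)
  have "((\<lambda>t::real. h (y + t *\<^sub>R axis j 1)) has_derivative (\<lambda>t. h' (t *\<^sub>R axis j 1))) (at 0)"
    by (rule has_derivative_compose[OF 0]) (use assms in simp)
  moreover have "h' (t *\<^sub>R axis j 1) = t *\<^sub>R h' (axis j 1)" for t
    using has_derivative_linear[OF assms] by (rule linear_scale)
  ultimately show ?thesis
    by (simp add: pdiff_def vector_derivative_at has_vector_derivative_def)
qed

lemma derivative_eq_pdiff:
  assumes "(h has_derivative h') (at y)"
  shows "h' v = (\<Sum>j\<in>UNIV. of_real (v $ j) * pdiff j h y)"
proof -
  have lin: "linear h'" by (rule has_derivative_linear[OF assms])
  have "h' v = h' (\<Sum>j\<in>UNIV. (v $ j) *\<^sub>R axis j 1)"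
    using vec_eq_sum_axis[of v] by simp
  also have "\<dots> = (\<Sum>j\<in>UNIV. (v $ j) *\<^sub>R h' (axis j 1))"
    by (simp add: linear_sum[OF lin] linear_scale[OF lin])
  finally show ?thesis by (simp add: pdiff_eq[OF assms] scaleR_conv_of_real)
qed

lemma pdiff_const [simp]: "pdiff j (\<lambda>y. c) = (\<lambda>y. 0)"
  by (intro ext, subst pdiff_eq[OF has_derivative_const]) simp

lemma pdiff_coord: "pdiff j (\<lambda>y. of_real (y $ i)) = (\<lambda>y. if i = j then 1 else 0)"
proof
  fix y
  have "((\<lambda>y. complex_of_real (y $ i)) has_derivative (\<lambda>v. of_real (v $ i))) (at y)"
    by (intro bounded_linear_imp_has_derivative bounded_linear_compose[OF bounded_linear_of_real]
        bounded_linear_vec_nth)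
  from pdiff_eq[OF this] show "pdiff j (\<lambda>y. of_real (y $ i)) y = (if i = j then 1 else 0)"
    by (simp add: axis_def)
qed

lemma pdiff_add:
  assumes "f differentiable (at y)" "g differentiable (at y)"
  shows "pdiff j (\<lambda>y. f y + g y) y = pdiff j f y + pdiff j g y"
proof -
  obtain f' g' where d: "(f has_derivative f') (at y)" "(g has_derivative g') (at y)"
    using assms by (auto simp: differentiable_def)
  show ?thesis
    by (simp add: pdiff_eq[OF d(1)] pdiff_eq[OF d(2)] pdiff_eq[OF has_derivative_add[OF d]])
qed

lemma pdiff_mult:
  fixes f g :: "real ^ 'n::finite \<Rightarrow> complex"
  assumes "f differentiable (at y)" "g differentiable (at y)"
  shows "pdiff j (\<lambda>y. f y * g y) y = pdiff j f y * g y + f y * pdiff j g y"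
proof -
  obtain f' g' where d: "(f has_derivative f') (at y)" "(g has_derivative g') (at y)"
    using assms by (auto simp: differentiable_def)
  show ?thesis
    by (simp add: pdiff_eq[OF d(1)] pdiff_eq[OF d(2)] pdiff_eq[OF has_derivative_mult[OF d]])
qed

text \<open>\<open>polynomial_function\<close> quantifies over all bounded linear functionals and
  offers no induction on the complex-valued function itself. This description does, which is what
  makes differentiability, closure under partial derivatives and their commutation short
  inductions.\<close>

inductive cpoly :: "(real ^ 'n::finite \<Rightarrow> complex) \<Rightarrow> bool" where
  const: "cpoly (\<lambda>y. c)"
| coord: "cpoly (\<lambda>y. of_real (y $ j))"
| add: "cpoly f \<Longrightarrow> cpoly g \<Longrightarrow> cpoly (\<lambda>y. f y + g y)"
| mult: "cpoly f \<Longrightarrow> cpoly g \<Longrightarrow> cpoly (\<lambda>y. f y * g y)"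

lemma cpoly_differentiable:
  assumes "cpoly h"
  shows "h differentiable (at y)"
  using assms
proof induction
  case (coord j)
  have "bounded_linear (\<lambda>y :: real^'a. complex_of_real (y $ j))"
    by (intro bounded_linear_compose[OF bounded_linear_of_real] bounded_linear_vec_nth)
  then show ?case by (rule bounded_linear_imp_differentiable)
qed auto

lemma cpoly_isCont: "cpoly h \<Longrightarrow> isCont h y"
  by (intro differentiable_imp_continuous_within cpoly_differentiable)

lemma cpoly_sum: "(\<And>i. i \<in> S \<Longrightarrow> cpoly (f i)) \<Longrightarrow> cpoly (\<lambda>y. \<Sum>i\<in>S. f i y)"
  by (induction S rule: infinite_finite_induct) (auto intro: cpoly.intros)

lemma cpoly_cmult: "cpoly h \<Longrightarrow> cpoly (\<lambda>y. c * h y)"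
  by (intro cpoly.intros)

lemma cpoly_divide: "cpoly h \<Longrightarrow> cpoly (\<lambda>y. h y / c)"
  using cpoly_cmult[of h "1 / c"] by simp

lemma cpoly_diff: "cpoly f \<Longrightarrow> cpoly g \<Longrightarrow> cpoly (\<lambda>y. f y - g y)"
  using cpoly.add[OF _ cpoly_cmult, of f g "-1"] by simp

lemma cpoly_uminus: "cpoly f \<Longrightarrow> cpoly (\<lambda>y. - f y)"
  using cpoly_cmult[of f "-1"] by simp

lemma cpoly_power: "cpoly f \<Longrightarrow> cpoly (\<lambda>y. f y ^ d)"
  by (induction d) (auto intro: cpoly.intros)

lemma cpoly_norm_sq: "cpoly (\<lambda>y :: real ^ 'n::finite. of_real ((norm y)\<^sup>2))"
proof -
  have "cpoly (\<lambda>y :: real ^ 'n. \<Sum>j\<in>UNIV. of_real (y $ j) * of_real (y $ j))"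
    by (intro cpoly_sum cpoly.intros)
  then show ?thesis by (simp add: complex_norm_sq)
qed

lemma cpoly_linear:
  assumes "bounded_linear f"
  shows "cpoly (\<lambda>y :: real ^ 'n::finite. complex_of_real (f y))"
proof -
  interpret bounded_linear f by fact
  have f_eq: "f y = (\<Sum>j\<in>UNIV. f (axis j 1) * (y $ j))" for y
  proof -
    have "f y = f (\<Sum>j\<in>UNIV. (y $ j) *\<^sub>R axis j 1)"
      using vec_eq_sum_axis[of y] by simp
    also have "\<dots> = (\<Sum>j\<in>UNIV. f (axis j 1) * (y $ j))"
      by (simp add: sum scaleR mult.commute)
    finally show ?thesis .
  qed
  have "(\<lambda>y. complex_of_real (f y)) = (\<lambda>y. \<Sum>j\<in>UNIV. of_real (f (axis j 1)) * of_real (y $ j))"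
    by (rule ext, subst f_eq) simp
  then show ?thesis by (simp only:) (rule cpoly_sum, rule cpoly.mult[OF cpoly.const cpoly.coord])
qed

lemmas cpoly_intros = cpoly.intros cpoly_sum cpoly_diff cpoly_divide cpoly_uminus cpoly_power
  cpoly_norm_sq cpoly_linear

lemma polynomial_function_iff_cpoly:
  "polynomial_function h \<longleftrightarrow> cpoly (h :: real ^ 'n::finite \<Rightarrow> complex)"
proof
  assume h: "polynomial_function h"
  have real: "cpoly (\<lambda>y. complex_of_real (r y))" if "real_polynomial_function r" for r :: "real ^ 'n \<Rightarrow> real"
    using that by induction (auto intro: cpoly_intros)
  have "real_polynomial_function (\<lambda>y. Re (h y))" "real_polynomial_function (\<lambda>y. Im (h y))"
    using h bounded_linear_Re bounded_linear_Im by (auto simp: polynomial_function_def o_def)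
  then have "cpoly (\<lambda>y. complex_of_real (Re (h y)) + \<i> * complex_of_real (Im (h y)))"
    by (intro cpoly.intros real)
  then show "cpoly h" by (simp add: complex_eq[symmetric])
next
  assume "cpoly h"
  then have re_im: "real_polynomial_function (\<lambda>y. Re (h y)) \<and> real_polynomial_function (\<lambda>y. Im (h y))"
  proof induction
    case (coord j)
    show ?case by (auto intro!: real_polynomial_function.intros bounded_linear_vec_nth)
  next
    case (mult f g)
    then show ?case
      by (auto intro!: real_polynomial_function_diff real_polynomial_function.intros(3,4))
  qed (auto intro: real_polynomial_function.intros)
  \<comment> \<open>Every real-linear functional on the complex numbers is a combination of real and
    imaginary part, so these two parts decide about all functionals.\<close>
  have lin: "f (h y) = Re (h y) * f 1 + Im (h y) * f \<i>" if "bounded_linear f" for f :: "complex \<Rightarrow> real" and y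
  proof -
    interpret bounded_linear f by fact
    have "f (h y) = f (Re (h y) *\<^sub>R 1 + Im (h y) *\<^sub>R \<i>)"
      by (rule arg_cong[where f = f]) (simp add: complex_eq_iff)
    then show ?thesis by (simp add: add scaleR)
  qed
  show "polynomial_function h"
    unfolding polynomial_function_def o_def
  proof (intro allI impI)
    fix f :: "complex \<Rightarrow> real"
    assume "bounded_linear f"
    then have "(\<lambda>y. f (h y)) = (\<lambda>y. Re (h y) * f 1 + Im (h y) * f \<i>)"
      by (intro ext lin)
    then show "real_polynomial_function (\<lambda>y. f (h y))"
      using re_im by (simp only:) (auto intro!: real_polynomial_function.intros(2-4))
  qed
qed

lemma cpoly_pdiff_add:
  assumes "cpoly f" "cpoly g"
  shows "pdiff j (\<lambda>y. f y + g y) = (\<lambda>y. pdiff j f y + pdiff j g y)"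
  using assms by (simp add: fun_eq_iff pdiff_add cpoly_differentiable)

lemma cpoly_pdiff_mult:
  assumes "cpoly f" "cpoly g"
  shows "pdiff j (\<lambda>y. f y * g y) = (\<lambda>y. pdiff j f y * g y + f y * pdiff j g y)"
  using assms by (simp add: fun_eq_iff pdiff_mult cpoly_differentiable)

lemma cpoly_pdiff: "cpoly h \<Longrightarrow> cpoly (pdiff j h)"
proof (induction rule: cpoly.induct)
  case (coord i)
  then show ?case by (simp add: pdiff_coord cpoly.const)
qed (auto simp: cpoly_pdiff_add cpoly_pdiff_mult intro: cpoly.intros)

lemma pdiff_commute: "cpoly h \<Longrightarrow> pdiff i (pdiff j h) = pdiff j (pdiff i h)"
proof (induction rule: cpoly.induct)
  case (coord l)
  then show ?case by (simp add: pdiff_coord)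
next
  case (mult f g)
  then show ?case
    by (simp add: cpoly_pdiff_add cpoly_pdiff_mult cpoly_pdiff cpoly.intros fun_eq_iff)
qed (auto simp: cpoly_pdiff_add cpoly_pdiff)

lemma cpoly_pdiff_cmult: "cpoly h \<Longrightarrow> pdiff j (\<lambda>y. c * h y) = (\<lambda>y. c * pdiff j h y)"
  by (simp add: cpoly_pdiff_mult cpoly.const)

lemma cpoly_pdiff_divide: "cpoly h \<Longrightarrow> pdiff j (\<lambda>y. h y / c) = (\<lambda>y. pdiff j h y / c)"
  using cpoly_pdiff_cmult[of h j "1 / c"] by simp

lemma cpoly_pdiff_diff:
  "cpoly f \<Longrightarrow> cpoly g \<Longrightarrow> pdiff j (\<lambda>y. f y - g y) = (\<lambda>y. pdiff j f y - pdiff j g y)"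
  using cpoly_pdiff_add[of f "\<lambda>y. -1 * g y" j] cpoly_pdiff_cmult[of g j "-1"] cpoly_cmult[of g "-1"]
  by simp

lemma cpoly_pdiff_uminus: "cpoly f \<Longrightarrow> pdiff j (\<lambda>y. - f y) = (\<lambda>y. - pdiff j f y)"
  using cpoly_pdiff_cmult[of f j "-1"] by simp

lemma cpoly_pdiff_sum:
  "(\<And>i. i \<in> S \<Longrightarrow> cpoly (f i)) \<Longrightarrow> pdiff j (\<lambda>y. \<Sum>i\<in>S. f i y) = (\<lambda>y. \<Sum>i\<in>S. pdiff j (f i) y)"
  by (induction S rule: infinite_finite_induct) (auto simp: cpoly_pdiff_add cpoly_sum)

lemma cpoly_pdiff_power:
  "cpoly f \<Longrightarrow> pdiff j (\<lambda>y. f y ^ d) = (\<lambda>y. of_nat d * f y ^ (d - 1) * pdiff j f y)"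
proof (induction d)
  case (Suc d)
  then have "pdiff j (\<lambda>y. f y ^ Suc d) =
      (\<lambda>y. pdiff j f y * f y ^ d + f y * (of_nat d * f y ^ (d - 1) * pdiff j f y))"
    by (simp add: cpoly_pdiff_mult cpoly_power)
  also have "\<dots> = (\<lambda>y. of_nat (Suc d) * f y ^ (Suc d - 1) * pdiff j f y)"
    by (cases d) (auto simp: fun_eq_iff algebra_simps)
  finally show ?case .
qed auto

lemma sum_delta_mult: 
  fixes f :: "'n::finite \<Rightarrow> complex"
  shows "(\<Sum>i\<in>UNIV. (if j = i then 1 else 0) * f i) = f j"
    "(\<Sum>i\<in>UNIV. (if i = j then 1 else 0) * f i) = f j"
    "(\<Sum>i\<in>UNIV. f i * (if j = i then 1 else 0)) = f j"
    "(\<Sum>i\<in>UNIV. f i * (if i = j then 1 else 0)) = f j"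
  by (simp_all add: if_distrib[of "\<lambda>x. x * _"] if_distrib[of "\<lambda>x. _ * x"] cong: if_cong)

lemma pdiff_norm_sq:
  "pdiff j (\<lambda>y :: real ^ 'n::finite. of_real ((norm y)\<^sup>2)) = (\<lambda>y. 2 * of_real (y $ j))"
proof -
  have "pdiff j (\<lambda>y :: real ^ 'n. \<Sum>i\<in>UNIV. (of_real (y $ i) :: complex) * of_real (y $ i))
      = (\<lambda>y. \<Sum>i\<in>UNIV. (if i = j then 1 else 0) * of_real (y $ i) + of_real (y $ i) * (if i = j then 1 else 0))"
    by (simp add: cpoly_pdiff_sum cpoly_pdiff_mult pdiff_coord cpoly.intros)
  also have "\<dots> = (\<lambda>y. 2 * of_real (y $ j))"
    by (simp add: fun_eq_iff sum.distrib sum_delta_mult flip: sum_distrib_left)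
  finally show ?thesis by (simp add: complex_norm_sq)
qed

lemmas pdiff_simps = cpoly_pdiff_add cpoly_pdiff_mult cpoly_pdiff_divide cpoly_pdiff_diff
  cpoly_pdiff_uminus cpoly_pdiff_sum pdiff_coord pdiff_norm_sq

definition lap :: "(real ^ 'n::finite \<Rightarrow> complex) \<Rightarrow> real ^ 'n \<Rightarrow> complex" where
  "lap h y = (\<Sum>j\<in>UNIV. pdiff j (pdiff j h) y)"

definition homog :: "nat \<Rightarrow> (real ^ 'n::finite \<Rightarrow> complex) \<Rightarrow> bool" where
  "homog d h \<longleftrightarrow> (\<forall>t y. h (t *\<^sub>R y) = of_real (t ^ d) * h y)"

lemma harmonic_poly_iff: "harmonic_poly d h \<longleftrightarrow> cpoly h \<and> homog d h \<and> (\<forall>y. lap h y = 0)"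
  by (simp add: harmonic_poly_def polynomial_function_iff_cpoly homog_def lap_def)

lemma euler_homog:
  assumes "cpoly h" "homog d h"
  shows "(\<Sum>j\<in>UNIV. of_real (y $ j) * pdiff j h y) = of_nat d * h y"
proof -
  obtain h' where h': "(h has_derivative h') (at y)"
    using cpoly_differentiable[OF assms(1)] by (auto simp: differentiable_def)
  have 0: "((\<lambda>t::real. t *\<^sub>R y) has_derivative (\<lambda>t. t *\<^sub>R y)) (at 1)"
    by (auto intro!: derivative_eq_intros)
  have "((\<lambda>t::real. h (t *\<^sub>R y)) has_derivative (\<lambda>t. h' (t *\<^sub>R y))) (at 1)"
    by (rule has_derivative_compose[OF 0]) (use h' in simp)
  then have "((\<lambda>t::real. h (t *\<^sub>R y)) has_vector_derivative h' y) (at 1)"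
    by (simp add: has_vector_derivative_def linear_scale[OF has_derivative_linear[OF h']])
  moreover have "((\<lambda>t::real. h (t *\<^sub>R y)) has_vector_derivative of_nat d * h y) (at 1)"
  proof -
    have "((\<lambda>t::real. complex_of_real (t ^ d)) has_vector_derivative complex_of_real (of_nat d)) (at 1)"
      by (rule has_vector_derivative_of_real) (auto intro!: derivative_eq_intros)
    from has_vector_derivative_mult_left[OF this, of "h y"] show ?thesis
      using assms(2) by (simp add: homog_def)
  qed
  ultimately have "h' y = of_nat d * h y" by (rule vector_derivative_unique_at)
  then show ?thesis by (simp add: derivative_eq_pdiff[OF h'])
qed

lemma homog_0: "homog 0 h \<Longrightarrow> h = (\<lambda>y. h 0)"
proof
  fix y
  assume "homog 0 h"
  then have "h (0 *\<^sub>R y) = of_real (0 ^ 0) * h y" unfolding homog_def by blast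
  then show "h y = h 0" by simp
qed

text \<open>Differentiating h(t y) with respect to y by the chain rule and by homogeneity gives the
  claim multiplied by t. The division by t leaves t = 0 to a limit.\<close>

lemma homog_pdiff:
  assumes h: "cpoly h" "homog (Suc d) h"
  shows "homog d (pdiff j h)"
  unfolding homog_def
proof (intro allI)
  fix t :: real and y
  have nz: "pdiff j h (t *\<^sub>R y) = of_real (t ^ d) * pdiff j h y" if "t \<noteq> 0" for t
  proof -
    obtain h' where h': "(h has_derivative h') (at (t *\<^sub>R y))"
      using cpoly_differentiable[OF h(1)] by (auto simp: differentiable_def)
    have 0: "((\<lambda>y. t *\<^sub>R y) has_derivative (\<lambda>v. t *\<^sub>R v)) (at y)"
      by (auto intro!: derivative_eq_intros)
    have "((\<lambda>y. h (t *\<^sub>R y)) has_derivative (\<lambda>v. h' (t *\<^sub>R v))) (at y)"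
      by (rule has_derivative_compose[OF 0]) (use h' in simp)
    have "pdiff j (\<lambda>y. h (t *\<^sub>R y)) y = h' (t *\<^sub>R axis j 1)"
      by (rule pdiff_eq) fact
    also have "\<dots> = t *\<^sub>R h' (axis j 1)"
      by (rule linear_scale[OF has_derivative_linear[OF h']])
    also have "\<dots> = of_real t * pdiff j h (t *\<^sub>R y)"
      by (simp add: pdiff_eq[OF h'] scaleR_conv_of_real[of t "h' _"])
    finally have "pdiff j (\<lambda>y. h (t *\<^sub>R y)) y = of_real t * pdiff j h (t *\<^sub>R y)" .
    moreover have "pdiff j (\<lambda>y. h (t *\<^sub>R y)) y = of_real (t ^ Suc d) * pdiff j h y"
      using h by (simp add: homog_def cpoly_pdiff_cmult)
    ultimately show ?thesis using that by simp
  qed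
  show "pdiff j h (t *\<^sub>R y) = of_real (t ^ d) * pdiff j h y"
  proof (cases "t = 0")
    case True
    have "isCont (\<lambda>t. pdiff j h (t *\<^sub>R y)) (0::real)"
      by (rule isCont_o2[where g = "pdiff j h"]) (auto intro!: cpoly_isCont cpoly_pdiff h(1))
    then have 1: "((\<lambda>t. pdiff j h (t *\<^sub>R y)) \<longlongrightarrow> pdiff j h (0 *\<^sub>R y)) (at (0::real))"
      unfolding isCont_def .
    have "((\<lambda>t::real. complex_of_real (t ^ d) * pdiff j h y) \<longlongrightarrow> of_real (0 ^ d) * pdiff j h y) (at 0)"
      by (intro tendsto_intros)
    then have 2: "((\<lambda>t. pdiff j h (t *\<^sub>R y)) \<longlongrightarrow> of_real (0 ^ d) * pdiff j h y) (at (0::real))"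
      by (rule Lim_transform_eventually) (auto simp: eventually_at_filter nz)
    show ?thesis using tendsto_unique[OF _ 1 2] True by simp
  qed (rule nz)
qed

lemma lap_pdiff:
  assumes "cpoly h"
  shows "lap (pdiff j h) y = pdiff j (lap h) y"
proof -
  have "pdiff i (pdiff i (pdiff j h)) = pdiff j (pdiff i (pdiff i h))" for i
    by (simp only: pdiff_commute[OF assms, of i j] pdiff_commute[OF cpoly_pdiff[OF assms], of i j i])
  moreover have "lap h = (\<lambda>y. \<Sum>i\<in>UNIV. pdiff i (pdiff i h) y)"
    by (simp add: lap_def fun_eq_iff)
  ultimately show ?thesis
    by (simp add: lap_def cpoly_pdiff_sum cpoly_pdiff assms)
qed

lemma harmonic_poly_0: "harmonic_poly 0 h \<Longrightarrow> h = (\<lambda>y. h 0)"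
  by (simp add: harmonic_poly_iff homog_0)

lemma harmonic_poly_const: "harmonic_poly 0 (\<lambda>y. c)"
  by (simp add: harmonic_poly_iff homog_def lap_def cpoly.const)

lemma harmonic_poly_pdiff:
  assumes "harmonic_poly (Suc d) h"
  shows "harmonic_poly d (pdiff j h)"
proof -
  have h: "cpoly h" "homog (Suc d) h" "lap h = (\<lambda>y. 0)"
    using assms by (auto simp: harmonic_poly_iff fun_eq_iff)
  show ?thesis
    using h by (simp add: harmonic_poly_iff cpoly_pdiff homog_pdiff lap_pdiff)
qed

lemma harmonic_poly_zero: "harmonic_poly d (\<lambda>y. 0)"
  by (simp add: harmonic_poly_iff homog_def lap_def cpoly.const)

lemma harmonic_poly_add:
  "harmonic_poly d f \<Longrightarrow> harmonic_poly d g \<Longrightarrow> harmonic_poly d (\<lambda>y. f y + g y)"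
  by (simp add: harmonic_poly_iff homog_def lap_def cpoly.add cpoly_pdiff_add cpoly_pdiff
      sum.distrib algebra_simps)

lemma harmonic_poly_cmult: "harmonic_poly d f \<Longrightarrow> harmonic_poly d (\<lambda>y. c * f y)"
  by (simp add: harmonic_poly_iff homog_def lap_def cpoly_cmult cpoly_pdiff_cmult cpoly_pdiff
      sum_distrib_left[symmetric] mult_ac)

text \<open>\<open>y\<^sub>j h = h_up j d h + \<parallel>y\<parallel>\<^sup>2 h_down j d h\<close> is the harmonic decomposition of \<open>y\<^sub>j h\<close> for
  \<open>h\<close> harmonic of degree \<open>d\<close>. For \<open>d = 0\<close> the numerator of \<open>h_down\<close> vanishes, so the value of the
  denominator, which can be \<open>0\<close>, is irrelevant.\<close>

definition h_down :: "'n::finite \<Rightarrow> nat \<Rightarrow> (real ^ 'n \<Rightarrow> complex) \<Rightarrow> real ^ 'n \<Rightarrow> complex" where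
  "h_down j d h y = pdiff j h y / (of_nat CARD('n) + 2 * of_nat d - 2)"

definition h_up :: "'n::finite \<Rightarrow> nat \<Rightarrow> (real ^ 'n \<Rightarrow> complex) \<Rightarrow> real ^ 'n \<Rightarrow> complex" where
  "h_up j d h y = of_real (y $ j) * h y - of_real ((norm y)\<^sup>2) * h_down j d h y"

lemma up_down_denominator:
  fixes d :: nat
  assumes "d \<ge> 1"
  shows "(of_nat CARD('n::finite) + 2 * of_nat d - 2 :: complex) \<noteq> 0"
proof -
  have "(of_nat CARD('n) + 2 * of_nat d - 2 :: complex) = of_nat (CARD('n) + 2 * d - 2)"
    using assms by (simp add: of_nat_diff)
  moreover have "CARD('n) + 2 * d - 2 \<noteq> 0" using assms zero_less_card_finite[where 'a='n] by linarith
  ultimately show ?thesis by (metis of_nat_eq_0_iff)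
qed

lemma pdiff_eq_h_down:
  fixes h :: "real ^ 'n::finite \<Rightarrow> complex"
  assumes "harmonic_poly d h"
  shows "pdiff j h y = (of_nat CARD('n) + 2 * of_nat d - 2) * h_down j d h y"
proof (cases "d = 0")
  case True
  with assms have "h = (\<lambda>y. h 0)" by (simp add: harmonic_poly_0)
  then have "pdiff j h y = 0" by (metis pdiff_const)
  then show ?thesis by (simp add: h_down_def)
next
  case False
  then show ?thesis using up_down_denominator[where 'n='n, of d] by (simp add: h_down_def)
qed

lemma mult_coord_eq: "of_real (y $ j) * h y = h_up j d h y + of_real ((norm y)\<^sup>2) * h_down j d h y"
  by (simp add: h_up_def)

lemma harmonic_poly_h_down:
  assumes "harmonic_poly (Suc d) h"
  shows "harmonic_poly d (h_down j (Suc d) h)"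
  using harmonic_poly_cmult[OF harmonic_poly_pdiff[OF assms, of j], of "1 / (of_nat CARD('a) + 2 * of_nat (Suc d) - 2)"]
  unfolding h_down_def[abs_def] by simp

lemma h_down_0: "harmonic_poly 0 h \<Longrightarrow> h_down j 0 h = (\<lambda>y. 0)"
  using pdiff_const[of j "h 0"] harmonic_poly_0[of h] by (simp add: h_down_def[abs_def])

lemma lap_mult_coord:
  assumes "cpoly h"
  shows "lap (\<lambda>y. of_real (y $ j) * h y) y = 2 * pdiff j h y + of_real (y $ j) * lap h y"
  using assms
  by (simp add: lap_def pdiff_simps cpoly_pdiff cpoly.intros sum.distrib sum_distrib_left[symmetric]
      sum_delta_mult)

lemma lap_mult_norm_sq:
  fixes g :: "real ^ 'n::finite \<Rightarrow> complex"
  assumes g: "cpoly g"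
  shows "lap (\<lambda>y. of_real ((norm y)\<^sup>2) * g y) y =
    2 * of_nat CARD('n) * g y + 4 * (\<Sum>j\<in>UNIV. of_real (y $ j) * pdiff j g y) + of_real ((norm y)\<^sup>2) * lap g y"
proof -
  have "pdiff i (pdiff i (\<lambda>y. of_real ((norm y)\<^sup>2) * g y)) =
      (\<lambda>y. 2 * g y + 4 * (of_real (y $ i) * pdiff i g y) + of_real ((norm y)\<^sup>2) * pdiff i (pdiff i g) y)" for i
  proof -
    have "pdiff i (\<lambda>y. of_real ((norm y)\<^sup>2) * g y) =
        (\<lambda>y. 2 * (of_real (y $ i) * g y) + of_real ((norm y)\<^sup>2) * pdiff i g y)"
      by (subst cpoly_pdiff_mult) (auto simp: g cpoly_norm_sq pdiff_norm_sq mult.assoc simp del: of_real_power)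
    moreover have "pdiff i \<dots> = (\<lambda>y. 2 * g y + 4 * (of_real (y $ i) * pdiff i g y) + of_real ((norm y)\<^sup>2) * pdiff i (pdiff i g) y)"
      by (simp add: pdiff_simps g cpoly_pdiff cpoly_intros fun_eq_iff algebra_simps del: of_real_power)
    ultimately show ?thesis by simp
  qed
  then show ?thesis
    by (simp add: lap_def sum.distrib sum_distrib_left del: of_real_power)
qed

text \<open>The Laplacian of \<open>y $ j * h\<close> is twice the j-th partial derivative of h. By
  \<open>lap_mult_norm_sq\<close> and Euler's identity in degree d - 1, the Laplacian of the
  subtracted term is 2(n + 2d - 2) times \<open>h_down\<close>, which is the same by the choice of
  the denominator.\<close>

lemma harmonic_poly_h_up:
  fixes h :: "real ^ 'n::finite \<Rightarrow> complex"
  assumes "harmonic_poly d h"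
  shows "harmonic_poly (Suc d) (h_up j d h)"
proof -
  have h: "cpoly h" "homog d h" "\<And>y. lap h y = 0"
    using assms by (auto simp: harmonic_poly_iff)
  have dn: "cpoly (h_down j d h)"
    unfolding h_down_def[abs_def] by (intro cpoly_divide cpoly_pdiff h)
  have up: "h_up j d h = (\<lambda>y. of_real (y $ j) * h y - of_real ((norm y)\<^sup>2) * h_down j d h y)"
    by (simp add: h_up_def fun_eq_iff)
  have "lap (h_up j d h) y = 2 * pdiff j h y - lap (\<lambda>y. of_real ((norm y)\<^sup>2) * h_down j d h y) y" for y
    using lap_mult_coord[OF h(1), of j y] h dn unfolding up lap_def
    by (simp add: cpoly_pdiff_diff cpoly_pdiff cpoly_intros sum_subtractf del: of_real_power)
  moreover have "lap (\<lambda>y. of_real ((norm y)\<^sup>2) * h_down j d h y) y = 2 * pdiff j h y" for y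
  proof (cases d)
    case 0
    then show ?thesis using assms pdiff_eq_h_down[OF assms, of j y]
      by (simp add: h_down_0 lap_def)
  next
    case (Suc e)
    then have "harmonic_poly e (h_down j d h)" using assms by (simp add: harmonic_poly_h_down)
    then have "(\<Sum>i\<in>UNIV. of_real (y $ i) * pdiff i (h_down j d h) y) = of_nat e * h_down j d h y"
      "lap (h_down j d h) y = 0"
      by (auto simp: harmonic_poly_iff euler_homog)
    then show ?thesis
      by (subst lap_mult_norm_sq[OF dn]) (simp add: pdiff_eq_h_down[OF assms] Suc algebra_simps)
  qed
  moreover have "homog (Suc d) (h_up j d h)"
  proof (cases d)
    case 0
    then show ?thesis using assms h(2) by (simp add: h_up_def homog_def h_down_0)
  next
    case (Suc e)
    then have "homog e (h_down j d h)" using harmonic_poly_h_down[of e h j] assms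
      by (simp add: harmonic_poly_iff)
    then show ?thesis using h(2) Suc
      by (simp add: h_up_def homog_def power_mult_distrib power2_eq_square algebra_simps)
        (auto simp flip: of_real_mult)
  qed
  moreover have "cpoly (h_up j d h)"
    unfolding up by (intro cpoly_intros h dn)
  ultimately show ?thesis by (simp add: harmonic_poly_iff)
qed

text \<open>The raised functions span the harmonic polynomials of the next degree; with \<open>exists_pdiff_nonzero\<close>
  this stands in for the irreducibility of the spaces of harmonic polynomials under \<open>so(n)\<close>.\<close>

lemma sum_h_up_pdiff:
  assumes "harmonic_poly (Suc d) h"
  shows "(\<Sum>j\<in>UNIV. h_up j d (pdiff j h) y) = of_nat (Suc d) * h y"
    and "(\<Sum>j\<in>UNIV. h_down j d (pdiff j h) y) = 0"
proof -
  have h: "cpoly h" "homog (Suc d) h" "\<And>y. lap h y = 0"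
    using assms by (auto simp: harmonic_poly_iff)
  show 1: "(\<Sum>j\<in>UNIV. h_down j d (pdiff j h) y) = 0"
    using h(3)[of y] by (simp add: h_down_def lap_def sum_divide_distrib[symmetric])
  show "(\<Sum>j\<in>UNIV. h_up j d (pdiff j h) y) = of_nat (Suc d) * h y"
    using euler_homog[OF h(1,2), of y] 1
    by (simp add: h_up_def sum_subtractf sum_distrib_left[symmetric] del: of_real_power)
qed

lemma exists_pdiff_nonzero:
  assumes "harmonic_poly (Suc d) h" "h \<noteq> (\<lambda>y. 0)"
  shows "\<exists>j. pdiff j h \<noteq> (\<lambda>y. 0)"
proof (rule ccontr)
  assume "\<nexists>j. pdiff j h \<noteq> (\<lambda>y. 0)"
  then have "of_nat (Suc d) * h y = 0" for y
    using euler_homog[of h "Suc d" y] assms by (simp add: harmonic_poly_iff)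
  then have "h y = 0" for y by (simp del: of_nat_Suc)
  then show False using assms(2) by auto
qed

text \<open>On a line h'' = 0. Euler's identity for h', of degree d - 1 > 0, gives h' = 0, and
  Euler's identity for h then gives h = 0.\<close>

lemma harmonic_poly_dim_1:
  fixes h :: "real ^ 'n::finite \<Rightarrow> complex"
  assumes "CARD('n) = 1" "harmonic_poly d h" "d \<ge> 2"
  shows "h = (\<lambda>y. 0)"
proof -
  define e where "e = d - 2"
  have d: "d = Suc (Suc e)" using assms(3) by (simp add: e_def)
  obtain j :: 'n where U: "UNIV = {j}" using assms(1) by (metis card_1_singletonE)
  have h: "cpoly h" "homog d h" "\<And>y. lap h y = 0"
    using assms(2) by (auto simp: harmonic_poly_iff)
  have "pdiff j (pdiff j h) y = 0" for y using h(3)[of y] by (simp add: lap_def U)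
  moreover have "homog (Suc e) (pdiff j h)" using h d by (simp add: homog_pdiff)
  ultimately have "pdiff j h y = 0" for y
    using euler_homog[OF cpoly_pdiff[OF h(1)], of "Suc e" j y]
    by (simp add: U del: of_nat_Suc)
  then have "h y = 0" for y
    using euler_homog[OF h(1,2), of y] d by (simp add: U del: of_nat_Suc)
  then show ?thesis by auto
qed

section \<open>Infinitesimal rotations and the Casimir operator\<close>

definition rot :: "real ^ 'n ^ 'n \<Rightarrow> (real ^ 'n::finite \<Rightarrow> complex) \<Rightarrow> real ^ 'n \<Rightarrow> complex" where
  "rot A h y = - (\<Sum>j\<in>UNIV. of_real ((A *v y) $ j) * pdiff j h y)"

lemma skew_sum_zero:
  fixes f :: "'n::finite \<Rightarrow> 'n \<Rightarrow> complex"
  assumes "transpose A = - A" "\<And>i j. f i j = f j i"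
  shows "(\<Sum>i\<in>UNIV. \<Sum>j\<in>UNIV. of_real (A $ i $ j) * f i j) = 0"
proof -
  let ?S = "\<Sum>i\<in>UNIV. \<Sum>j\<in>UNIV. of_real (A $ i $ j) * f i j"
  have A: "A $ i $ j = - (A $ j $ i)" for i j
    using arg_cong[OF assms(1), of "\<lambda>B. B $ j $ i"] by (simp add: transpose_def)
  have "?S = (\<Sum>i\<in>UNIV. \<Sum>j\<in>UNIV. - (of_real (A $ j $ i) * f j i))"
  proof (intro sum.cong refl)
    fix i j
    show "of_real (A $ i $ j) * f i j = - (of_real (A $ j $ i) * f j i)"
      using A[of i j] assms(2)[of i j] by simp
  qed
  also have "\<dots> = - (\<Sum>j\<in>UNIV. \<Sum>i\<in>UNIV. of_real (A $ j $ i) * f j i)"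
    by (subst sum.swap) (simp add: sum_negf)
  finally show ?thesis by simp
qed

text \<open>The Laplacian commutes with \<open>rot A\<close>: the commutator is a contraction of the
  skew matrix A with the symmetric matrix of second derivatives of h, hence zero by
  \<open>skew_sum_zero\<close>.\<close>

lemma harmonic_poly_rot:
  fixes h :: "real ^ 'n::finite \<Rightarrow> complex"
  assumes "harmonic_poly d h" and A: "transpose A = - A"
  shows "harmonic_poly d (rot A h)"
proof -
  have h: "cpoly h" "homog d h" "lap h = (\<lambda>y. 0)"
    using assms by (auto simp: harmonic_poly_iff)
  define a where "a j = (\<lambda>y :: real ^ 'n. \<Sum>l\<in>UNIV. of_real (A $ j $ l) * complex_of_real (y $ l))" for j
  have rot: "rot A h = (\<lambda>y. - (\<Sum>j\<in>UNIV. a j y * pdiff j h y))"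
    by (simp add: rot_def fun_eq_iff a_def matrix_vector_mult_def)
  have a: "cpoly (a j)" for j unfolding a_def by (intro cpoly_intros)
  have pa: "pdiff i (a j) = (\<lambda>y. of_real (A $ j $ i))" for i j
  proof -
    have "pdiff i (a j) = (\<lambda>y. \<Sum>l\<in>UNIV. of_real (A $ j $ l) * (if l = i then 1 else 0))"
      unfolding a_def by (simp add: cpoly_pdiff_sum cpoly_pdiff_mult pdiff_coord cpoly.intros)
    then show ?thesis by (simp add: sum_delta_mult)
  qed
  have cp: "cpoly (rot A h)"
    unfolding rot by (intro cpoly_intros a cpoly_pdiff h)
  have "pdiff i (pdiff i (rot A h)) = (\<lambda>y. - (\<Sum>j\<in>UNIV. 2 * (of_real (A $ j $ i) * pdiff i (pdiff j h) y)
      + a j y * pdiff j (pdiff i (pdiff i h)) y))" for i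
  proof -
    have "pdiff i (rot A h) = (\<lambda>y. - (\<Sum>j\<in>UNIV. of_real (A $ j $ i) * pdiff j h y + a j y * pdiff i (pdiff j h) y))"
      unfolding rot
      by (simp add: cpoly_pdiff_uminus cpoly_pdiff_sum cpoly_pdiff_mult cpoly_pdiff a pa h cpoly_intros)
    moreover have "pdiff i \<dots> = (\<lambda>y. - (\<Sum>j\<in>UNIV. 2 * (of_real (A $ j $ i) * pdiff i (pdiff j h) y)
      + a j y * pdiff i (pdiff i (pdiff j h)) y))"
      by (simp add: cpoly_pdiff_uminus cpoly_pdiff_sum cpoly_pdiff_mult cpoly_pdiff_add cpoly_pdiff a pa h
          cpoly_intros fun_eq_iff algebra_simps)
    moreover have "pdiff i (pdiff i (pdiff j h)) = pdiff j (pdiff i (pdiff i h))" for j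
      by (simp only: pdiff_commute[OF h(1), of i j] pdiff_commute[OF cpoly_pdiff[OF h(1)], of i j i])
    ultimately show ?thesis by simp
  qed
  then have "lap (rot A h) y = - (2 * (\<Sum>i\<in>UNIV. \<Sum>j\<in>UNIV. of_real (A $ j $ i) * pdiff i (pdiff j h) y)
      + (\<Sum>i\<in>UNIV. \<Sum>j\<in>UNIV. a j y * pdiff j (pdiff i (pdiff i h)) y))" for y
    by (simp add: lap_def sum_negf sum_subtractf sum.distrib sum_distrib_left)
  moreover have "(\<Sum>i\<in>UNIV. \<Sum>j\<in>UNIV. of_real (A $ j $ i) * pdiff i (pdiff j h) y) = 0" for y
  proof -
    have "(\<Sum>i\<in>UNIV. \<Sum>j\<in>UNIV. of_real (A $ j $ i) * pdiff i (pdiff j h) y)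
        = (\<Sum>j\<in>UNIV. \<Sum>i\<in>UNIV. of_real (A $ j $ i) * pdiff i (pdiff j h) y)"
      by (rule sum.swap)
    also have "\<dots> = 0"
      by (rule skew_sum_zero[OF A]) (simp add: pdiff_commute[OF h(1)])
    finally show ?thesis .
  qed
  moreover have "(\<Sum>i\<in>UNIV. \<Sum>j\<in>UNIV. a j y * pdiff j (pdiff i (pdiff i h)) y) = 0" for y
  proof -
    have "(\<Sum>i\<in>UNIV. pdiff j (pdiff i (pdiff i h)) y) = 0" for j
    proof -
      have "(\<Sum>i\<in>UNIV. pdiff j (pdiff i (pdiff i h)) y) = pdiff j (\<lambda>y. \<Sum>i\<in>UNIV. pdiff i (pdiff i h) y) y"
        by (simp add: cpoly_pdiff_sum cpoly_pdiff h)
      also have "(\<lambda>y. \<Sum>i\<in>UNIV. pdiff i (pdiff i h) y) = (\<lambda>y. 0)"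
        using h(3) by (simp add: lap_def[abs_def])
      finally show ?thesis by simp
    qed
    then show ?thesis
      by (subst sum.swap) (simp add: sum_distrib_left[symmetric])
  qed
  moreover have "homog d (rot A h)"
  proof (cases d)
    case 0
    then have "pdiff j h = (\<lambda>y. 0)" for j using assms(1) harmonic_poly_0[of h] pdiff_const[of j "h 0"] by simp
    then show ?thesis by (simp add: homog_def rot_def)
  next
    case (Suc e)
    then have "pdiff j h (t *\<^sub>R y) = of_real (t ^ e) * pdiff j h y" for j t y
      using homog_pdiff[of h e j] h by (simp add: homog_def)
    then show ?thesis
      by (simp add: homog_def rot_def Suc matrix_vector_mult_scaleR sum_distrib_left mult_ac)
  qed
  ultimately show ?thesis using cp by (simp add: harmonic_poly_iff)
qed

definition skew_unit :: "'n \<Rightarrow> 'n \<Rightarrow> real ^ 'n ^ 'n::finite" where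
  "skew_unit i j = (\<chi> r c. (if r = j \<and> c = i then 1 else 0) - (if r = i \<and> c = j then 1 else 0))"

lemma transpose_skew_unit: "transpose (skew_unit i j) = - skew_unit i j"
  by (simp add: vec_eq_iff transpose_def skew_unit_def conj_commute)

lemma rot_skew_unit:
  "rot (skew_unit i j) h y = of_real (y $ j) * pdiff i h y - of_real (y $ i) * pdiff j h y"
proof -
  have R: "(skew_unit i j *v y) $ r = (if r = j then y $ i else 0) - (if r = i then y $ j else 0)" for r
  proof -
    have "(skew_unit i j *v y) $ r = (\<Sum>c\<in>UNIV. (if c = i then if r = j then y $ c else 0 else 0)
        - (if c = j then if r = i then y $ c else 0 else 0))"
      unfolding matrix_vector_mult_def by (auto simp: skew_unit_def intro!: sum.cong)
    then show ?thesis by (simp add: sum_subtractf)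
  qed
  have "rot (skew_unit i j) h y = - (\<Sum>r\<in>UNIV. (if r = j then of_real (y $ i) * pdiff r h y else 0)
      - (if r = i then of_real (y $ j) * pdiff r h y else 0))"
    unfolding rot_def R by (auto intro!: sum.cong simp: algebra_simps)
  then show ?thesis by (simp add: sum_subtractf)
qed

text \<open>The sum runs over ordered pairs, so each rotation plane is counted twice; this is the
  factor 2 in the eigenvalue. The squares of the coordinates multiply the Laplacian and drop out,
  and the remaining terms are evaluated by Euler's identity for h and for its partial
  derivatives.\<close>

lemma casimir_rot:
  fixes h :: "real ^ 'n::finite \<Rightarrow> complex"
  assumes "harmonic_poly d h"
  shows "(\<Sum>i\<in>UNIV. \<Sum>j\<in>UNIV. rot (skew_unit i j) (rot (skew_unit i j) h) y) =
    - 2 * of_nat d * (of_nat d + of_nat CARD('n) - 2) * h y"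
proof (cases d)
  case 0
  then have "pdiff j h = (\<lambda>y. 0)" for j
    using assms harmonic_poly_0[of h] pdiff_const[of j "h 0"] by simp
  then have "rot A h = (\<lambda>y. 0)" for A by (simp add: rot_def fun_eq_iff)
  then show ?thesis using 0 by (simp add: rot_def)
next
  case (Suc e)
  have h: "cpoly h" "homog d h" "\<And>y. lap h y = 0"
    using assms by (auto simp: harmonic_poly_iff)
  define x where "x i = complex_of_real (y $ i)" for i
  \<comment> \<open>The expansion for distinct i and j, with a correction on the diagonal, where
    \<open>skew_unit i i = 0\<close> and the other terms add up to -2 times the correction's
    half.\<close>
  have rr: "rot (skew_unit i j) (rot (skew_unit i j) h) y =
      (if j = i then 2 * (x i * pdiff i h y) else 0) + x j ^ 2 * pdiff i (pdiff i h) y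
      + x i ^ 2 * pdiff j (pdiff j h) y - x j * pdiff j h y - x i * pdiff i h y
      - 2 * (x i * (x j * pdiff j (pdiff i h) y))" for i j
  proof -
    have r: "rot (skew_unit i j) h = (\<lambda>y. of_real (y $ j) * pdiff i h y - of_real (y $ i) * pdiff j h y)"
      by (simp add: rot_skew_unit fun_eq_iff)
    have P: "pdiff l (rot (skew_unit i j) h) y = (if j = l then 1 else 0) * pdiff i h y + x j * pdiff l (pdiff i h) y
       - (if i = l then 1 else 0) * pdiff j h y - x i * pdiff l (pdiff j h) y" for l
      unfolding r
      by (simp add: cpoly_pdiff_diff cpoly_pdiff_mult cpoly_pdiff pdiff_coord cpoly.intros h x_def)
    have "pdiff i (pdiff j h) = pdiff j (pdiff i h)" by (rule pdiff_commute[OF h(1)])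
    then show ?thesis
      unfolding rot_skew_unit[of i j "rot (skew_unit i j) h"] P x_def[symmetric]
      by (cases "i = j") (simp_all add: power2_eq_square algebra_simps del: distrib_left_numeral)
  qed
  have E: "(\<Sum>i\<in>UNIV. x i * pdiff i h y) = of_nat d * h y"
    unfolding x_def by (rule euler_homog[OF h(1,2)])
  have "homog e (pdiff i h)" for i using h Suc by (simp add: homog_pdiff)
  then have EE: "(\<Sum>j\<in>UNIV. x j * pdiff j (pdiff i h) y) = of_nat e * pdiff i h y" for i
    unfolding x_def by (rule euler_homog[OF cpoly_pdiff[OF h(1)]])
  have L: "(\<Sum>i\<in>UNIV. pdiff i (pdiff i h) y) = 0" using h(3)[of y] by (simp add: lap_def)
  have s1: "(\<Sum>i\<in>UNIV. \<Sum>j\<in>UNIV. x j ^ 2 * pdiff i (pdiff i h) y) = 0"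
    by (simp add: sum_distrib_left[symmetric] sum_distrib_right[symmetric] L)
  have s2: "(\<Sum>i\<in>UNIV. \<Sum>j\<in>UNIV. x i ^ 2 * pdiff j (pdiff j h) y) = 0"
    by (simp add: sum_distrib_left[symmetric] L)
  have s3: "(\<Sum>i\<in>UNIV. \<Sum>j\<in>UNIV. 2 * (x i * (x j * pdiff j (pdiff i h) y))) = 2 * (of_nat e * (of_nat d * h y))"
  proof -
    have "(\<Sum>j\<in>UNIV. 2 * (x i * (x j * pdiff j (pdiff i h) y))) = 2 * (of_nat e * (x i * pdiff i h y))" for i
      by (simp only: sum_distrib_left[symmetric] EE) (simp add: mult_ac)
    then have "(\<Sum>i\<in>UNIV. \<Sum>j\<in>UNIV. 2 * (x i * (x j * pdiff j (pdiff i h) y))) =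
        2 * (of_nat e * (\<Sum>i\<in>UNIV. x i * pdiff i h y))"
      by (simp only: sum_distrib_left)
    then show ?thesis by (simp only: E)
  qed
  have s4: "(\<Sum>i\<in>UNIV. \<Sum>j\<in>UNIV. (if j = i then 2 * (x i * pdiff i h y) else 0)) = 2 * (of_nat d * h y)"
    by (simp add: sum_distrib_left[symmetric] E)
  have s5: "(\<Sum>i\<in>(UNIV::'n set). \<Sum>j\<in>UNIV. x j * pdiff j h y) = of_nat CARD('n) * (of_nat d * h y)"
    by (simp add: E)
  have s6: "(\<Sum>i\<in>UNIV. \<Sum>j\<in>(UNIV::'n set). x i * pdiff i h y) = of_nat CARD('n) * (of_nat d * h y)"
    by (simp add: sum_distrib_left[symmetric] E)
  show ?thesis
    by (simp only: rr sum.distrib sum_subtractf s1 s2 s3 s4 s5 s6) (simp add: Suc algebra_simps)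
qed

section \<open>The spaces of harmonic polynomials\<close>

lemma from_nat_into_neq:
  assumes "CARD('n::finite) \<ge> 2"
  shows "from_nat_into (UNIV :: 'n set) 0 \<noteq> from_nat_into UNIV 1"
  using inj_onD[OF bij_betw_imp_inj_on[OF bij_betw_from_nat_into_finite[OF finite[of "UNIV :: 'n set"]]], of 0 1] assms
  by auto

lemma UNIV_eq_from_nat_into:
  assumes "CARD('n::finite) = 2"
  shows "(UNIV :: 'n set) = {from_nat_into UNIV 0, from_nat_into UNIV 1}"
proof -
  have "{..<CARD('n)} = {0, 1}" using assms by auto
  then show ?thesis using bij_betw_from_nat_into_finite[of "UNIV :: 'n set"]
    by (auto simp: bij_betw_def)
qed

definition planar_of :: "int \<Rightarrow> real ^ 'n::finite \<Rightarrow> complex" where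
  "planar_of k y = (if k \<ge> 0 then planar y else cnj (planar y))"

definition i_of :: "int \<Rightarrow> complex" where
  "i_of k = (if k \<ge> 0 then \<i> else - \<i>)"

text \<open>The gradient of \<open>planar_of k\<close>. Its components are 1 and \<plusminus>i, so
  it is isotropic, which is why all powers of \<open>planar_of k\<close> are harmonic.\<close>

definition planar_coeff :: "int \<Rightarrow> 'n::finite \<Rightarrow> complex" where
  "planar_coeff k j = (if j = from_nat_into UNIV 0 then 1 else 0) + i_of k * (if j = from_nat_into UNIV 1 then 1 else 0)"

lemma planar_of_eq:
  "planar_of k = (\<lambda>y :: real ^ 'n::finite. of_real (y $ from_nat_into UNIV 0) + i_of k * of_real (y $ from_nat_into UNIV 1))"
  by (auto simp: planar_of_def planar_def i_of_def complex_eq_iff)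

lemma cpoly_planar_of: "cpoly (planar_of k)"
  unfolding planar_of_eq by (intro cpoly.add cpoly.coord cpoly_cmult)

lemma pdiff_planar_of: "pdiff j (planar_of k) = (\<lambda>y. planar_coeff k j)"
  unfolding planar_of_eq
  by (auto simp: cpoly_pdiff_add cpoly_pdiff_cmult cpoly_cmult cpoly.coord pdiff_coord planar_coeff_def fun_eq_iff)

lemma pdiff_planar_power:
  "pdiff j (\<lambda>y. c * planar_of k y ^ d) = (\<lambda>y. c * of_nat d * planar_coeff k j * planar_of k y ^ (d - 1))"
  by (simp add: cpoly_pdiff_cmult cpoly_power cpoly_planar_of cpoly_pdiff_power pdiff_planar_of mult_ac)

lemma harmonic_poly_planar:
  assumes "CARD('n::finite) \<ge> 2"
  shows "harmonic_poly d (\<lambda>y :: real ^ 'n. c * planar_of k y ^ d)"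
proof -
  have "(\<Sum>j\<in>UNIV. (planar_coeff k (j :: 'n))\<^sup>2) = 0"
  proof -
    have "(planar_coeff k (j :: 'n))\<^sup>2 = (if j = from_nat_into UNIV 0 then 1 else 0) - (if j = from_nat_into UNIV 1 then 1 else 0)" for j
      using from_nat_into_neq[OF assms] by (auto simp: planar_coeff_def i_of_def)
    then show ?thesis by (simp add: sum_subtractf)
  qed
  then have "lap (\<lambda>y :: real ^ 'n. c * planar_of k y ^ d) y = 0" for y
  proof -
    have "lap (\<lambda>y :: real ^ 'n. c * planar_of k y ^ d) y =
      (\<Sum>j\<in>UNIV. c * of_nat d * of_nat (d - 1) * planar_of k y ^ (d - 1 - 1) * (planar_coeff k (j :: 'n))\<^sup>2)"
      unfolding lap_def pdiff_planar_power by (simp add: power2_eq_square mult_ac)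
    then show ?thesis
      by (simp only: sum_distrib_left[symmetric] \<open>(\<Sum>j\<in>UNIV. (planar_coeff k j)\<^sup>2) = 0\<close>) simp
  qed
  moreover have "homog d (\<lambda>y :: real ^ 'n. c * planar_of k y ^ d)"
  proof -
    have "planar_of k (t *\<^sub>R y) = of_real t * planar_of k y" for t and y :: "real ^ 'n"
      by (simp add: planar_of_eq algebra_simps)
    then show ?thesis by (simp add: homog_def power_mult_distrib of_real_power)
  qed
  ultimately show ?thesis
    by (simp add: harmonic_poly_iff cpoly_cmult cpoly_power cpoly_planar_of)
qed

lemma harm_space_2:
  assumes "CARD('n::finite) = 2"
  shows "harm_space k = {h :: real ^ 'n \<Rightarrow> complex. \<exists>c. h = (\<lambda>y. c * planar_of k y ^ nat \<bar>k\<bar>)}"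
proof (intro set_eqI iffI)
  fix h :: "real ^ 'n \<Rightarrow> complex"
  assume "h \<in> harm_space k"
  then have "\<exists>c. \<forall>y. h y = c * planar_of k y ^ nat \<bar>k\<bar>"
    unfolding harm_space_def planar_of_def using assms by blast
  then show "h \<in> {h. \<exists>c. h = (\<lambda>y. c * planar_of k y ^ nat \<bar>k\<bar>)}" by (simp add: fun_eq_iff)
next
  fix h :: "real ^ 'n \<Rightarrow> complex"
  assume "h \<in> {h. \<exists>c. h = (\<lambda>y. c * planar_of k y ^ nat \<bar>k\<bar>)}"
  then obtain c where h: "h = (\<lambda>y. c * planar_of k y ^ nat \<bar>k\<bar>)" by blast
  have "harmonic_poly (nat \<bar>k\<bar>) h" unfolding h using assms by (simp add: harmonic_poly_planar)
  moreover have "\<exists>c. \<forall>y. h y = c * (if k \<ge> 0 then planar y else cnj (planar y)) ^ nat \<bar>k\<bar>"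
    unfolding h planar_of_def by blast
  ultimately show "h \<in> harm_space k" unfolding harm_space_def by blast
qed

lemma harm_space_not_2:
  assumes "CARD('n::finite) \<noteq> 2"
  shows "harm_space k = {h :: real ^ 'n \<Rightarrow> complex. harmonic_poly (nat \<bar>k\<bar>) h}"
  using assms by (auto simp: harm_space_def)

lemma harm_space_harmonic: "h \<in> harm_space k \<Longrightarrow> harmonic_poly (nat \<bar>k\<bar>) h"
  by (simp add: harm_space_def)

lemma harm_space_zero: "(\<lambda>y. 0) \<in> harm_space k"
  by (auto simp: harm_space_def harmonic_poly_zero intro: exI[of _ 0])

lemma harm_space_add: "f \<in> harm_space k \<Longrightarrow> g \<in> harm_space k \<Longrightarrow> (\<lambda>y. f y + g y) \<in> harm_space k"
  by (auto simp: harm_space_def harmonic_poly_add distrib_right[symmetric])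

lemma harm_space_cmult: "f \<in> harm_space k \<Longrightarrow> (\<lambda>y. c * f y) \<in> harm_space k"
  by (auto simp: harm_space_def harmonic_poly_cmult mult.assoc[symmetric])

lemma harm_space_nonzero:
  assumes "k \<in> harm_indices TYPE('n::finite)"
  shows "\<exists>h \<in> harm_space k. (h :: real ^ 'n \<Rightarrow> complex) \<noteq> (\<lambda>y. 0)"
proof (cases "CARD('n) = 1")
  case True
  then consider "k = 0" | "k = 1" using assms by (auto simp: harm_indices_def)
  then show ?thesis
  proof cases
    case 1
    then have "(\<lambda>y :: real ^ 'n. 1) \<in> harm_space k" using True by (simp add: harm_space_not_2 harmonic_poly_const)
    then show ?thesis by (metis zero_neq_one)
  next
    case 2
    fix j :: 'n
    let ?h = "\<lambda>y :: real ^ 'n. complex_of_real (y $ j)"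
    have "?h \<in> harm_space k"
      using True 2 by (simp add: harm_space_not_2 harmonic_poly_iff cpoly.coord homog_def lap_def pdiff_coord)
    moreover have "?h (axis j 1) \<noteq> 0" by (simp add: axis_def)
    ultimately show ?thesis by metis
  qed
next
  case False
  then have 2: "CARD('n) \<ge> 2" using zero_less_card_finite[where 'a='n] by linarith
  let ?h = "\<lambda>y :: real ^ 'n. 1 * planar_of k y ^ nat \<bar>k\<bar>"
  have "?h \<in> harm_space k"
    using harmonic_poly_planar[OF 2, of "nat \<bar>k\<bar>" 1 k]
    by (auto simp: harm_space_def planar_of_def intro: exI[of _ 1])
  moreover have "?h (axis (from_nat_into UNIV 0) 1) \<noteq> 0"
    using from_nat_into_neq[OF 2] by (auto simp: planar_of_eq axis_def)
  ultimately show ?thesis by metis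
qed

text \<open>\<open>next_index TYPE('n) k k'\<close> states that multiplication by a coordinate takes \<open>harm_space k\<close>
  up to \<open>harm_space k'\<close>. For \<open>n = 2\<close> the index \<open>0\<close> has the two successors \<open>1\<close> and \<open>-1\<close>.\<close>

definition next_index :: "'n::finite itself \<Rightarrow> int \<Rightarrow> int \<Rightarrow> bool" where
  "next_index T k k' \<longleftrightarrow> k \<in> harm_indices T \<and> k' \<in> harm_indices T \<and> \<bar>k' - k\<bar> = 1 \<and> \<bar>k'\<bar> = \<bar>k\<bar> + 1"

lemma nat_next_index: "next_index T k k' \<Longrightarrow> nat \<bar>k'\<bar> = Suc (nat \<bar>k\<bar>)"
  by (auto simp: next_index_def)

lemma planar_of_next: "next_index T k k' \<Longrightarrow> k \<noteq> 0 \<Longrightarrow> planar_of k = planar_of k'"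
  by (auto simp: next_index_def planar_of_def fun_eq_iff)

lemma harm_space_pdiff:
  fixes h :: "real ^ 'n::finite \<Rightarrow> complex"
  assumes k: "next_index TYPE('n) k k'" and h: "h \<in> harm_space k'"
  shows "pdiff j h \<in> harm_space k"
proof (cases "CARD('n) = 2")
  case True
  then obtain c where c: "h = (\<lambda>y. c * planar_of k' y ^ nat \<bar>k'\<bar>)" using h by (auto simp: harm_space_2)
  have "pdiff j h = (\<lambda>y. (c * of_nat (Suc (nat \<bar>k\<bar>)) * planar_coeff k' j) * planar_of k y ^ nat \<bar>k\<bar>)"
    unfolding c pdiff_planar_power
    by (cases "k = 0") (simp_all add: nat_next_index[OF k] planar_of_next[OF k])
  then show ?thesis using True by (auto simp: harm_space_2)
next
  case False
  then show ?thesis using h harmonic_poly_pdiff[of "nat \<bar>k\<bar>" h j]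
    by (simp add: harm_space_not_2 nat_next_index[OF k])
qed

lemma harm_space_h_down:
  fixes h :: "real ^ 'n::finite \<Rightarrow> complex"
  assumes "next_index TYPE('n) k k'" "h \<in> harm_space k'"
  shows "h_down j d h \<in> harm_space k"
  using harm_space_cmult[OF harm_space_pdiff[OF assms, of j], of "1 / (of_nat CARD('n) + 2 * of_nat d - 2)"]
  unfolding h_down_def[abs_def] by simp

lemma coord_eq_planar:
  assumes "CARD('n::finite) = 2"
  shows "complex_of_real (y $ j) =
    (cnj (planar_coeff k j) * planar_of k y + planar_coeff k j * cnj (planar_of k (y :: real ^ 'n))) / 2"
proof -
  have "j = from_nat_into UNIV 0 \<or> j = from_nat_into UNIV 1"
    using UNIV_eq_from_nat_into[OF assms] by blast
  then show ?thesis
    using from_nat_into_neq[where 'n='n] assms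
    by (auto simp: planar_coeff_def planar_of_eq i_of_def complex_eq_iff)
qed

lemma norm_sq_eq_planar:
  assumes "CARD('n::finite) = 2"
  shows "complex_of_real ((norm (y :: real ^ 'n))\<^sup>2) = planar_of k y * cnj (planar_of k y)"
proof -
  have "(\<Sum>j\<in>UNIV. complex_of_real (y $ j) * of_real (y $ j)) =
      of_real (y $ from_nat_into UNIV 0) * of_real (y $ from_nat_into UNIV 0)
      + of_real (y $ from_nat_into UNIV 1) * of_real (y $ from_nat_into UNIV 1)"
    using from_nat_into_neq[where 'n='n] assms
    by (subst UNIV_eq_from_nat_into[OF assms]) simp
  then show ?thesis
    by (simp add: complex_norm_sq planar_of_eq i_of_def algebra_simps)
qed

text \<open>\<open>h_up\<close> leaves \<open>harm_space k\<close> for the sum of the successors of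
  k. There is one successor as a rule, none for n = 1 and k = 1, and two for n = 2 and k = 0, where
  a coordinate is a combination of z and its conjugate. The sum over successors treats the three
  situations alike.\<close>

lemma harm_space_h_up:
  fixes h :: "real ^ 'n::finite \<Rightarrow> complex"
  assumes k: "k \<in> harm_indices TYPE('n)" and h: "h \<in> harm_space k"
  shows "\<exists>g. (\<forall>k'. next_index TYPE('n) k k' \<longrightarrow> g k' \<in> harm_space k') \<and>
    (\<forall>y. h_up j (nat \<bar>k\<bar>) h y = (\<Sum>k' | next_index TYPE('n) k k'. g k' y))"
proof (cases "CARD('n) = 2")
  case False
  have hp: "harmonic_poly (Suc (nat \<bar>k\<bar>)) (h_up j (nat \<bar>k\<bar>) h)"
    by (intro harmonic_poly_h_up harm_space_harmonic h)
  show ?thesis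
  proof (cases "next_index TYPE('n) k (k + 1)")
    case True
    have "k \<ge> 0" using k False by (auto simp: harm_indices_def split: if_splits)
    then have "{k'. next_index TYPE('n) k k'} = {k + 1}"
      using True False by (auto simp: next_index_def harm_indices_def split: if_splits)
    moreover have "h_up j (nat \<bar>k\<bar>) h \<in> harm_space (k + 1)"
      using hp False by (simp add: harm_space_not_2 nat_next_index[OF True])
    moreover from calculation have "k' = k + 1" if "next_index TYPE('n) k k'" for k' using that by blast
    ultimately show ?thesis
      by (intro exI[of _ "\<lambda>_. h_up j (nat \<bar>k\<bar>) h"]) auto
  next
    case no: False
    \<comment> \<open>A missing successor leaves only this case, and here \<open>h_up\<close> has
      degree 2 on a line and vanishes.\<close>
    then have n: "CARD('n) = 1" "k = 1" using k False by (auto simp: harm_indices_def next_index_def split: if_splits)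
    then have "h_up j (nat \<bar>k\<bar>) h = (\<lambda>y. 0)"
      using harmonic_poly_dim_1[OF n(1) hp] by simp
    moreover have "{k'. next_index TYPE('n) k k'} = {}"
      using n by (auto simp: next_index_def harm_indices_def)
    ultimately show ?thesis by (intro exI[of _ "\<lambda>_ _. 0"]) auto
  qed
next
  case True
  then obtain c where c: "h = (\<lambda>y. c * planar_of k y ^ nat \<bar>k\<bar>)" using h by (auto simp: harm_space_2)
  have K: "harm_indices TYPE('n) = UNIV" using True by (simp add: harm_indices_def)
  show ?thesis
  proof (cases "k = 0")
    case k0: True
    have S: "{k'. next_index TYPE('n) k k'} = {1, -1}" using k0 K by (auto simp: next_index_def)
    define g where "g k' = (\<lambda>y :: real ^ 'n. c / 2 * (if k' = (1::int) then cnj (planar_coeff 1 j) else planar_coeff 1 j)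
      * planar_of k' y ^ nat \<bar>k'\<bar>)" for k'
    have "g k' \<in> harm_space k'" for k' unfolding g_def harm_space_2[OF True] by blast
    moreover have "h_up j (nat \<bar>k\<bar>) h y = (\<Sum>k' | next_index TYPE('n) k k'. g k' y)" for y
    proof -
      have "planar_of (-1) y = cnj (planar_of 1 y)" by (simp add: planar_of_def)
      then show ?thesis
        unfolding S using coord_eq_planar[OF True, of y j 1]
        by (simp add: h_up_def h_down_def c k0 g_def field_simps)
    qed
    ultimately show ?thesis by blast
  next
    case k0: False
    define k' where "k' = (if k > 0 then k + 1 else k - 1)"
    have S: "{k'. next_index TYPE('n) k k'} = {k'}" using k0 K by (auto simp: next_index_def k'_def)
    then have nk: "next_index TYPE('n) k k'" by blast
    define g where "g = (\<lambda>y :: real ^ 'n. c / 2 * cnj (planar_coeff k j) * planar_of k' y ^ nat \<bar>k'\<bar>)"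
    have "g \<in> harm_space k'" unfolding g_def harm_space_2[OF True] by blast
    moreover have "h_up j (nat \<bar>k\<bar>) h y = g y" for y
    proof -
      obtain e where e: "nat \<bar>k\<bar> = Suc e" using k0 by (cases "nat \<bar>k\<bar>") auto
      have "h_down j (nat \<bar>k\<bar>) h y = c / 2 * planar_coeff k j * planar_of k y ^ e"
      proof -
        define X :: complex where "X = of_nat (Suc e)"
        have "X \<noteq> 0" unfolding X_def by (simp del: of_nat_Suc)
        then show ?thesis
          unfolding h_down_def c pdiff_planar_power e True X_def[symmetric] by (simp add: field_simps)
      qed
      then show ?thesis
        unfolding h_up_def g_def norm_sq_eq_planar[OF True, of y k] coord_eq_planar[OF True, of y j k]
        by (simp add: c nat_next_index[OF nk] planar_of_next[OF nk k0, symmetric] e field_simps)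
    qed
    ultimately show ?thesis unfolding S
      by (intro exI[of _ "\<lambda>_. g"]) (auto dest!: arg_cong[OF S, of "\<lambda>S. _ \<in> S", THEN iffD1, OF CollectI])
  qed
qed

text \<open>In the plane the generator of rotations acts on \<open>harm_space k\<close> by a scalar
  linear in k. Unlike the Casimir eigenvalue, which depends on |k|, it separates k from -k.\<close>

lemma rot_planar:
  assumes "CARD('n::finite) = 2" "transpose A = - A" "h \<in> harm_space k"
  shows "rot A h y = - (\<i> * of_int k * of_real (A $ from_nat_into UNIV 1 $ from_nat_into UNIV 0)) * h (y :: real ^ 'n)"
proof -
  let ?p = "from_nat_into (UNIV :: 'n set)"
  define \<alpha> where "\<alpha> = A $ ?p 1 $ ?p 0"
  obtain c where c: "h = (\<lambda>y. c * planar_of k y ^ nat \<bar>k\<bar>)" using assms by (auto simp: harm_space_2)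
  have neq: "?p 0 \<noteq> ?p 1" using from_nat_into_neq[where 'n='n] assms(1) by simp
  have A: "A $ i $ j = - (A $ j $ i)" for i j
    using arg_cong[OF assms(2), of "\<lambda>B. B $ j $ i"] by (simp add: transpose_def)
  have A': "A $ i $ i = 0" "A $ ?p 0 $ ?p 1 = - \<alpha>" for i
    using A[of i i] A[of "?p 0" "?p 1"] by (auto simp: \<alpha>_def)
  have sum2: "sum f UNIV = f (?p 0) + f (?p 1)" for f :: "'n \<Rightarrow> 'x::comm_monoid_add"
    by (subst UNIV_eq_from_nat_into[OF assms(1)]) (use neq in simp)
  have "(\<Sum>j\<in>UNIV. of_real ((A *v y) $ j) * planar_coeff k j) = i_of k * of_real \<alpha> * planar_of k y"
    using neq by (simp add: sum2 matrix_vector_mult_def A' \<alpha>_def[symmetric] planar_coeff_def planar_of_eq i_of_def algebra_simps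
        del: One_nat_def)
  moreover have "rot A h y = - (c * of_nat (nat \<bar>k\<bar>) * planar_of k y ^ (nat \<bar>k\<bar> - 1) *
      (\<Sum>j\<in>UNIV. of_real ((A *v y) $ j) * planar_coeff k j))"
    unfolding rot_def c pdiff_planar_power by (simp add: sum_distrib_left mult_ac)
  ultimately have "rot A h y = - (c * of_nat (nat \<bar>k\<bar>) * planar_of k y ^ (nat \<bar>k\<bar> - 1) *
      (i_of k * of_real \<alpha> * planar_of k y))" by simp
  moreover have "of_nat (nat \<bar>k\<bar>) * i_of k = \<i> * of_int k"
    by (auto simp: i_of_def)
  moreover have "of_nat (nat \<bar>k\<bar>) * (planar_of k y ^ (nat \<bar>k\<bar> - 1) * planar_of k y) = of_nat (nat \<bar>k\<bar>) * planar_of k y ^ nat \<bar>k\<bar>"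
    by (cases "nat \<bar>k\<bar>") simp_all
  ultimately show ?thesis
    unfolding \<alpha>_def[symmetric] c by (metis (no_types, lifting) mult.assoc mult.commute mult_minus_left)
qed

lemma harm_space_rot:
  assumes "h \<in> harm_space k" "transpose A = - A"
  shows "rot A h \<in> harm_space k"
proof (cases "CARD('a) = 2")
  case True
  have "rot A h = (\<lambda>y. - (\<i> * of_int k * of_real (A $ from_nat_into UNIV 1 $ from_nat_into UNIV 0)) * h y)"
    using rot_planar[OF True assms(2,1)] by (simp add: fun_eq_iff)
  then show ?thesis
    using harm_space_cmult[OF assms(1),
        of "- (\<i> * of_int k * of_real (A $ from_nat_into UNIV 1 $ from_nat_into UNIV 0))"] by simp
next
  case False
  then show ?thesis using assms by (simp add: harm_space_not_2 harmonic_poly_rot)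
qed

section \<open>Orthogonal maps of the plane\<close>

text \<open>An orthogonal map is z -> cz if its determinant is 1, and it is z -> c times the
  conjugate of z if the determinant is -1.\<close>

lemma orthogonal_planar:
  fixes B :: "real ^ 'n ^ 'n::finite"
  assumes "CARD('n) = 2" "orthogonal_matrix B"
  shows "\<exists>c. (\<forall>y. planar (B *v y) = c * planar y) \<or> (\<forall>y. planar (B *v y) = c * cnj (planar y))"
proof -
  let ?p = "from_nat_into (UNIV :: 'n set)"
  have neq: "?p 0 \<noteq> ?p 1" using from_nat_into_neq[where 'n='n] assms(1) by simp
  have sum2: "sum f UNIV = f (?p 0) + f (?p 1)" for f :: "'n \<Rightarrow> real"
    by (subst UNIV_eq_from_nat_into[OF assms(1)]) (use neq in simp)
  define a b c d where "a = B $ ?p 0 $ ?p 0" and "b = B $ ?p 0 $ ?p 1" and "c = B $ ?p 1 $ ?p 0" and "d = B $ ?p 1 $ ?p 1"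
  note abcd = a_def[symmetric] b_def[symmetric] c_def[symmetric] d_def[symmetric]
  have BB: "(\<Sum>r\<in>UNIV. B $ r $ i * B $ r $ j) = (if i = j then 1 else 0)" for i j
    using arg_cong[OF assms(2)[unfolded orthogonal_matrix], of "\<lambda>M. M $ i $ j"]
    by (simp add: matrix_matrix_mult_def transpose_def mat_def)
  have 1: "a * a + c * c = 1" and 2: "b * b + d * d = 1" and 3: "a * b + c * d = 0"
    using BB[of "?p 0" "?p 0"] BB[of "?p 1" "?p 1"] BB[of "?p 0" "?p 1"] neq
    by (auto simp: sum2 abcd simp del: One_nat_def)
  have pl: "planar (B *v y) = Complex a c * of_real (y $ ?p 0) + Complex b d * of_real (y $ ?p 1)" for y
    by (simp add: planar_def matrix_vector_mult_def sum2 abcd complex_eq_iff del: One_nat_def)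
  have "(a * d - b * c)\<^sup>2 = 1"
  proof -
    have "(a * d - b * c)\<^sup>2 + (a * b + c * d)\<^sup>2 = (a * a + c * c) * (b * b + d * d)"
      by (simp add: power2_eq_square algebra_simps)
    then show ?thesis using 1 2 3 by simp
  qed
  then consider "a * d - b * c = 1" | "a * d - b * c = -1" by (auto simp: power2_eq_1_iff)
  then show ?thesis
  proof cases
    case det: 1
    \<comment> \<open>The columns are unit vectors, so the right-hand side is 2 - 2 det. For det = 1
      two squares sum to 0, which are the Cauchy-Riemann equations for the linear map.\<close>
    have "(b + c)\<^sup>2 + (d - a)\<^sup>2 = (a * a + c * c) + (b * b + d * d) - 2 * (a * d - b * c)"
      by (simp add: power2_eq_square algebra_simps)
    then have "(b + c)\<^sup>2 + (d - a)\<^sup>2 = 0" using det 1 2 by simp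
    then have "b = - c" "d = a" by (auto simp: sum_power2_eq_zero_iff)
    then have "planar (B *v y) = Complex a c * planar y" for y
      unfolding pl planar_def[of y] by (simp add: complex_eq_iff del: One_nat_def)
    then show ?thesis by blast
  next
    case det: 2
    have "(b - c)\<^sup>2 + (d + a)\<^sup>2 = (a * a + c * c) + (b * b + d * d) + 2 * (a * d - b * c)"
      by (simp add: power2_eq_square algebra_simps)
    then have "(b - c)\<^sup>2 + (d + a)\<^sup>2 = 0" using det 1 2 by simp
    then have "b = c" "d = - a" by (auto simp: sum_power2_eq_zero_iff)
    then have "planar (B *v y) = Complex a c * cnj (planar y)" for y
      unfolding pl planar_def[of y] by (simp add: complex_eq_iff del: One_nat_def)
    then show ?thesis by blast
  qed
qed

lemma harm_space_orthogonal:
  fixes B :: "real ^ 'n ^ 'n::finite"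
  assumes "CARD('n) = 2" "orthogonal_matrix B" "h \<in> harm_space k"
  shows "(\<lambda>y. h (B *v y)) \<in> harm_space k \<or> (\<lambda>y. h (B *v y)) \<in> harm_space (- k)"
proof -
  obtain c where c: "h = (\<lambda>y. c * planar_of k y ^ nat \<bar>k\<bar>)" using assms by (auto simp: harm_space_2)
  obtain e where "(\<forall>y. planar (B *v y) = e * planar y) \<or> (\<forall>y. planar (B *v y) = e * cnj (planar y))"
    using orthogonal_planar[OF assms(1,2)] by blast
  then have "\<exists>e. (\<forall>y. planar_of k (B *v y) ^ nat \<bar>k\<bar> = e * planar_of k y ^ nat \<bar>k\<bar>) \<or>
      (\<forall>y. planar_of k (B *v y) ^ nat \<bar>k\<bar> = e * planar_of (- k) y ^ nat \<bar>k\<bar>)"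
  proof
    assume "\<forall>y. planar (B *v y) = e * planar y"
    then show ?thesis
      by (intro exI[of _ "(if k \<ge> 0 then e else cnj e) ^ nat \<bar>k\<bar>"] disjI1)
        (simp add: planar_of_def power_mult_distrib)
  next
    assume "\<forall>y. planar (B *v y) = e * cnj (planar y)"
    then show ?thesis
      by (intro exI[of _ "(if k \<ge> 0 then e else cnj e) ^ nat \<bar>k\<bar>"] disjI2)
        (auto simp: planar_of_def power_mult_distrib)
  qed
  then obtain e where e: "(\<forall>y. planar_of k (B *v y) ^ nat \<bar>k\<bar> = e * planar_of k y ^ nat \<bar>k\<bar>) \<or>
      (\<forall>y. planar_of k (B *v y) ^ nat \<bar>k\<bar> = e * planar_of (- k) y ^ nat \<bar>k\<bar>)" by blast
  then show ?thesis
    by (rule disj_forward) (auto simp: c harm_space_2[OF assms(1)] intro!: exI[of _ "c * e"])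
qed

section \<open>The action on the basic functions\<close>

definition par_a :: "nat \<Rightarrow> int \<Rightarrow> nat \<Rightarrow> nat \<Rightarrow> complex" where
  "par_a N m l d = (of_int m + 4 * of_nat l + 2 * of_nat d + of_nat N) / 4"

definition par_b :: "nat \<Rightarrow> nat \<Rightarrow> nat \<Rightarrow> complex" where
  "par_b N l d = 2 * of_nat l + of_nat d + of_nat N / 2"

text \<open>Written in the variable x = |y|^2, taken complex: the square of the norm is a polynomial
  in y, so no singularity at y = 0 has to be discussed, and the derivative in x is a complex one.
  The dimension is an explicit number N so that the identities below are pure statements about
  functions of x.\<close>

definition radial :: "complex \<Rightarrow> nat \<Rightarrow> int \<Rightarrow> nat \<Rightarrow> nat \<Rightarrow> complex \<Rightarrow> complex" where
  "radial s N m l d x =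
     exp (- (\<i> * s * x)) * (x ^ l * hyp1F1 (par_a N m l d) (par_b N l d) (2 * \<i> * s * x))"

definition radial' :: "complex \<Rightarrow> nat \<Rightarrow> int \<Rightarrow> nat \<Rightarrow> nat \<Rightarrow> complex \<Rightarrow> complex" where
  "radial' s N m l d x =
     exp (- (\<i> * s * x)) *
       ((of_nat l * x ^ (l - 1) - \<i> * s * x ^ l) * hyp1F1 (par_a N m l d) (par_b N l d) (2 * \<i> * s * x)
        + x ^ l * (2 * \<i> * s) * hyp1F1' (par_a N m l d) (par_b N l d) (2 * \<i> * s * x))"

text \<open>The factor \<open>(b - 1 - l) / (b - 1)\<close>; for \<open>l = 0\<close> it is \<open>1\<close>, also when \<open>b = 1\<close>.\<close>

definition lift_coeff :: "nat \<Rightarrow> nat \<Rightarrow> nat \<Rightarrow> complex" where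
  "lift_coeff N l d = (if l = 0 then 1 else (par_b N l d - 1 - of_nat l) / (par_b N l d - 1))"

lemma Re_par_b: "N \<ge> 1 \<Longrightarrow> Re (par_b N l d) > 0"
  by (simp add: par_b_def)

lemma Re_par_b_gt_1: "N \<ge> 1 \<Longrightarrow> l \<ge> 1 \<or> d \<ge> 1 \<Longrightarrow> Re (par_b N l d) > 1"
  by (auto simp: par_b_def)

lemma par_b_neq_0: "N \<ge> 1 \<Longrightarrow> par_b N l d \<noteq> 0"
  using Re_par_b[of N l d] by auto

lemma par_b_neq_1: "N \<ge> 1 \<Longrightarrow> l \<ge> 1 \<or> d \<ge> 1 \<Longrightarrow> par_b N l d \<noteq> 1"
  using Re_par_b_gt_1[of N l d] by auto

lemma radial_deriv:
  assumes "N \<ge> 1"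
  shows "(radial s N m l d has_field_derivative radial' s N m l d x) (at x)"
proof -
  have "((\<lambda>x. hyp1F1 (par_a N m l d) (par_b N l d) (2 * \<i> * s * x)) has_field_derivative
      hyp1F1' (par_a N m l d) (par_b N l d) (2 * \<i> * s * x) * (2 * \<i> * s)) (at x)"
    by (rule DERIV_chain2[OF hyp1F1_deriv[OF Re_par_b[OF assms]]]) (auto intro!: derivative_eq_intros)
  then show ?thesis
    unfolding radial_def[abs_def] radial'_def
    by (auto intro!: derivative_eq_intros simp: algebra_simps)
qed

text \<open>Used with c = b - 1, L = l, F the hypergeometric function and G = z F' or z (F' - F).
  Then F + G/c is the function with b lowered, and G is a multiple of the one with b raised; the
  operators thus produce two values of l.\<close>

lemma up_arith:
  fixes c :: complex
  assumes "c \<noteq> 0"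
  shows "L * F + G = L * (F + G / c) + (c - L) / c * G"
    and "(c - L) * F + G = (c - L) * (F + G / c) + L / c * G"
  using assms by (simp_all add: field_simps)

text \<open>The left-hand side is the coefficient of \<open>y $ j * h\<close> in
  \<open>op_E_plus\<close> applied to a basic function. The derivative of exp(-isx) cancels the term
  -2s, so only the derivatives of x^l and of the hypergeometric function survive.\<close>

lemma radial_E_plus_up:
  assumes "N \<ge> 1"
  shows "2 * \<i> * radial' s N m l d x - 2 * s * radial s N m l d x =
    2 * \<i> * of_nat l * radial s N (m + 2) (l - 1) (d + 1) x +
    2 * \<i> * (lift_coeff N l d * (par_a N m l d / par_b N l d) * (2 * \<i> * s)) * radial s N (m + 2) l (d + 1) x"
proof -
  define a b where "a = par_a N m l d" and "b = par_b N l d"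
  define z where "z = 2 * \<i> * s * x"
  define e where "e = exp (- (\<i> * s * x))"
  have p: "par_a N (m + 2) l (d + 1) = a + 1" "par_b N l (d + 1) = b + 1"
    by (simp_all add: par_a_def par_b_def a_def b_def field_simps)
  have D: "hyp1F1' a b z = a / b * hyp1F1 (a + 1) (b + 1) z" by (simp add: hyp1F1'_def)
  show ?thesis
  proof (cases l)
    case 0
    then show ?thesis
      unfolding radial_def radial'_def p lift_coeff_def a_def[symmetric] b_def[symmetric] z_def[symmetric] e_def[symmetric] D
      by (simp add: algebra_simps)
  next
    case (Suc i)
    have p': "par_a N (m + 2) (l - 1) (d + 1) = a" "par_b N (l - 1) (d + 1) = b - 1"
      by (simp_all add: par_a_def par_b_def a_def b_def field_simps Suc)
    have b1: "Re b > 1" using Re_par_b_gt_1[OF assms, of l d] Suc by (simp add: b_def)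
    then have b1': "b - 1 \<noteq> 0" by auto
    then have G: "hyp1F1 a (b - 1) z = hyp1F1 a b z + z * hyp1F1' a b z / (b - 1)"
      using hyp1F1_lower_b[OF b1, of z a] by (simp add: field_simps)
    have L: "x ^ l = x * x ^ i" "l - 1 = i" by (simp_all add: Suc)
    have "2 * \<i> * radial' s N m l d x - 2 * s * radial s N m l d x
        = 2 * \<i> * e * x ^ i * (of_nat l * hyp1F1 a b z + z * hyp1F1' a b z)"
      unfolding radial_def radial'_def L a_def[symmetric] b_def[symmetric] z_def[symmetric] e_def[symmetric]
      by (simp add: algebra_simps z_def)
    also have "of_nat l * hyp1F1 a b z + z * hyp1F1' a b z =
        of_nat l * hyp1F1 a (b - 1) z + (b - 1 - of_nat l) / (b - 1) * (z * hyp1F1' a b z)"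
      unfolding G by (rule up_arith(1)[OF b1'])
    also have "2 * \<i> * e * x ^ i * \<dots> = 2 * \<i> * of_nat l * radial s N (m + 2) (l - 1) (d + 1) x +
        2 * \<i> * (lift_coeff N l d * (2 * \<i> * s)) * e * x ^ l * hyp1F1' a b z"
      unfolding radial_def p p' lift_coeff_def L(1) a_def[symmetric] b_def[symmetric] z_def[symmetric] e_def[symmetric]
      using Suc by (simp add: algebra_simps z_def)
    finally show ?thesis
      unfolding radial_def p a_def[symmetric] b_def[symmetric] z_def[symmetric] e_def[symmetric] D
      by (simp add: mult_ac)
  qed
qed

text \<open>The sign of the derivative is opposite to \<open>radial_E_plus_up\<close>, so the two
  contributions of the exponential add up instead of cancelling and turn F' into \<open>P\<close>,
  that is F' - F. This brings in b - a where the other operator has a.\<close>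

lemma radial_E_minus_up:
  assumes "N \<ge> 1"
  shows "- 2 * \<i> * radial' s N m l d x - 2 * s * radial s N m l d x =
    - 2 * \<i> * of_nat l * radial s N (m - 2) (l - 1) (d + 1) x +
    2 * \<i> * (lift_coeff N l d * ((par_b N l d - par_a N m l d) / par_b N l d) * (2 * \<i> * s)) * radial s N (m - 2) l (d + 1) x"
proof -
  define a b where "a = par_a N m l d" and "b = par_b N l d"
  define z where "z = 2 * \<i> * s * x"
  define e where "e = exp (- (\<i> * s * x))"
  define P where "P = hyp1F1' a b z - hyp1F1 a b z"
  have P': "hyp1F1' a b z = hyp1F1 a b z + P" by (simp add: P_def)
  have p: "par_a N (m - 2) l (d + 1) = a" "par_b N l (d + 1) = b + 1"
    by (simp_all add: par_a_def par_b_def a_def b_def field_simps)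
  have D: "(b - a) / b * hyp1F1 a (b + 1) z = - P"
    using hyp1F1_raise_b[of b a z] Re_par_b[OF assms] by (simp add: b_def P_def)
  show ?thesis
  proof (cases l)
    case 0
    have "2 * \<i> * (lift_coeff N l d * ((b - a) / b) * (2 * \<i> * s)) * radial s N (m - 2) l (d + 1) x
      = 2 * \<i> * (2 * \<i> * s) * e * ((b - a) / b * hyp1F1 a (b + 1) z)"
      unfolding radial_def p lift_coeff_def z_def[symmetric] e_def[symmetric]
      by (simp only: 0 simp_thms if_True power_0 mult_1 mult_1_right mult_ac)
    with 0 show ?thesis
      unfolding D a_def[symmetric] b_def[symmetric]
      unfolding radial_def radial'_def a_def[symmetric] b_def[symmetric] z_def[symmetric] e_def[symmetric] P'
      by (simp add: algebra_simps)
  next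
    case (Suc i)
    have p': "par_a N (m - 2) (l - 1) (d + 1) = a - 1" "par_b N (l - 1) (d + 1) = b - 1"
      by (simp_all add: par_a_def par_b_def a_def b_def field_simps Suc)
    have b1: "Re b > 1" using Re_par_b_gt_1[OF assms, of l d] Suc by (simp add: b_def)
    then have b1': "b - 1 \<noteq> 0" by auto
    then have G: "hyp1F1 (a - 1) (b - 1) z = hyp1F1 a b z + z * P / (b - 1)"
      using hyp1F1_lower_a_b[OF b1, of z a] unfolding P_def by (simp add: field_simps)
    have L: "x ^ l = x * x ^ i" "l - 1 = i" by (simp_all add: Suc)
    have "- 2 * \<i> * radial' s N m l d x - 2 * s * radial s N m l d x
        = - 2 * \<i> * e * x ^ i * (of_nat l * hyp1F1 a b z + z * P)"
      unfolding radial_def radial'_def L a_def[symmetric] b_def[symmetric] z_def[symmetric] e_def[symmetric] P'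
      by (simp add: algebra_simps z_def)
    also have "of_nat l * hyp1F1 a b z + z * P =
        of_nat l * hyp1F1 (a - 1) (b - 1) z + (b - 1 - of_nat l) / (b - 1) * (z * P)"
      unfolding G by (rule up_arith(1)[OF b1'])
    also have "- 2 * \<i> * e * x ^ i * \<dots> = - 2 * \<i> * of_nat l * radial s N (m - 2) (l - 1) (d + 1) x +
        2 * \<i> * (lift_coeff N l d * (2 * \<i> * s)) * e * x ^ l * (- P)"
      unfolding radial_def p p' lift_coeff_def L(1) a_def[symmetric] b_def[symmetric] z_def[symmetric] e_def[symmetric]
      using Suc by (simp add: algebra_simps z_def)
    finally show ?thesis
      unfolding radial_def p a_def[symmetric] b_def[symmetric] z_def[symmetric] e_def[symmetric] D[symmetric]
      by (simp add: mult_ac)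
  qed
qed

text \<open>After splitting \<open>y $ j * h\<close> and expressing the partial derivative of h
  through \<open>h_down\<close>, the left-hand side is the coefficient of \<open>h_down\<close>. It
  collects x times the previous operator and the derivative of h, the latter with the constant N +
  2d - 2 of \<open>pdiff_eq_h_down\<close>.\<close>

lemma radial_E_plus_down:
  assumes "N \<ge> 1" "d \<ge> 1"
  shows "2 * \<i> * x * radial' s N m l d x - 2 * s * x * radial s N m l d x
      + \<i> * (of_nat N + 2 * of_nat d - 2) * radial s N m l d x =
    2 * \<i> * (par_b N l d - 1 - of_nat l) * radial s N (m + 2) l (d - 1) x +
    2 * \<i> * (of_nat l / (par_b N l d - 1) * (par_a N m l d / par_b N l d) * (2 * \<i> * s)) * radial s N (m + 2) (l + 1) (d - 1) x"
proof -
  define a b where "a = par_a N m l d" and "b = par_b N l d"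
  define z where "z = 2 * \<i> * s * x"
  define e where "e = exp (- (\<i> * s * x))"
  have p: "par_a N (m + 2) (l + 1) (d - 1) = a + 1" "par_b N (l + 1) (d - 1) = b + 1"
    "par_a N (m + 2) l (d - 1) = a" "par_b N l (d - 1) = b - 1"
    using assms by (simp_all add: par_a_def par_b_def a_def b_def field_simps of_nat_diff)
  have D: "hyp1F1' a b z = a / b * hyp1F1 (a + 1) (b + 1) z" by (simp add: hyp1F1'_def)
  have b1: "Re b > 1" using Re_par_b_gt_1[of N l d] assms by (simp add: b_def)
  then have b1': "b - 1 \<noteq> 0" by auto
  then have G: "hyp1F1 a (b - 1) z = hyp1F1 a b z + z * hyp1F1' a b z / (b - 1)"
    using hyp1F1_lower_b[OF b1, of z a] by (simp add: field_simps)
  have N: "of_nat N + 2 * of_nat d - 2 = 2 * (b - 1 - 2 * of_nat l)" by (simp add: b_def par_b_def)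
  have L: "x * (of_nat l * x ^ (l - 1)) = of_nat l * x ^ l" by (cases l) auto
  have "2 * \<i> * x * radial' s N m l d x - 2 * s * x * radial s N m l d x
      + \<i> * (of_nat N + 2 * of_nat d - 2) * radial s N m l d x
      = 2 * \<i> * e * ((x * (of_nat l * x ^ (l - 1)) + (b - 1 - 2 * of_nat l) * x ^ l) * hyp1F1 a b z + x ^ l * z * hyp1F1' a b z)"
    unfolding radial_def radial'_def N a_def[symmetric] b_def[symmetric] z_def[symmetric] e_def[symmetric]
    by (simp add: algebra_simps z_def)
  also have "\<dots> = 2 * \<i> * e * x ^ l * ((b - 1 - of_nat l) * hyp1F1 a b z + z * hyp1F1' a b z)"
    unfolding L by (simp add: algebra_simps)
  also have "(b - 1 - of_nat l) * hyp1F1 a b z + z * hyp1F1' a b z =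
      (b - 1 - of_nat l) * hyp1F1 a (b - 1) z + of_nat l / (b - 1) * (z * hyp1F1' a b z)"
    unfolding G by (rule up_arith(2)[OF b1'])
  also have "2 * \<i> * e * x ^ l * \<dots> = 2 * \<i> * (b - 1 - of_nat l) * radial s N (m + 2) l (d - 1) x
      + 2 * \<i> * (of_nat l / (b - 1) * (2 * \<i> * s)) * e * x ^ (l + 1) * hyp1F1' a b z"
    unfolding radial_def p z_def[symmetric] e_def[symmetric]
    by (simp add: algebra_simps z_def)
  finally show ?thesis
    unfolding radial_def p a_def[symmetric] b_def[symmetric] z_def[symmetric] e_def[symmetric] D
    by (simp add: mult_ac)
qed

lemma radial_E_minus_down:
  assumes "N \<ge> 1" "d \<ge> 1"
  shows "- 2 * \<i> * x * radial' s N m l d x - 2 * s * x * radial s N m l d x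
      - \<i> * (of_nat N + 2 * of_nat d - 2) * radial s N m l d x =
    - 2 * \<i> * (par_b N l d - 1 - of_nat l) * radial s N (m - 2) l (d - 1) x +
    2 * \<i> * (of_nat l / (par_b N l d - 1) * ((par_b N l d - par_a N m l d) / par_b N l d) * (2 * \<i> * s)) * radial s N (m - 2) (l + 1) (d - 1) x"
proof -
  define a b where "a = par_a N m l d" and "b = par_b N l d"
  define z where "z = 2 * \<i> * s * x"
  define e where "e = exp (- (\<i> * s * x))"
  define P where "P = hyp1F1' a b z - hyp1F1 a b z"
  have P': "hyp1F1' a b z = hyp1F1 a b z + P" by (simp add: P_def)
  have p: "par_a N (m - 2) (l + 1) (d - 1) = a" "par_b N (l + 1) (d - 1) = b + 1"
    "par_a N (m - 2) l (d - 1) = a - 1" "par_b N l (d - 1) = b - 1"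
    using assms by (simp_all add: par_a_def par_b_def a_def b_def field_simps of_nat_diff)
  have D: "(b - a) / b * hyp1F1 a (b + 1) z = - P"
    using hyp1F1_raise_b[of b a z] Re_par_b[OF assms(1)] by (simp add: b_def P_def)
  have b1: "Re b > 1" using Re_par_b_gt_1[of N l d] assms by (simp add: b_def)
  then have b1': "b - 1 \<noteq> 0" by auto
  then have G: "hyp1F1 (a - 1) (b - 1) z = hyp1F1 a b z + z * P / (b - 1)"
    using hyp1F1_lower_a_b[OF b1, of z a] unfolding P_def by (simp add: field_simps)
  have N: "of_nat N + 2 * of_nat d - 2 = 2 * (b - 1 - 2 * of_nat l)" by (simp add: b_def par_b_def)
  have L: "x * (of_nat l * x ^ (l - 1)) = of_nat l * x ^ l" by (cases l) auto
  have "- 2 * \<i> * x * radial' s N m l d x - 2 * s * x * radial s N m l d x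
      - \<i> * (of_nat N + 2 * of_nat d - 2) * radial s N m l d x
      = - 2 * \<i> * e * ((x * (of_nat l * x ^ (l - 1)) + (b - 1 - 2 * of_nat l) * x ^ l) * hyp1F1 a b z + x ^ l * z * P)"
    unfolding radial_def radial'_def N a_def[symmetric] b_def[symmetric] z_def[symmetric] e_def[symmetric] P'
    by (simp add: algebra_simps z_def)
  also have "\<dots> = - 2 * \<i> * e * x ^ l * ((b - 1 - of_nat l) * hyp1F1 a b z + z * P)"
    unfolding L by (simp add: algebra_simps)
  also have "(b - 1 - of_nat l) * hyp1F1 a b z + z * P =
      (b - 1 - of_nat l) * hyp1F1 (a - 1) (b - 1) z + of_nat l / (b - 1) * (z * P)"
    unfolding G by (rule up_arith(2)[OF b1'])
  also have "- 2 * \<i> * e * x ^ l * \<dots> = - 2 * \<i> * (b - 1 - of_nat l) * radial s N (m - 2) l (d - 1) x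
      + 2 * \<i> * (of_nat l / (b - 1) * (2 * \<i> * s)) * e * x ^ (l + 1) * (- P)"
    unfolding radial_def p z_def[symmetric] e_def[symmetric]
    by (simp add: algebra_simps z_def)
  finally show ?thesis
    unfolding radial_def p a_def[symmetric] b_def[symmetric] z_def[symmetric] e_def[symmetric] D[symmetric]
    by (simp add: mult_ac)
qed

text \<open>The bracket of \<open>op_eta_plus\<close> on a basic function: Euler's operator becomes
  2x d/dx + d, and the derivative in \<theta> contributes -m/2. The term from exp(-isx) cancels the
  potential 2isx, which leaves \<open>hyp1F1_raise_a\<close>.\<close>

lemma radial_eta_plus:
  assumes "N \<ge> 1"
  shows "- (2 * x * radial' s N m l d x + of_nat d * radial s N m l d x) - of_int m / 2 * radial s N m l d x
      - (of_nat N / 2 + 2 * \<i> * s * x) * radial s N m l d x = - 2 * par_a N m l d * radial s N (m + 4) l d x"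
proof -
  define a b where "a = par_a N m l d" and "b = par_b N l d"
  define z where "z = 2 * \<i> * s * x"
  define e where "e = exp (- (\<i> * s * x))"
  have p: "par_a N (m + 4) l d = a + 1"
    by (simp add: par_a_def a_def field_simps)
  have G: "a * hyp1F1 (a + 1) b z = z * hyp1F1' a b z + a * hyp1F1 a b z"
    using hyp1F1_raise_a[of b z a] Re_par_b[OF assms] by (simp add: b_def)
  have L: "x * (of_nat l * x ^ (l - 1)) = of_nat l * x ^ l" by (cases l) auto
  have d: "of_nat d = 2 * a - of_int m / 2 - of_nat N / 2 - 2 * of_nat l" by (simp add: a_def par_a_def field_simps)
  have "- (2 * x * radial' s N m l d x + of_nat d * radial s N m l d x) - of_int m / 2 * radial s N m l d x
      - (of_nat N / 2 + 2 * \<i> * s * x) * radial s N m l d x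
      = - 2 * e * ((x * (of_nat l * x ^ (l - 1)) + (a - of_nat l) * x ^ l) * hyp1F1 a b z + x ^ l * z * hyp1F1' a b z)"
    unfolding radial_def radial'_def d a_def[symmetric] b_def[symmetric] z_def[symmetric] e_def[symmetric]
    by (simp add: algebra_simps z_def)
  also have "\<dots> = - 2 * e * x ^ l * (a * hyp1F1 (a + 1) b z)"
    unfolding L G by (simp add: algebra_simps)
  finally show ?thesis
    unfolding radial_def p a_def[symmetric] b_def[symmetric] z_def[symmetric] e_def[symmetric]
    by (simp add: mult_ac)
qed

lemma radial_eta_minus:
  assumes "N \<ge> 1"
  shows "- (2 * x * radial' s N m l d x + of_nat d * radial s N m l d x) + of_int m / 2 * radial s N m l d x
      - (of_nat N / 2 - 2 * \<i> * s * x) * radial s N m l d x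
      = - 2 * (par_b N l d - par_a N m l d) * radial s N (m - 4) l d x"
proof -
  define a b where "a = par_a N m l d" and "b = par_b N l d"
  define z where "z = 2 * \<i> * s * x"
  define e where "e = exp (- (\<i> * s * x))"
  have p: "par_a N (m - 4) l d = a - 1"
    by (simp add: par_a_def a_def field_simps)
  have G: "(b - a) * hyp1F1 (a - 1) b z = z * hyp1F1' a b z - z * hyp1F1 a b z + (b - a) * hyp1F1 a b z"
    using hyp1F1_lower_a[of b z a] Re_par_b[OF assms] by (simp add: b_def)
  have L: "x * (of_nat l * x ^ (l - 1)) = of_nat l * x ^ l" by (cases l) auto
  have d: "of_nat d = 2 * (b - a) + of_int m / 2 - of_nat N / 2 - 2 * of_nat l"
    by (simp add: a_def b_def par_a_def par_b_def field_simps)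
  have "- (2 * x * radial' s N m l d x + of_nat d * radial s N m l d x) + of_int m / 2 * radial s N m l d x
      - (of_nat N / 2 - 2 * \<i> * s * x) * radial s N m l d x
      = - 2 * e * ((x * (of_nat l * x ^ (l - 1)) + (b - a - of_nat l) * x ^ l - x ^ l * z) * hyp1F1 a b z + x ^ l * z * hyp1F1' a b z)"
    unfolding radial_def radial'_def d a_def[symmetric] b_def[symmetric] z_def[symmetric] e_def[symmetric]
    by (simp add: algebra_simps z_def)
  also have "\<dots> = - 2 * e * x ^ l * ((b - a) * hyp1F1 (a - 1) b z)"
    unfolding L G by (simp add: algebra_simps)
  finally show ?thesis
    unfolding radial_def p a_def[symmetric] b_def[symmetric] z_def[symmetric] e_def[symmetric]
    by (simp only: mult_ac)
qed

section \<open>The operators applied to the basic functions\<close>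

definition bfun :: "complex \<Rightarrow> int \<Rightarrow> nat \<Rightarrow> nat \<Rightarrow> (real ^ 'n::finite \<Rightarrow> complex) \<Rightarrow> 'n func" where
  "bfun s m l d h = (\<lambda>\<theta> y. exp (- \<i> * of_int m * of_real \<theta> / 2) *
     (radial s CARD('n) m l d (of_real ((norm y)\<^sup>2)) * h y))"

lemma basic_fun_eq:
  fixes h :: "real ^ 'n::finite \<Rightarrow> complex"
  shows "basic_fun s m l k h = bfun s m l (nat \<bar>k\<bar>) h"
proof (intro ext)
  fix \<theta> and y :: "real ^ 'n"
  have "complex_of_real (norm y ^ (2 * l)) = of_real ((norm y)\<^sup>2) ^ l"
    by (simp only: power_mult of_real_power)
  then show "basic_fun s m l k h \<theta> y = bfun s m l (nat \<bar>k\<bar>) h \<theta> y"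
    by (simp add: basic_fun_def bfun_def radial_def par_a_def par_b_def mult_ac)
qed

lemma bfun_zero: "bfun s m l d (\<lambda>y. 0) = 0"
  by (simp add: bfun_def fun_eq_iff)

lemma bfun_add: "bfun s m l d (\<lambda>y. f y + g y) = bfun s m l d f + bfun s m l d g"
  by (simp add: bfun_def fun_eq_iff algebra_simps)

lemma bfun_cmult: "bfun s m l d (\<lambda>y. c * f y) = fscale c (bfun s m l d f)"
  by (simp add: bfun_def fscale_def fun_eq_iff)

lemma bfun_sum: "bfun s m l d (\<lambda>y. \<Sum>i\<in>S. f i y) = (\<Sum>i\<in>S. bfun s m l d (f i))"
  by (induction S rule: infinite_finite_induct) (simp_all add: bfun_zero bfun_add)

text \<open>The radial factor may have zeros, but not arbitrarily close to the origin, because the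
  hypergeometric function is 1 there. Along a ray on which h does not vanish, a vanishing product
  would contradict continuity at 0.\<close>

lemma bfun_neq_0:
  fixes h :: "real ^ 'n::finite \<Rightarrow> complex"
  assumes h: "harmonic_poly d h" "h \<noteq> (\<lambda>y. 0)"
  shows "bfun s m l d h \<noteq> 0"
proof
  assume "bfun s m l d h = 0"
  then have 0: "radial s CARD('n) m l d (of_real ((norm y)\<^sup>2)) * h y = 0" for y
    by (auto simp: bfun_def fun_eq_iff dest!: spec[of _ 0])
  have homog: "homog d h" using h by (simp add: harmonic_poly_iff)
  obtain y where y: "h y \<noteq> 0" "y \<noteq> 0"
  proof (cases "d = 0")
    case True
    then have "h = (\<lambda>y. h 0)" using h harmonic_poly_0 by blast
    then have "h y \<noteq> 0" for y using h(2) by metis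
    then show ?thesis using that[of "axis undefined 1"] by (simp add: axis_eq_0_iff)
  next
    case False
    obtain y where "h y \<noteq> 0" using h(2) by auto
    moreover have "h 0 = 0" using False homog[unfolded homog_def, rule_format, of 0 0] by (simp add: power_0_left)
    ultimately show ?thesis using that by metis
  qed
  define f where "f t = hyp1F1 (par_a CARD('n) m l d) (par_b CARD('n) l d) (2 * \<i> * s * of_real ((norm (t *\<^sub>R y))\<^sup>2))" for t :: real
  have f0: "f t = 0" if "t \<noteq> 0" for t
  proof -
    have "h (t *\<^sub>R y) \<noteq> 0" using homog y that by (simp add: homog_def)
    then have "radial s CARD('n) m l d (of_real ((norm (t *\<^sub>R y))\<^sup>2)) = 0" using 0[of "t *\<^sub>R y"] by simp
    then show ?thesis using that y by (simp add: radial_def f_def)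
  qed
  have b: "Re (par_b CARD('n) l d) > 0" by (rule Re_par_b) (simp add: Suc_leI)
  have "isCont f 0" unfolding f_def
    by (intro continuous_intros isCont_o2[OF _ DERIV_isCont[OF hyp1F1_deriv[OF b]]])
  then have "(f \<longlongrightarrow> f 0) (at 0)" by (simp add: isCont_def)
  moreover have "(f \<longlongrightarrow> 0) (at 0)"
    by (rule Lim_transform_eventually[OF tendsto_const]) (auto simp: eventually_at_filter f0)
  ultimately have "f 0 = 0" using tendsto_unique by (metis at_neq_bot)
  then show False by (simp add: f_def hyp1F1_0[OF b])
qed

text \<open>The operators assign some value to every function, also where no derivative exists, and
  additivity can fail there. Separate differentiability in \<theta> and in y is what each operator
  needs for linearity.\<close>

definition diffable :: "'n::finite func \<Rightarrow> bool" where
  "diffable F \<longleftrightarrow> (\<forall>\<theta> y. (\<lambda>t. F t y) differentiable (at \<theta>)) \<and> (\<forall>\<theta> y. F \<theta> differentiable (at y))"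

lemma diffable_zero: "diffable 0"
  by (simp add: diffable_def zero_fun_def)

lemma diffable_add: "diffable F \<Longrightarrow> diffable G \<Longrightarrow> diffable (F + G)"
  by (simp add: diffable_def plus_fun_def)

lemma diffable_fscale: "diffable F \<Longrightarrow> diffable (fscale c F)"
  by (simp add: diffable_def fscale_def)

lemma dtheta_add: "diffable F \<Longrightarrow> diffable G \<Longrightarrow> dtheta (F + G) = dtheta F + dtheta G"
  by (simp add: diffable_def dtheta_def plus_fun_def fun_eq_iff vector_derivative_add_at)

lemma dtheta_fscale: "diffable F \<Longrightarrow> dtheta (fscale c F) = fscale c (dtheta F)"
  by (simp add: diffable_def dtheta_def fscale_def fun_eq_iff vector_derivative_mult_at)

lemma pdiff_fadd:
  "diffable F \<Longrightarrow> diffable G \<Longrightarrow> pdiff j (F \<theta> + G \<theta>) y = pdiff j (F \<theta>) y + pdiff j (G \<theta>) y"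
  by (simp add: diffable_def plus_fun_def pdiff_add)

lemma pdiff_fscale: "diffable F \<Longrightarrow> pdiff j (fscale c F \<theta>) y = c * pdiff j (F \<theta>) y"
  by (simp add: diffable_def fscale_def pdiff_mult)

definition linear_op :: "('n::finite func \<Rightarrow> 'n func) \<Rightarrow> bool" where
  "linear_op T \<longleftrightarrow> (\<forall>F G. diffable F \<longrightarrow> diffable G \<longrightarrow> T (F + G) = T F + T G) \<and>
     (\<forall>c F. diffable F \<longrightarrow> T (fscale c F) = fscale c (T F))"

lemma linear_op_kappa: "linear_op op_kappa"
  by (simp add: linear_op_def op_kappa_def dtheta_add dtheta_fscale fun_eq_iff)
     (simp add: fscale_def algebra_simps)

lemma euler_add: "diffable F \<Longrightarrow> diffable G \<Longrightarrow> euler (F + G) = euler F + euler G"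
  by (simp add: euler_def fun_eq_iff pdiff_fadd algebra_simps sum.distrib)

lemma euler_fscale: "diffable F \<Longrightarrow> euler (fscale c F) = fscale c (euler F)"
  by (simp add: euler_def fun_eq_iff pdiff_fscale) (simp add: fscale_def sum_distrib_left mult_ac)

lemma linear_op_eta_plus: "linear_op (op_eta_plus s)"
  by (simp add: linear_op_def op_eta_plus_def dtheta_add dtheta_fscale euler_add euler_fscale fun_eq_iff)
     (simp add: fscale_def algebra_simps)

lemma linear_op_eta_minus: "linear_op (op_eta_minus s)"
  by (simp add: linear_op_def op_eta_minus_def dtheta_add dtheta_fscale euler_add euler_fscale fun_eq_iff)
     (simp add: fscale_def algebra_simps)

lemma linear_op_E_plus: "linear_op (op_E_plus s j)"
  by (simp add: linear_op_def op_E_plus_def pdiff_fadd pdiff_fscale fun_eq_iff)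
     (simp add: fscale_def algebra_simps)

lemma linear_op_E_minus: "linear_op (op_E_minus s j)"
  by (simp add: linear_op_def op_E_minus_def pdiff_fadd pdiff_fscale fun_eq_iff)
     (simp add: fscale_def algebra_simps)

lemma linear_op_so: "linear_op (op_so A)"
  by (simp add: linear_op_def op_so_def pdiff_fadd pdiff_fscale fun_eq_iff)
     (simp add: fscale_def algebra_simps sum.distrib sum_distrib_left sum_negf)

lemma bfun_has_derivative:
  fixes h :: "real ^ 'n::finite \<Rightarrow> complex"
  assumes "(h has_derivative h') (at y)"
  shows "(bfun s m l d h \<theta> has_derivative (\<lambda>v. exp (- \<i> * of_int m * of_real \<theta> / 2) *
    (radial' s CARD('n) m l d (of_real ((norm y)\<^sup>2)) * (2 * of_real (y \<bullet> v)) * h y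
     + radial s CARD('n) m l d (of_real ((norm y)\<^sup>2)) * h' v))) (at y)"
proof -
  have N: "CARD('n) \<ge> 1" by (simp add: Suc_leI)
  have 1: "((\<lambda>y :: real ^ 'n. complex_of_real ((norm y)\<^sup>2)) has_derivative (\<lambda>v. 2 * of_real (y \<bullet> v))) (at y)"
  proof -
    have "((\<lambda>y :: real ^ 'n. complex_of_real (y \<bullet> y)) has_derivative (\<lambda>v. of_real (y \<bullet> v + v \<bullet> y))) (at y)"
      by (intro has_derivative_of_real has_derivative_inner has_derivative_ident)
    then show ?thesis by (simp add: power2_norm_eq_inner inner_commute)
  qed
  have "(radial s CARD('n) m l d has_derivative (\<lambda>v. v * radial' s CARD('n) m l d (of_real ((norm y)\<^sup>2))))
      (at (of_real ((norm y)\<^sup>2)))"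
    using radial_deriv[OF N] by (simp add: has_field_derivative_def mult.commute[of _ "radial' _ _ _ _ _ _"])
  from has_derivative_compose[OF 1 this]
  have 2: "((\<lambda>y :: real ^ 'n. radial s CARD('n) m l d (of_real ((norm y)\<^sup>2))) has_derivative
      (\<lambda>v. 2 * of_real (y \<bullet> v) * radial' s CARD('n) m l d (of_real ((norm y)\<^sup>2)))) (at y)" .
  show ?thesis
    unfolding bfun_def
    by (rule has_derivative_eq_rhs, rule has_derivative_mult_right, rule has_derivative_mult[OF 2 assms])
      (simp add: fun_eq_iff algebra_simps)
qed

lemma pdiff_bfun:
  fixes h :: "real ^ 'n::finite \<Rightarrow> complex"
  assumes "cpoly h"
  shows "pdiff j (bfun s m l d h \<theta>) y = exp (- \<i> * of_int m * of_real \<theta> / 2) *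
    (2 * of_real (y $ j) * radial' s CARD('n) m l d (of_real ((norm y)\<^sup>2)) * h y
     + radial s CARD('n) m l d (of_real ((norm y)\<^sup>2)) * pdiff j h y)"
proof -
  obtain h' where h': "(h has_derivative h') (at y)"
    using cpoly_differentiable[OF assms] by (auto simp: differentiable_def)
  show ?thesis
    using pdiff_eq[OF bfun_has_derivative[OF h', of s m l d \<theta>], of j] pdiff_eq[OF h', of j]
    by (simp add: inner_axis mult_ac)
qed

lemma bfun_dtheta:
  "((\<lambda>t. bfun s m l d h t y) has_vector_derivative - \<i> * of_int m / 2 * bfun s m l d h \<theta> y) (at \<theta>)"
proof -
  have "((\<lambda>z. exp (- \<i> * of_int m * z / 2) * c) has_field_derivative
      - \<i> * of_int m / 2 * (exp (- \<i> * of_int m * of_real \<theta> / 2) * c)) (at (of_real \<theta>))" for c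
    by (auto intro!: derivative_eq_intros)
  from has_vector_derivative_real_field[OF this] show ?thesis
    unfolding bfun_def by simp
qed

lemma dtheta_bfun: "dtheta (bfun s m l d h) = fscale (- \<i> * of_int m / 2) (bfun s m l d h)"
  by (intro ext) (simp add: dtheta_def vector_derivative_at[OF bfun_dtheta] fscale_def)

lemma diffable_bfun:
  assumes "cpoly h"
  shows "diffable (bfun s m l d h)"
  unfolding diffable_def
proof (intro conjI allI)
  fix \<theta> y
  show "(\<lambda>t. bfun s m l d h t y) differentiable at \<theta>"
    using bfun_dtheta by (rule differentiableI_vector)
  obtain h' where h': "(h has_derivative h') (at y)"
    using cpoly_differentiable[OF assms] by (auto simp: differentiable_def)
  show "bfun s m l d h \<theta> differentiable at y"
    using bfun_has_derivative[OF h'] unfolding differentiable_def by blast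
qed

lemma op_kappa_bfun: "op_kappa (bfun s m l d h) = fscale (of_int m / 2) (bfun s m l d h)"
  by (simp add: op_kappa_def dtheta_bfun fscale_def fun_eq_iff mult.assoc[symmetric])

lemma euler_bfun:
  fixes h :: "real ^ 'n::finite \<Rightarrow> complex"
  assumes "cpoly h" "homog d h"
  shows "euler (bfun s m l d h) \<theta> y = exp (- \<i> * of_int m * of_real \<theta> / 2) *
    (2 * of_real ((norm y)\<^sup>2) * radial' s CARD('n) m l d (of_real ((norm y)\<^sup>2))
     + of_nat d * radial s CARD('n) m l d (of_real ((norm y)\<^sup>2))) * h y"
proof -
  let ?R = "radial s CARD('n) m l d (of_real ((norm y)\<^sup>2))"
  let ?R' = "radial' s CARD('n) m l d (of_real ((norm y)\<^sup>2))"
  let ?e = "exp (- \<i> * of_int m * of_real \<theta> / 2)"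
  have "euler (bfun s m l d h) \<theta> y = (\<Sum>j\<in>UNIV. (?e * 2 * ?R' * h y) * (of_real (y $ j) * of_real (y $ j))
      + (?e * ?R) * (of_real (y $ j) * pdiff j h y))"
    unfolding euler_def by (simp add: pdiff_bfun[OF assms(1)] algebra_simps)
  also have "\<dots> = ?e * 2 * ?R' * h y * of_real ((norm y)\<^sup>2) + ?e * ?R * (of_nat d * h y)"
    by (simp only: sum.distrib sum_distrib_left[symmetric] euler_homog[OF assms] complex_norm_sq)
  finally show ?thesis by (simp add: algebra_simps)
qed

lemma op_eta_plus_bfun:
  fixes h :: "real ^ 'n::finite \<Rightarrow> complex"
  assumes "cpoly h" "homog d h"
  shows "op_eta_plus s (bfun s m l d h) = fscale (- par_a CARD('n) m l d) (bfun s (m + 4) l d h)"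
proof (intro ext)
  fix \<theta> and y :: "real ^ 'n"
  have N: "CARD('n) \<ge> 1" by (simp add: Suc_leI)
  define x where "x = complex_of_real ((norm y)\<^sup>2)"
  define e where "e = exp (- \<i> * of_int m * of_real \<theta> / 2)"
  have e: "exp (- \<i> * of_int (m + 4) * of_real \<theta> / 2) = exp (- 2 * \<i> * of_real \<theta>) * e"
    unfolding e_def exp_add[symmetric] by (rule arg_cong[where f = exp]) (simp add: field_simps)
  have "op_eta_plus s (bfun s m l d h) \<theta> y = 1/2 * (exp (- 2 * \<i> * of_real \<theta>) * e) * h y *
      (- (2 * x * radial' s CARD('n) m l d x + of_nat d * radial s CARD('n) m l d x)
       - of_int m / 2 * radial s CARD('n) m l d x
       - (of_nat CARD('n) / 2 + 2 * \<i> * s * x) * radial s CARD('n) m l d x)"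
    unfolding op_eta_plus_def euler_bfun[OF assms] dtheta_bfun
    by (simp add: fscale_def bfun_def x_def e_def algebra_simps)
  also have "\<dots> = fscale (- par_a CARD('n) m l d) (bfun s (m + 4) l d h) \<theta> y"
    unfolding radial_eta_plus[OF N] fscale_def bfun_def e x_def[symmetric] by (simp only: mult_ac) simp
  finally show "op_eta_plus s (bfun s m l d h) \<theta> y = fscale (- par_a CARD('n) m l d) (bfun s (m + 4) l d h) \<theta> y" .
qed

lemma op_eta_minus_bfun:
  fixes h :: "real ^ 'n::finite \<Rightarrow> complex"
  assumes "cpoly h" "homog d h"
  shows "op_eta_minus s (bfun s m l d h) =
    fscale (- (par_b CARD('n) l d - par_a CARD('n) m l d)) (bfun s (m - 4) l d h)"
proof (intro ext)
  fix \<theta> and y :: "real ^ 'n"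
  have N: "CARD('n) \<ge> 1" by (simp add: Suc_leI)
  define x where "x = complex_of_real ((norm y)\<^sup>2)"
  define e where "e = exp (- \<i> * of_int m * of_real \<theta> / 2)"
  have e: "exp (- \<i> * of_int (m - 4) * of_real \<theta> / 2) = exp (2 * \<i> * of_real \<theta>) * e"
    unfolding e_def exp_add[symmetric] by (rule arg_cong[where f = exp]) (simp add: field_simps)
  have "op_eta_minus s (bfun s m l d h) \<theta> y = 1/2 * (exp (2 * \<i> * of_real \<theta>) * e) * h y *
      (- (2 * x * radial' s CARD('n) m l d x + of_nat d * radial s CARD('n) m l d x)
       + of_int m / 2 * radial s CARD('n) m l d x
       - (of_nat CARD('n) / 2 - 2 * \<i> * s * x) * radial s CARD('n) m l d x)"
    unfolding op_eta_minus_def euler_bfun[OF assms] dtheta_bfun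
    by (simp add: fscale_def bfun_def x_def e_def algebra_simps)
  also have "\<dots> = fscale (- (par_b CARD('n) l d - par_a CARD('n) m l d)) (bfun s (m - 4) l d h) \<theta> y"
    unfolding radial_eta_minus[OF N] fscale_def bfun_def e x_def[symmetric] by (simp add: algebra_simps)
  finally show "op_eta_minus s (bfun s m l d h) \<theta> y = fscale (- (par_b CARD('n) l d - par_a CARD('n) m l d)) (bfun s (m - 4) l d h) \<theta> y" .
qed

lemma op_so_bfun:
  fixes h :: "real ^ 'n::finite \<Rightarrow> complex"
  assumes "cpoly h" "transpose A = - A"
  shows "op_so A (bfun s m l d h) = bfun s m l d (rot A h)"
proof (intro ext)
  fix \<theta> and y :: "real ^ 'n"
  let ?R = "radial s CARD('n) m l d (of_real ((norm y)\<^sup>2))"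
  let ?R' = "radial' s CARD('n) m l d (of_real ((norm y)\<^sup>2))"
  let ?e = "exp (- \<i> * of_int m * of_real \<theta> / 2)"
  have "(\<Sum>j\<in>UNIV. \<Sum>i\<in>UNIV. complex_of_real (A $ j $ i) * (of_real (y $ j) * of_real (y $ i))) = 0"
    by (rule skew_sum_zero[OF assms(2)]) (simp add: mult.commute)
  \<comment> \<open>A y is orthogonal to y for skew A, so radial factors are constant in the
    direction of the rotation and only h is differentiated.\<close>
  then have 0: "(\<Sum>j\<in>UNIV. complex_of_real ((A *v y) $ j) * of_real (y $ j)) = 0"
    by (simp add: matrix_vector_mult_def sum_distrib_left sum_distrib_right mult_ac)
  have "op_so A (bfun s m l d h) \<theta> y = - (\<Sum>j\<in>UNIV. (?e * 2 * ?R' * h y) * (of_real ((A *v y) $ j) * of_real (y $ j))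
      + (?e * ?R) * (of_real ((A *v y) $ j) * pdiff j h y))"
    unfolding op_so_def by (simp add: pdiff_bfun[OF assms(1)] algebra_simps)
  also have "\<dots> = bfun s m l d (rot A h) \<theta> y"
    by (simp only: sum.distrib sum_distrib_left[symmetric] 0) (simp add: bfun_def rot_def)
  finally show "op_so A (bfun s m l d h) \<theta> y = bfun s m l d (rot A h) \<theta> y" .
qed

text \<open>The truncated and degenerate values are harmless: \<open>l - 1\<close> and the quotient
  by b - 1 come with a factor l, and for l \<ge> 1 that quotient is proper, while for d = 0 the
  terms with \<open>d - 1\<close> contain \<open>h_down\<close>, which is then zero.\<close>

lemma op_E_plus_bfun:
  fixes h :: "real ^ 'n::finite \<Rightarrow> complex" and m :: int and l :: nat
  assumes h: "harmonic_poly d h"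
  defines "a \<equiv> par_a CARD('n) m l d" and "b \<equiv> par_b CARD('n) l d"
  shows "op_E_plus s j (bfun s m l d h) =
    fscale (2 * \<i> * of_nat l) (bfun s (m + 2) (l - 1) (d + 1) (h_up j d h)) +
    fscale (2 * \<i> * (lift_coeff CARD('n) l d * (a / b) * (2 * \<i> * s))) (bfun s (m + 2) l (d + 1) (h_up j d h)) +
    fscale (2 * \<i> * (b - 1 - of_nat l)) (bfun s (m + 2) l (d - 1) (h_down j d h)) +
    fscale (2 * \<i> * (of_nat l / (b - 1) * (a / b) * (2 * \<i> * s))) (bfun s (m + 2) (l + 1) (d - 1) (h_down j d h))"
    (is "_ = ?rhs")
proof (intro ext)
  fix \<theta> and y :: "real ^ 'n"
  have N: "CARD('n) \<ge> 1" by (simp add: Suc_leI)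
  have cp: "cpoly h" using h by (simp add: harmonic_poly_iff)
  define x where "x = complex_of_real ((norm y)\<^sup>2)"
  define e where "e = exp (- \<i> * of_int m * of_real \<theta> / 2)"
  have e: "exp (- \<i> * of_int (m + 2) * of_real \<theta> / 2) = exp (- \<i> * of_real \<theta>) * e"
    unfolding e_def exp_add[symmetric] by (rule arg_cong[where f = exp]) (simp add: field_simps)
  let ?R = "radial s CARD('n) m l d x" and ?R' = "radial' s CARD('n) m l d x"
  have "op_E_plus s j (bfun s m l d h) \<theta> y = exp (- \<i> * of_real \<theta>) * e *
      ((2 * \<i> * ?R' - 2 * s * ?R) * (of_real (y $ j) * h y) + \<i> * ?R * pdiff j h y)"
    unfolding op_E_plus_def pdiff_bfun[OF cp]
    by (simp add: bfun_def x_def e_def algebra_simps)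
  also have "(2 * \<i> * ?R' - 2 * s * ?R) * (of_real (y $ j) * h y) + \<i> * ?R * pdiff j h y =
      (2 * \<i> * ?R' - 2 * s * ?R) * h_up j d h y + (2 * \<i> * x * ?R' - 2 * s * x * ?R
       + \<i> * (of_nat CARD('n) + 2 * of_nat d - 2) * ?R) * h_down j d h y"
    unfolding mult_coord_eq[of y j h d] pdiff_eq_h_down[OF h] x_def by (simp only: algebra_simps)
  also have "(2 * \<i> * x * ?R' - 2 * s * x * ?R + \<i> * (of_nat CARD('n) + 2 * of_nat d - 2) * ?R) * h_down j d h y =
      (2 * \<i> * (b - 1 - of_nat l) * radial s CARD('n) (m + 2) l (d - 1) x +
       2 * \<i> * (of_nat l / (b - 1) * (a / b) * (2 * \<i> * s)) * radial s CARD('n) (m + 2) (l + 1) (d - 1) x)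
       * h_down j d h y"
  proof (cases "d = 0")
    case True
    then show ?thesis using h by (simp add: h_down_0)
  next
    case False
    then show ?thesis unfolding a_def b_def by (subst radial_E_plus_down[OF N]) auto
  qed
  also have "2 * \<i> * ?R' - 2 * s * ?R = 2 * \<i> * of_nat l * radial s CARD('n) (m + 2) (l - 1) (d + 1) x +
    2 * \<i> * (lift_coeff CARD('n) l d * (a / b) * (2 * \<i> * s)) * radial s CARD('n) (m + 2) l (d + 1) x"
    unfolding a_def b_def by (rule radial_E_plus_up[OF N])
  finally show "op_E_plus s j (bfun s m l d h) \<theta> y = ?rhs \<theta> y"
    unfolding bfun_def fscale_def plus_fun_def e x_def[symmetric] by (simp only: algebra_simps)
qed

lemma op_E_minus_bfun:
  fixes h :: "real ^ 'n::finite \<Rightarrow> complex" and m :: int and l :: nat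
  assumes h: "harmonic_poly d h"
  defines "a \<equiv> par_a CARD('n) m l d" and "b \<equiv> par_b CARD('n) l d"
  shows "op_E_minus s j (bfun s m l d h) =
    fscale (- 2 * \<i> * of_nat l) (bfun s (m - 2) (l - 1) (d + 1) (h_up j d h)) +
    fscale (2 * \<i> * (lift_coeff CARD('n) l d * ((b - a) / b) * (2 * \<i> * s))) (bfun s (m - 2) l (d + 1) (h_up j d h)) +
    fscale (- 2 * \<i> * (b - 1 - of_nat l)) (bfun s (m - 2) l (d - 1) (h_down j d h)) +
    fscale (2 * \<i> * (of_nat l / (b - 1) * ((b - a) / b) * (2 * \<i> * s))) (bfun s (m - 2) (l + 1) (d - 1) (h_down j d h))"
    (is "_ = ?rhs")
proof (intro ext)
  fix \<theta> and y :: "real ^ 'n"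
  have N: "CARD('n) \<ge> 1" by (simp add: Suc_leI)
  have cp: "cpoly h" using h by (simp add: harmonic_poly_iff)
  define x where "x = complex_of_real ((norm y)\<^sup>2)"
  define e where "e = exp (- \<i> * of_int m * of_real \<theta> / 2)"
  have e: "exp (- \<i> * of_int (m - 2) * of_real \<theta> / 2) = exp (\<i> * of_real \<theta>) * e"
    unfolding e_def exp_add[symmetric] by (rule arg_cong[where f = exp]) (simp add: field_simps)
  let ?R = "radial s CARD('n) m l d x" and ?R' = "radial' s CARD('n) m l d x"
  have "op_E_minus s j (bfun s m l d h) \<theta> y = exp (\<i> * of_real \<theta>) * e *
      ((- 2 * \<i> * ?R' - 2 * s * ?R) * (of_real (y $ j) * h y) - \<i> * ?R * pdiff j h y)"
    unfolding op_E_minus_def pdiff_bfun[OF cp]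
    by (simp add: bfun_def x_def e_def algebra_simps)
  also have "(- 2 * \<i> * ?R' - 2 * s * ?R) * (of_real (y $ j) * h y) - \<i> * ?R * pdiff j h y =
      (- 2 * \<i> * ?R' - 2 * s * ?R) * h_up j d h y + (- 2 * \<i> * x * ?R' - 2 * s * x * ?R
       - \<i> * (of_nat CARD('n) + 2 * of_nat d - 2) * ?R) * h_down j d h y"
    unfolding mult_coord_eq[of y j h d] pdiff_eq_h_down[OF h] x_def by (simp add: algebra_simps)
  also have "(- 2 * \<i> * x * ?R' - 2 * s * x * ?R - \<i> * (of_nat CARD('n) + 2 * of_nat d - 2) * ?R) * h_down j d h y =
      (- 2 * \<i> * (b - 1 - of_nat l) * radial s CARD('n) (m - 2) l (d - 1) x +
       2 * \<i> * (of_nat l / (b - 1) * ((b - a) / b) * (2 * \<i> * s)) * radial s CARD('n) (m - 2) (l + 1) (d - 1) x)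
       * h_down j d h y"
  proof (cases "d = 0")
    case True
    then show ?thesis using h by (simp add: h_down_0)
  next
    case False
    then show ?thesis unfolding a_def b_def by (subst radial_E_minus_down[OF N]) auto
  qed
  also have "- 2 * \<i> * ?R' - 2 * s * ?R = - 2 * \<i> * of_nat l * radial s CARD('n) (m - 2) (l - 1) (d + 1) x +
    2 * \<i> * (lift_coeff CARD('n) l d * ((b - a) / b) * (2 * \<i> * s)) * radial s CARD('n) (m - 2) l (d + 1) x"
    unfolding a_def b_def by (rule radial_E_minus_up[OF N])
  finally show "op_E_minus s j (bfun s m l d h) \<theta> y = ?rhs \<theta> y"
    unfolding bfun_def fscale_def plus_fun_def e x_def[symmetric] by (simp only: algebra_simps)
qed

section \<open>Submodules as sets of indices\<close>

declare plus_fun_apply [simp del] zero_fun_apply [simp del] minus_apply [simp del] uminus_apply [simp del]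

text \<open>The functions are linear in h and the harmonic polynomials form a vector space, so this
  set of functions is a subspace without taking a span.\<close>

definition block :: "complex \<Rightarrow> int \<times> nat \<times> int \<Rightarrow> 'n::finite func set" where
  "block s = (\<lambda>(m, l, k). {basic_fun s m l k h | h. h \<in> harm_space k})"

definition blocks :: "complex \<Rightarrow> (int \<times> nat \<times> int) set \<Rightarrow> 'n::finite func set" where
  "blocks s P = cfun.span (\<Union>p\<in>P. block s p)"

definition idx :: "'n::finite itself \<Rightarrow> int \<Rightarrow> (int \<times> nat \<times> int) set" where
  "idx T q = {(m, l, k). k \<in> harm_indices T \<and> [m = 2 * k + q] (mod 4)}"

lemma block_iff: "F \<in> block s (m, l, k) \<longleftrightarrow> (\<exists>h \<in> harm_space k. F = bfun s m l (nat \<bar>k\<bar>) h)"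
  by (auto simp: block_def basic_fun_eq)

lemma block_zero: "0 \<in> block s p"
  by (cases p) (auto simp: block_iff bfun_zero intro!: bexI[of _ "\<lambda>y. 0"] harm_space_zero)

lemma block_add: "F \<in> block s p \<Longrightarrow> G \<in> block s p \<Longrightarrow> F + G \<in> block s p"
  by (cases p) (force simp: block_iff bfun_add[symmetric] intro: harm_space_add)

lemma block_fscale: "F \<in> block s p \<Longrightarrow> fscale c F \<in> block s p"
  by (cases p) (force simp: block_iff bfun_cmult[symmetric] intro: harm_space_cmult)

lemma subspace_blocks: "cfun.subspace (blocks s P)"
  by (simp add: blocks_def)

lemma block_subset_blocks: "p \<in> P \<Longrightarrow> block s p \<subseteq> blocks s P"
  unfolding blocks_def by (rule subset_trans[OF _ cfun.span_superset]) auto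

lemma blocks_mono: "P \<subseteq> Q \<Longrightarrow> blocks s P \<subseteq> blocks s Q"
  unfolding blocks_def by (intro cfun.span_mono) auto

lemma blocks_least: "cfun.subspace W \<Longrightarrow> (\<And>p. p \<in> P \<Longrightarrow> block s p \<subseteq> W) \<Longrightarrow> blocks s P \<subseteq> W"
  unfolding blocks_def by (rule cfun.span_minimal) auto

lemma blocks_expand:
  assumes "F \<in> blocks s P"
  obtains S v where "finite S" "S \<subseteq> P" "\<And>p. v p \<in> block s p" "F = (\<Sum>p\<in>S. v p)"
proof -
  have "\<exists>S v. finite S \<and> S \<subseteq> P \<and> (\<forall>p. v p \<in> block s p) \<and> F = (\<Sum>p\<in>S. v p)"
    using assms unfolding blocks_def
  proof (induction rule: cfun.span_induct_alt)
    case base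
    show ?case by (intro exI[of _ "{}"] exI[of _ "\<lambda>_. 0"]) (simp add: block_zero)
  next
    case (step c x y)
    then obtain S v p where *: "finite S" "S \<subseteq> P" "\<And>p. v p \<in> block s p" "y = (\<Sum>p\<in>S. v p)"
      and p: "p \<in> P" "x \<in> block s p" by blast
    \<comment> \<open>Outside S the values of v are arbitrary members of their blocks. They are set
      to 0 so that the new index can be inserted without knowing whether it is already in S.\<close>
    define w where "w r = (if r \<in> S then v r else 0)" for r
    have y: "y = (\<Sum>r\<in>insert p S. w r)"
      using * by (simp add: w_def sum.insert_if cong: sum.cong)
    have "fscale c x + (\<Sum>r\<in>insert p S. w r) = (\<Sum>r\<in>insert p S. (w(p := fscale c x + w p)) r)"
    proof -
      have "(\<Sum>r\<in>insert p S. (w(p := fscale c x + w p)) r) = (fscale c x + w p) + (\<Sum>r\<in>S - {p}. w r)"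
        using *(1) by (subst sum.insert_remove) (auto intro!: sum.cong)
      then show ?thesis using *(1) by (simp add: sum.insert_remove add.assoc)
    qed
    then show ?case
      using * p y by (intro exI[of _ "insert p S"] exI[of _ "w(p := fscale c x + w p)"])
        (auto simp: w_def block_zero intro!: block_add block_fscale)
  qed
  then show ?thesis using that by blast
qed

lemma diffable_block: "F \<in> block s p \<Longrightarrow> diffable F"
  by (cases p) (auto simp: block_iff harmonic_poly_iff dest!: harm_space_harmonic intro!: diffable_bfun)

lemma diffable_subspace: "cfun.subspace (Collect diffable)"
  by (auto simp: cfun.subspace_def diffable_zero diffable_add diffable_fscale)

lemma diffable_blocks: "F \<in> blocks s P \<Longrightarrow> diffable F"
  using blocks_least[OF diffable_subspace, of P s] diffable_block by blast

lemma linear_op_zero: "linear_op T \<Longrightarrow> T 0 = 0"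
  unfolding linear_op_def using diffable_zero by (metis cfun.scale_zero_left)

lemma linear_op_blocks:
  assumes T: "linear_op T" and W: "cfun.subspace W" and P: "\<And>p F. p \<in> P \<Longrightarrow> F \<in> block s p \<Longrightarrow> T F \<in> W"
  assumes F: "F \<in> blocks s P"
  shows "T F \<in> W"
proof -
  have "cfun.subspace {F. diffable F \<and> T F \<in> W}"
    using T W diffable_subspace linear_op_zero[OF T]
    by (auto simp: cfun.subspace_def linear_op_def)
  then have "blocks s P \<subseteq> {F. diffable F \<and> T F \<in> W}"
    by (rule blocks_least) (use P diffable_block in blast)
  then show ?thesis using F by blast
qed

text \<open>Stability under the complexified algebra, stated for the operators whose action on basic
  functions is explicit. For complex subspaces it agrees with stability under the real algebra, by
  \<open>op_stable_iff\<close>.\<close>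

definition op_stable :: "complex \<Rightarrow> 'n::finite func set \<Rightarrow> bool" where
  "op_stable s N \<longleftrightarrow> (\<forall>F\<in>N. op_kappa F \<in> N \<and> op_eta_plus s F \<in> N \<and> op_eta_minus s F \<in> N \<and>
     (\<forall>j. op_E_plus s j F \<in> N \<and> op_E_minus s j F \<in> N) \<and> (\<forall>A. transpose A = - A \<longrightarrow> op_so A F \<in> N))"

text \<open>The weights \<open>4 a\<close> and \<open>4 (b - a)\<close>, where \<open>a\<close>, \<open>b\<close> are the parameters of \<open>hyp1F1\<close>.\<close>

definition wt_plus :: "nat \<Rightarrow> int \<times> nat \<times> int \<Rightarrow> int" where
  "wt_plus N = (\<lambda>(m, l, k). m + 4 * int l + 2 * \<bar>k\<bar> + int N)"

definition wt_minus :: "nat \<Rightarrow> int \<times> nat \<times> int \<Rightarrow> int" where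
  "wt_minus N = (\<lambda>(m, l, k). 4 * int l + 2 * \<bar>k\<bar> + int N - m)"

lemma par_a_eq: "par_a N m l (nat \<bar>k\<bar>) = of_int (wt_plus N (m, l, k)) / 4"
  by (simp add: par_a_def wt_plus_def)

lemma par_b_a_eq: "par_b N l (nat \<bar>k\<bar>) - par_a N m l (nat \<bar>k\<bar>) = of_int (wt_minus N (m, l, k)) / 4"
  by (simp add: par_a_def par_b_def wt_minus_def field_simps)

text \<open>The side conditions are those under which the coefficients in
  \<open>op_eta_plus_bfun\<close>, \<open>op_E_plus_bfun\<close> and their counterparts do not
  vanish, given s \<noteq> 0: a factor a or b - a for moves that raise \<open>wt_plus\<close> or
  \<open>wt_minus\<close>, a factor l for moves that change l. The moves to a smaller |k| with l
  fixed carry b - 1 - l, which is never 0 there.\<close>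

definition moves_closed :: "'n::finite itself \<Rightarrow> (int \<times> nat \<times> int) set \<Rightarrow> bool" where
  "moves_closed T P \<longleftrightarrow> (\<forall>m l k. (m, l, k) \<in> P \<longrightarrow>
     (wt_plus CARD('n) (m, l, k) \<noteq> 0 \<longrightarrow> (m + 4, l, k) \<in> P) \<and>
     (wt_minus CARD('n) (m, l, k) \<noteq> 0 \<longrightarrow> (m - 4, l, k) \<in> P) \<and>
     (\<forall>k'. next_index T k k' \<longrightarrow>
        (wt_plus CARD('n) (m, l, k) \<noteq> 0 \<longrightarrow> (m + 2, l, k') \<in> P) \<and>
        (wt_minus CARD('n) (m, l, k) \<noteq> 0 \<longrightarrow> (m - 2, l, k') \<in> P) \<and>
        (l \<ge> 1 \<longrightarrow> (m + 2, l - 1, k') \<in> P \<and> (m - 2, l - 1, k') \<in> P)) \<and>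
     (\<forall>k'. next_index T k' k \<longrightarrow>
        (m + 2, l, k') \<in> P \<and> (m - 2, l, k') \<in> P \<and>
        (l \<ge> 1 \<longrightarrow> (wt_plus CARD('n) (m, l, k) \<noteq> 0 \<longrightarrow> (m + 2, l + 1, k') \<in> P) \<and>
                    (wt_minus CARD('n) (m, l, k) \<noteq> 0 \<longrightarrow> (m - 2, l + 1, k') \<in> P))))"

lemma bfun_in_block: "h \<in> harm_space k \<Longrightarrow> d = nat \<bar>k\<bar> \<Longrightarrow> bfun s m l d h \<in> block s (m, l, k)"
  by (auto simp: block_iff)

lemma bfun_h_up_in_blocks:
  fixes h :: "real ^ 'n::finite \<Rightarrow> complex"
  assumes "k \<in> harm_indices TYPE('n)" "h \<in> harm_space k" "\<And>k'. next_index TYPE('n) k k' \<Longrightarrow> (m, l, k') \<in> Q"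
  shows "bfun s m l (nat \<bar>k\<bar> + 1) (h_up j (nat \<bar>k\<bar>) h) \<in> blocks s Q"
proof -
  obtain g where g: "\<And>k'. next_index TYPE('n) k k' \<Longrightarrow> g k' \<in> harm_space k'"
    "\<And>y. h_up j (nat \<bar>k\<bar>) h y = (\<Sum>k' | next_index TYPE('n) k k'. g k' y)"
    using harm_space_h_up[OF assms(1,2)] by blast
  have up: "h_up j (nat \<bar>k\<bar>) h = (\<lambda>y. \<Sum>k' | next_index TYPE('n) k k'. g k' y)"
    using g(2) by auto
  show ?thesis
    unfolding up bfun_sum
  proof (rule cfun.subspace_sum[OF subspace_blocks])
    fix k' assume "k' \<in> {k'. next_index TYPE('n) k k'}"
    then have k': "next_index TYPE('n) k k'" by simp
    have "bfun s m l (nat \<bar>k\<bar> + 1) (g k') \<in> block s (m, l, k')"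
      using g(1)[OF k'] nat_next_index[OF k'] by (intro bfun_in_block) auto
    then show "bfun s m l (nat \<bar>k\<bar> + 1) (g k') \<in> blocks s Q"
      using block_subset_blocks assms(3)[OF k'] by blast
  qed
qed

lemma next_index_pred:
  "k \<in> harm_indices T \<Longrightarrow> k \<noteq> 0 \<Longrightarrow> next_index T (k - sgn k) k"
  by (auto simp: next_index_def harm_indices_def sgn_if split: if_splits)

lemma bfun_h_down_in_blocks:
  fixes h :: "real ^ 'n::finite \<Rightarrow> complex"
  assumes "k \<in> harm_indices TYPE('n)" "h \<in> harm_space k" "\<And>k'. next_index TYPE('n) k' k \<Longrightarrow> (m, l, k') \<in> Q"
  shows "bfun s m l (nat \<bar>k\<bar> - 1) (h_down j (nat \<bar>k\<bar>) h) \<in> blocks s Q"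
proof (cases "k = 0")
  case True
  then have "h_down j (nat \<bar>k\<bar>) h = (\<lambda>y. 0)"
    using harm_space_harmonic[OF assms(2)] by (simp add: h_down_0)
  then show ?thesis using cfun.subspace_0[OF subspace_blocks] by (simp add: bfun_zero)
next
  case False
  note k' = next_index_pred[OF assms(1) False]
  have "bfun s m l (nat \<bar>k\<bar> - 1) (h_down j (nat \<bar>k\<bar>) h) \<in> block s (m, l, k - sgn k)"
    using harm_space_h_down[OF k' assms(2)] nat_next_index[OF k'] by (intro bfun_in_block) auto
  then show ?thesis using block_subset_blocks assms(3)[OF k'] by blast
qed

lemma fscale_in_blocks: "(c \<noteq> 0 \<Longrightarrow> F \<in> blocks s Q) \<Longrightarrow> fscale c F \<in> blocks s Q"
  by (cases "c = 0") (auto intro: cfun.subspace_scale[OF subspace_blocks] cfun.subspace_0[OF subspace_blocks])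

lemma op_stable_blocks:
  fixes P :: "(int \<times> nat \<times> int) set"
  assumes P: "P \<subseteq> idx TYPE('n::finite) q" and cl: "moves_closed TYPE('n) P"
  shows "op_stable s (blocks s P :: 'n func set)"
proof -
  have K: "k \<in> harm_indices TYPE('n)" if "(m, l, k) \<in> P" for m l k
    using that P by (auto simp: idx_def)
  have gen: "op_kappa F \<in> blocks s P \<and> op_eta_plus s F \<in> blocks s P \<and> op_eta_minus s F \<in> blocks s P \<and>
     (\<forall>j. op_E_plus s j F \<in> blocks s P \<and> op_E_minus s j F \<in> blocks s P) \<and> (\<forall>A. transpose A = - A \<longrightarrow> op_so A F \<in> blocks s P)"
    if p: "p \<in> P" "F \<in> block s p" for p and F :: "'n func"
  proof -
    obtain m l k where pe: "p = (m, l, k)" by (cases p)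
    obtain h where h: "h \<in> harm_space k" "F = bfun s m l (nat \<bar>k\<bar>) h" using p pe by (auto simp: block_iff)
    have hp: "harmonic_poly (nat \<bar>k\<bar>) h" "cpoly h" "homog (nat \<bar>k\<bar>) h"
      using harm_space_harmonic[OF h(1)] by (auto simp: harmonic_poly_iff)
    have pP: "(m, l, k) \<in> P" using p pe by simp
    note cl' = cl[unfolded moves_closed_def, rule_format, OF pP]
    have in_blocks: "bfun s m' l' (nat \<bar>k\<bar>) g \<in> blocks s P" if "(m', l', k) \<in> P" "g \<in> harm_space k" for m' l' and g :: "real ^ 'n \<Rightarrow> complex"
      using block_subset_blocks[OF that(1)] bfun_in_block[OF that(2) refl] by blast
    have kappa: "op_kappa F \<in> blocks s P"
      unfolding h op_kappa_bfun by (intro fscale_in_blocks in_blocks pP h)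
    have ep: "op_eta_plus s F \<in> blocks s P"
      unfolding h op_eta_plus_bfun[OF hp(2,3)] par_a_eq
      by (intro fscale_in_blocks in_blocks h) (use cl' in auto)
    have em: "op_eta_minus s F \<in> blocks s P"
      unfolding h op_eta_minus_bfun[OF hp(2,3)] par_b_a_eq
      by (intro fscale_in_blocks in_blocks h) (use cl' in auto)
    have so: "op_so A F \<in> blocks s P" if "transpose A = - A" for A
      unfolding h op_so_bfun[OF hp(2) that] by (intro in_blocks pP harm_space_rot h that)
    have Ep: "op_E_plus s j F \<in> blocks s P" for j
      unfolding h op_E_plus_bfun[OF hp(1)] par_a_eq
      by (intro cfun.subspace_add[OF subspace_blocks] fscale_in_blocks bfun_h_up_in_blocks[OF K[OF pP] h(1)]
          bfun_h_down_in_blocks[OF K[OF pP] h(1)])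
        (use cl' in auto)
    have Em: "op_E_minus s j F \<in> blocks s P" for j
      unfolding h op_E_minus_bfun[OF hp(1)] par_b_a_eq
      by (intro cfun.subspace_add[OF subspace_blocks] fscale_in_blocks bfun_h_up_in_blocks[OF K[OF pP] h(1)]
          bfun_h_down_in_blocks[OF K[OF pP] h(1)])
        (use cl' in auto)
    show ?thesis using kappa ep em so Ep Em by blast
  qed
  show ?thesis
    unfolding op_stable_def
    by (intro ballI conjI allI impI;
        rule linear_op_blocks[OF linear_op_kappa subspace_blocks]
          linear_op_blocks[OF linear_op_eta_plus subspace_blocks] linear_op_blocks[OF linear_op_eta_minus subspace_blocks]
          linear_op_blocks[OF linear_op_E_plus subspace_blocks] linear_op_blocks[OF linear_op_E_minus subspace_blocks]
          linear_op_blocks[OF linear_op_so subspace_blocks]; (assumption | use gen in blast))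
qed

text \<open>A change of k by 1 in either direction shifts 2k by 2 modulo 4, and 2 and -2 agree
  modulo 4. Hence both signs of m \<plusminus> 2 are admissible.\<close>

lemma cong_next_index:
  assumes "next_index T k k' \<or> next_index T k' k" "[m = 2 * k + q] (mod 4)"
  shows "[m + 2 = 2 * k' + q] (mod 4)" "[m - 2 = 2 * k' + q] (mod 4)"
proof -
  have "k' = k + 1 \<or> k' = k - 1" using assms(1) by (auto simp: next_index_def)
  then show "[m + 2 = 2 * k' + q] (mod 4)" "[m - 2 = 2 * k' + q] (mod 4)"
    using assms(2) unfolding cong_iff_dvd_diff by presburger+
qed

lemma moves_closed_idx: "moves_closed TYPE('n::finite) (idx TYPE('n) q)"
proof -
  have "[m + 4 = 2 * k + q] (mod 4)" "[m - 4 = 2 * k + q] (mod 4)"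
    if "[m = 2 * k + q] (mod 4)" for m k :: int
    using that unfolding cong_iff_dvd_diff by presburger+
  moreover have "k \<in> harm_indices TYPE('n)" "k' \<in> harm_indices TYPE('n)"
    if "next_index TYPE('n) k k'" for k k'
    using that by (auto simp: next_index_def)
  ultimately show ?thesis
    unfolding moves_closed_def idx_def mem_Collect_eq prod.case
    using cong_next_index[where T = "TYPE('n)" and q = q] by blast
qed

lemma subspace_idx_stable: "op_stable s (blocks s (idx TYPE('n) q) :: 'n::finite func set)"
  by (rule op_stable_blocks[OF subset_refl moves_closed_idx])

section \<open>Separation of the blocks by eigenvalues\<close>

definition linear_on :: "'n::finite func set \<Rightarrow> ('n func \<Rightarrow> 'n func) \<Rightarrow> bool" where
  "linear_on H T \<longleftrightarrow> (\<forall>F\<in>H. \<forall>G\<in>H. T (F + G) = T F + T G) \<and> (\<forall>c. \<forall>F\<in>H. T (fscale c F) = fscale c (T F))"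

lemma linear_on_sum:
  assumes H: "cfun.subspace H" and T: "linear_on H T" and v: "\<And>p. p \<in> S \<Longrightarrow> v p \<in> H"
  shows "T (\<Sum>p\<in>S. v p) = (\<Sum>p\<in>S. T (v p))"
proof -
  have T0: "T 0 = 0" using T cfun.subspace_0[OF H] unfolding linear_on_def by (metis cfun.scale_zero_left)
  show ?thesis using v
  proof (induction S rule: infinite_finite_induct)
    case (insert p S)
    then have "(\<Sum>p\<in>S. v p) \<in> H" by (intro cfun.subspace_sum[OF H]) auto
    then show ?case using insert T by (simp add: linear_on_def)
  qed (simp_all add: T0)
qed

text \<open>If T separates p0 from p1, then T - ev p1 removes the component at p1, rescales the
  others and keeps the sum in N. Different p1 may call for different operators, so the induction
  removes one index at a time.\<close>

lemma separate_eigenvectors: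
  assumes N: "cfun.subspace N" and H: "cfun.subspace H"
    and "finite S" "p0 \<in> S" "\<And>p. p \<in> S \<Longrightarrow> v p \<in> H" "(\<Sum>p\<in>S. v p) \<in> N"
    and sep: "\<And>p. p \<in> S \<Longrightarrow> p \<noteq> p0 \<Longrightarrow> \<exists>(T, ev)\<in>\<T>. ev p0 \<noteq> ev p"
    and ops: "\<And>T ev. (T, ev) \<in> \<T> \<Longrightarrow> linear_on H T \<and> (\<forall>F\<in>N. T F \<in> N) \<and> (\<forall>p\<in>S. T (v p) = fscale (ev p) (v p))"
  shows "v p0 \<in> N"
  using assms(3-)
proof (induction "card S" arbitrary: S v)
  case 0
  then show ?case by auto
next
  case (Suc n)
  show ?case
  proof (cases "S = {p0}")
    case True
    then show ?thesis using Suc.prems(4) by simp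
  next
    case False
    then obtain p1 where p1: "p1 \<in> S" "p1 \<noteq> p0" using Suc.prems(2) by blast
    then obtain T ev where T: "(T, ev) \<in> \<T>" "ev p0 \<noteq> ev p1" using Suc.prems(5) by blast
    note T' = Suc.prems(6)[OF T(1)]
    define w where "w p = fscale (ev p - ev p1) (v p)" for p
    have "(\<Sum>p\<in>S. w p) = (\<Sum>p\<in>S. T (v p)) - fscale (ev p1) (\<Sum>p\<in>S. v p)"
      using T' by (simp add: w_def cfun.scale_left_diff_distrib sum_subtractf cfun.scale_sum_right)
    also have "(\<Sum>p\<in>S. T (v p)) = T (\<Sum>p\<in>S. v p)"
      using T' Suc.prems(3) by (intro linear_on_sum[OF H, symmetric]) auto
    finally have "(\<Sum>p\<in>S. w p) \<in> N"
      using T' Suc.prems(4) by (simp add: cfun.subspace_diff[OF N] cfun.subspace_scale[OF N])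
    moreover have "(\<Sum>p\<in>S. w p) = (\<Sum>p\<in>S - {p1}. w p)"
      using p1 Suc.prems(1) by (simp add: sum.remove[of S p1] w_def)
    ultimately have sum: "(\<Sum>p\<in>S - {p1}. w p) \<in> N" by simp
    have "w p0 \<in> N"
    proof (rule Suc.hyps(1)[of "S - {p1}" w])
      show "n = card (S - {p1})" using Suc.hyps(2) p1 Suc.prems(1) by simp
      show "\<And>p. p \<in> S - {p1} \<Longrightarrow> w p \<in> H"
        using Suc.prems(3) by (auto simp: w_def intro!: cfun.subspace_scale[OF H])
      show "linear_on H T \<and> (\<forall>F\<in>N. T F \<in> N) \<and> (\<forall>p\<in>S - {p1}. T (w p) = fscale (ev p) (w p))"
        if "(T, ev) \<in> \<T>" for T ev
        using Suc.prems(6)[OF that] Suc.prems(3)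
        by (auto simp: w_def linear_on_def mult.commute)
    qed (use Suc.prems p1 sum in auto)
    then have "fscale (1 / (ev p0 - ev p1)) (w p0) \<in> N" by (rule cfun.subspace_scale[OF N])
    then show ?thesis using T(2) by (simp add: w_def)
  qed
qed

text \<open>The Casimir operator unless n = 2, where its eigenvalue depends on |k| only and a single
  rotation is used instead.\<close>

definition so_op :: "'n::finite func \<Rightarrow> 'n func" where
  "so_op F = (if CARD('n) = 2 then op_so (skew_unit (from_nat_into UNIV 0) (from_nat_into UNIV 1)) F
     else (\<Sum>i\<in>UNIV. \<Sum>j\<in>UNIV. op_so (skew_unit i j) (op_so (skew_unit i j) F)))"

definition so_ev :: "nat \<Rightarrow> int \<Rightarrow> complex" where
  "so_ev N k = (if N = 2 then - (\<i> * of_int k) else - 2 * of_int \<bar>k\<bar> * (of_int \<bar>k\<bar> + of_nat N - 2))"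

lemma so_op_block:
  fixes F :: "'n::finite func"
  assumes "F \<in> block s (m, l, k)"
  shows "so_op F = fscale (so_ev CARD('n) k) F"
proof -
  obtain h where h: "h \<in> harm_space k" "F = bfun s m l (nat \<bar>k\<bar>) h" using assms by (auto simp: block_iff)
  have cp: "cpoly g" if "g \<in> harm_space k" for g :: "real ^ 'n \<Rightarrow> complex"
    using harm_space_harmonic[OF that] by (simp add: harmonic_poly_iff)
  note sk = transpose_skew_unit
  show ?thesis
  proof (cases "CARD('n) = 2")
    case True
    let ?p = "from_nat_into (UNIV :: 'n set)"
    have "skew_unit (?p 0) (?p 1) $ ?p 1 $ ?p 0 = 1"
      using from_nat_into_neq[where 'n='n] True by (simp add: skew_unit_def)
    then have "rot (skew_unit (?p 0) (?p 1)) h = (\<lambda>y. so_ev CARD('n) k * h y)"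
      using rot_planar[OF True sk h(1)] True by (simp add: so_ev_def fun_eq_iff del: One_nat_def)
    then show ?thesis
      unfolding so_op_def h op_so_bfun[OF cp[OF h(1)] sk]
      using True by (simp add: bfun_cmult)
  next
    case False
    have "op_so (skew_unit i j) (op_so (skew_unit i j) F) =
        bfun s m l (nat \<bar>k\<bar>) (rot (skew_unit i j) (rot (skew_unit i j) h))" for i j
      unfolding h op_so_bfun[OF cp[OF h(1)] sk] by (rule op_so_bfun[OF cp[OF harm_space_rot[OF h(1) sk]] sk])
    then have "so_op F = bfun s m l (nat \<bar>k\<bar>) (\<lambda>y. \<Sum>i\<in>UNIV. \<Sum>j\<in>UNIV. rot (skew_unit i j) (rot (skew_unit i j) h) y)"
      using False by (simp add: so_op_def bfun_sum)
    also have "\<dots> = bfun s m l (nat \<bar>k\<bar>) (\<lambda>y. so_ev CARD('n) k * h y)"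
      using False by (simp add: casimir_rot[OF harm_space_harmonic[OF h(1)]] so_ev_def)
    finally show ?thesis by (simp add: bfun_cmult h)
  qed
qed

text \<open>\<open>op_eta_minus\<close> acts first and lowers m by 4, so the factor from
  \<open>op_eta_plus\<close> sees \<open>wt_plus\<close> already reduced by 4.\<close>

definition eta_ev :: "nat \<Rightarrow> int \<times> nat \<times> int \<Rightarrow> complex" where
  "eta_ev N p = of_int (wt_minus N p) / 4 * (of_int (wt_plus N p - 4) / 4)"

lemma eta_eta_block:
  fixes F :: "'n::finite func"
  assumes "F \<in> block s p"
  shows "op_eta_plus s (op_eta_minus s F) = fscale (eta_ev CARD('n) p) F"
proof -
  obtain m l k where p: "p = (m, l, k)" by (cases p)
  obtain h where h: "h \<in> harm_space k" "F = bfun s m l (nat \<bar>k\<bar>) h" using assms p by (auto simp: block_iff)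
  have hp: "cpoly h" "homog (nat \<bar>k\<bar>) h"
    using harm_space_harmonic[OF h(1)] by (auto simp: harmonic_poly_iff)
  have lin: "op_eta_plus s (fscale c (bfun s (m - 4) l (nat \<bar>k\<bar>) h)) = fscale c (op_eta_plus s (bfun s (m - 4) l (nat \<bar>k\<bar>) h))" for c
    using linear_op_eta_plus[of s] diffable_bfun[OF hp(1)] unfolding linear_op_def by blast
  have "wt_plus CARD('n) (m - 4, l, k) = wt_plus CARD('n) (m, l, k) - 4" by (simp add: wt_plus_def)
  then show ?thesis
    unfolding h op_eta_minus_bfun[OF hp] lin op_eta_plus_bfun[OF hp] par_b_a_eq
    by (simp add: p eta_ev_def par_a_eq)
qed

lemma index_separated:
  assumes p: "(m, l, k) \<in> idx TYPE('n::finite) q" "(m, l', k') \<in> idx TYPE('n) q"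
    and eta: "eta_ev CARD('n) (m, l, k) = eta_ev CARD('n) (m, l', k')"
    and so: "so_ev CARD('n) k = so_ev CARD('n) k'"
  shows "l = l' \<and> k = k'"
proof -
  have n: "CARD('n) \<ge> 1" by (simp add: Suc_leI)
  have k: "k = k'"
  proof (cases "CARD('n) = 2")
    case True
    then show ?thesis using so by (simp add: so_ev_def)
  next
    case False
    then have pos: "k \<ge> 0" "k' \<ge> 0" using p by (auto simp: idx_def harm_indices_def split: if_splits)
    have "(of_int (k * (k + int CARD('n) - 2)) :: complex) = of_int (k' * (k' + int CARD('n) - 2))"
      using so False pos by (simp add: so_ev_def)
    then have "k * (k + int CARD('n) - 2) = k' * (k' + int CARD('n) - 2)" by (simp only: of_int_eq_iff)
    then have "(k - k') * (k + k' + int CARD('n) - 2) = 0" by (simp add: algebra_simps)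
    then consider "k = k'" | "k + k' + int CARD('n) = 2" by auto
    then show ?thesis
    proof cases
      case 2
      \<comment> \<open>Nonnegative k and k' with sum 2 - n leave n = 1 and the values 0 and 1, as n
        = 2 is excluded. Having the same m forces k and k' to have the same parity, a
        contradiction.\<close>
      moreover have "[2 * k + q = 2 * k' + q] (mod 4)"
        using p by (auto simp: idx_def intro: cong_trans cong_sym)
      then have "even (k - k')" unfolding cong_iff_dvd_diff by presburger
      ultimately have "k = 0" "k' = 0" using pos n False by presburger+
      then show ?thesis by simp
    qed
  qed
  \<comment> \<open>With this B the eigenvalue is, up to the factor 1/16, (B - 2)^2 - (m - 2)^2.
    Equality therefore means B = B' or B + B' = 4, and the latter leaves no room for l + l' > 0
    because n \<ge> 1.\<close>
  define B where "B l = 4 * int l + 2 * \<bar>k\<bar> + int CARD('n)" for l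
  have "(of_int ((B l - m) * (m + B l - 4)) :: complex) = of_int ((B l' - m) * (m + B l' - 4))"
  proof -
    have w: "wt_minus CARD('n) (m, l, k) = B l - m" "wt_plus CARD('n) (m, l, k) - 4 = m + B l - 4" for l
      by (simp_all add: wt_plus_def wt_minus_def B_def)
    show ?thesis using eta unfolding k[symmetric] eta_ev_def w by simp
  qed
  then have "(B l - m) * (m + B l - 4) = (B l' - m) * (m + B l' - 4)" by (simp only: of_int_eq_iff)
  then have "(B l - B l') * (B l + B l' - 4) = 0" by (simp add: algebra_simps)
  have "l = l'"
  proof -
    have "B l - B l' = 0 \<or> B l + B l' - 4 = 0" using \<open>(B l - B l') * (B l + B l' - 4) = 0\<close> by simp
    then show "l = l'"
    proof
      assume "B l + B l' - 4 = 0"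
      then have "4 * (int l + int l') + 4 * \<bar>k\<bar> + 2 * int CARD('n) = 4" by (simp add: B_def)
      moreover have "int CARD('n) \<ge> 1" "\<bar>k\<bar> \<ge> 0" using n by auto
      moreover have "a \<le> 0" if "4 * a + 4 * x + 2 * c = 4" "c \<ge> 1" "x \<ge> 0" for a c x :: int
        using that by presburger
      ultimately have "int l + int l' \<le> 0" by blast
      then show "l = l'" by simp
    qed (simp add: B_def)
  qed
  then show ?thesis using k by simp
qed

lemma linear_on_linear_op: "linear_op T \<Longrightarrow> linear_on (blocks s P) T"
  by (auto simp: linear_op_def linear_on_def diffable_blocks)

lemma linear_on_comp:
  assumes "linear_on H T" "linear_on H T'" "\<And>F. F \<in> H \<Longrightarrow> T' F \<in> H"
  shows "linear_on H (\<lambda>F. T (T' F))"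
  using assms by (simp add: linear_on_def)

lemma linear_on_add_sum:
  assumes "\<And>i. i \<in> S \<Longrightarrow> linear_on H (T i)"
  shows "linear_on H (\<lambda>F. \<Sum>i\<in>S. T i F)"
  using assms by (simp add: linear_on_def sum.distrib cfun.scale_sum_right)

lemma linear_on_so_op: "linear_on (blocks s (idx TYPE('n) q)) (so_op :: 'n::finite func \<Rightarrow> 'n func)"
proof (cases "CARD('n) = 2")
  case True
  then show ?thesis unfolding so_op_def[abs_def] by (simp add: linear_on_linear_op[OF linear_op_so])
next
  case False
  have "op_so (skew_unit i j) F \<in> blocks s (idx TYPE('n) q)" if "F \<in> blocks s (idx TYPE('n) q)" for i j and F :: "'n func"
    using subspace_idx_stable[of s q] that transpose_skew_unit unfolding op_stable_def by blast
  then show ?thesis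
    using False unfolding so_op_def[abs_def]
    by (simp add: linear_on_add_sum linear_on_comp linear_on_linear_op linear_op_so)
qed

lemma stable_separate:
  fixes N :: "'n::finite func set"
  assumes N: "cfun.subspace N" "op_stable s N"
    and S: "finite S" "S \<subseteq> idx TYPE('n) q" "p0 \<in> S" "\<And>p. p \<in> S \<Longrightarrow> v p \<in> block s p"
    and sum: "(\<Sum>p\<in>S. v p) \<in> N"
  shows "v p0 \<in> N"
proof -
  let ?H = "blocks s (idx TYPE('n) q) :: 'n func set"
  define \<T> :: "(('n func \<Rightarrow> 'n func) \<times> (int \<times> nat \<times> int \<Rightarrow> complex)) set" where
    "\<T> = {(op_kappa, \<lambda>(m, l, k). of_int m / 2),
      ((\<lambda>F. op_eta_plus s (op_eta_minus s F)), eta_ev CARD('n)), (so_op, \<lambda>(m, l, k). so_ev CARD('n) k)}"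
  have Hs: "op_stable s ?H" by (rule subspace_idx_stable)
  have so_N: "so_op F \<in> N" if "F \<in> N" for F
  proof -
    have "op_so (skew_unit i j) F \<in> N" if "F \<in> N" for i j F
      using N(2) that transpose_skew_unit unfolding op_stable_def by blast
    then show ?thesis unfolding so_op_def using that
      by (auto intro!: cfun.subspace_sum[OF N(1)])
  qed
  show ?thesis
  proof (rule separate_eigenvectors[OF N(1) subspace_blocks[of s "idx TYPE('n) q"] S(1,3) _ sum, where \<T> = \<T>])
    show "v p \<in> ?H" if "p \<in> S" for p
      using S(2,4) that block_subset_blocks by blast
    show "\<exists>(T, ev)\<in>\<T>. ev p0 \<noteq> ev p" if "p \<in> S" "p \<noteq> p0" for p
    proof (rule ccontr)
      assume *: "\<not> (\<exists>(T, ev)\<in>\<T>. ev p0 \<noteq> ev p)"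
      obtain m l k m' l' k' where e: "p0 = (m, l, k)" "p = (m', l', k')" by (cases p0, cases p) auto
      have "m = m'" "eta_ev CARD('n) (m, l, k) = eta_ev CARD('n) (m', l', k')" "so_ev CARD('n) k = so_ev CARD('n) k'"
        using * by (auto simp: \<T>_def e)
      moreover have "(m, l, k) \<in> idx TYPE('n) q" "(m', l', k') \<in> idx TYPE('n) q" using S that e by auto
      ultimately show False using index_separated[of m l k q l' k'] e that by auto
    qed
    fix T ev
    assume "(T, ev) \<in> \<T>"
    then consider "T = op_kappa" "ev = (\<lambda>(m, l, k). of_int m / 2)"
      | "T = (\<lambda>F. op_eta_plus s (op_eta_minus s F))" "ev = eta_ev CARD('n)"
      | "T = so_op" "ev = (\<lambda>(m, l, k). so_ev CARD('n) k)"
      unfolding \<T>_def by blast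
    then show "linear_on ?H T \<and> (\<forall>F\<in>N. T F \<in> N) \<and> (\<forall>p\<in>S. T (v p) = fscale (ev p) (v p))"
    proof cases
      case 1
      have "op_kappa F = fscale (case p of (m, l, k) \<Rightarrow> of_int m / 2) F" if "F \<in> block s p" for F :: "'n func" and p
        using that by (cases p) (auto simp: block_iff op_kappa_bfun)
      then have "\<forall>p\<in>S. op_kappa (v p) = fscale (case p of (m, l, k) \<Rightarrow> of_int m / 2) (v p)"
        using S(4) by blast
      then show ?thesis unfolding 1 using N(2) linear_on_linear_op[OF linear_op_kappa]
        unfolding op_stable_def by blast
    next
      case 2
      have "linear_on ?H (\<lambda>F. op_eta_plus s (op_eta_minus s F))"
        by (rule linear_on_comp) (use Hs in \<open>auto simp: op_stable_def linear_on_linear_op linear_op_eta_plus linear_op_eta_minus\<close>)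
      moreover have "\<forall>p\<in>S. op_eta_plus s (op_eta_minus s (v p)) = fscale (eta_ev CARD('n) p) (v p)"
        using S(4) eta_eta_block by blast
      ultimately show ?thesis unfolding 2 using N(2) unfolding op_stable_def by blast
    next
      case 3
      have "so_op F = fscale (case p of (m, l, k) \<Rightarrow> so_ev CARD('n) k) F" if "F \<in> block s p" for F :: "'n func" and p
        using that so_op_block by (cases p) auto
      then have "\<forall>p\<in>S. so_op (v p) = fscale (case p of (m, l, k) \<Rightarrow> so_ev CARD('n) k) (v p)"
        using S(4) by blast
      then show ?thesis unfolding 3 using so_N linear_on_so_op by blast
    qed
  qed
qed

text \<open>Isolates a known component without describing the rest of the sum: it suffices that the
  remainder avoids the index p.\<close>

lemma stable_project:
  fixes N :: "'n::finite func set"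
  assumes N: "cfun.subspace N" "op_stable s N"
    and p: "p \<in> idx TYPE('n) q" "F \<in> block s p" and G: "G \<in> blocks s (idx TYPE('n) q - {p})"
    and FG: "F + G \<in> N"
  shows "F \<in> N"
proof -
  obtain S v where S: "finite S" "S \<subseteq> idx TYPE('n) q - {p}" "\<And>p. v p \<in> block s p" "G = (\<Sum>p\<in>S. v p)"
    using blocks_expand[OF G] by metis
  have "(v(p := F)) p \<in> N"
  proof (rule stable_separate[OF N, of "insert p S" q p "v(p := F)"])
    have "(\<Sum>r\<in>insert p S. (v(p := F)) r) = F + G"
      using S by (subst sum.insert) (auto intro!: sum.cong)
    then show "(\<Sum>r\<in>insert p S. (v(p := F)) r) \<in> N" using FG by simp
  qed (use S p in auto)
  then show ?thesis by simp
qed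

lemma op_stable_zero: "op_stable s {0 :: 'n::finite func}"
  by (auto simp: op_stable_def intro!: linear_op_zero linear_op_kappa linear_op_eta_plus
      linear_op_eta_minus linear_op_E_plus linear_op_E_minus linear_op_so)

text \<open>The zero space is stable too. Projecting F + (-F) = 0 inside it gives F = 0, so the
  independence of the blocks is a special case of their separation.\<close>

lemma comp_HS_trivial:
  fixes F :: "'n::finite func"
  assumes "p \<in> idx TYPE('n) q" "F \<in> block s p" "F \<in> blocks s P" "P \<subseteq> idx TYPE('n) q - {p}"
  shows "F = 0"
proof -
  have "- F \<in> blocks s (idx TYPE('n) q - {p})"
    using blocks_mono[OF assms(4)] assms(3) cfun.subspace_neg[OF subspace_blocks] by blast
  then have "F \<in> {0}"
    using assms(1,2) by (intro stable_project[OF _ op_stable_zero, of p q F s "- F"]) (auto simp: cfun.subspace_def)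
  then show ?thesis by simp
qed

lemma block_nontrivial:
  assumes "p \<in> idx TYPE('n::finite) q"
  shows "\<exists>F \<in> block s p. (F :: 'n func) \<noteq> 0"
proof -
  obtain m l k where p: "p = (m, l, k)" by (cases p)
  then obtain h :: "real ^ 'n \<Rightarrow> complex" where "h \<in> harm_space k" "h \<noteq> (\<lambda>y. 0)"
    using harm_space_nonzero[of k] assms by (auto simp: idx_def)
  then have "bfun s m l (nat \<bar>k\<bar>) h \<in> block s p" "bfun s m l (nat \<bar>k\<bar>) h \<noteq> 0"
    using bfun_neq_0[OF harm_space_harmonic, of h k s m l] p by (auto intro: bfun_in_block)
  then show ?thesis by blast
qed

lemma block_subset_HS_iff:
  assumes "p \<in> idx TYPE('n::finite) q" "P \<subseteq> idx TYPE('n) q"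
  shows "(block s p :: 'n func set) \<subseteq> blocks s P \<longleftrightarrow> p \<in> P"
proof
  assume sub: "(block s p :: 'n func set) \<subseteq> blocks s P"
  show "p \<in> P"
  proof (rule ccontr)
    assume "p \<notin> P"
    then have "P \<subseteq> idx TYPE('n) q - {p}" using assms by auto
    then have "F = 0" if "F \<in> block s p" for F :: "'n func"
      using comp_HS_trivial[OF assms(1) that] sub that by blast
    then show False using block_nontrivial[OF assms(1)] by blast
  qed
qed (rule block_subset_blocks)

lemma blocks_disjoint:
  assumes "P \<subseteq> idx TYPE('n::finite) q" "Q \<subseteq> idx TYPE('n) q" "P \<inter> Q = {}"
  shows "(blocks s P :: 'n func set) \<inter> blocks s Q = {0}"
proof -
  have "F = 0" if F: "F \<in> blocks s P" "F \<in> blocks s Q" for F :: "'n func"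
  proof -
    obtain S v where S: "finite S" "S \<subseteq> P" "\<And>p. v p \<in> block s p" "F = (\<Sum>p\<in>S. v p)"
      using blocks_expand[OF F(1)] by metis
    have "v p = 0" if p: "p \<in> S" for p
    proof -
      have "v p = F - (\<Sum>r\<in>S - {p}. v r)" using S p by (simp add: sum.remove)
      moreover have "F \<in> blocks s (idx TYPE('n) q - {p})"
        using F(2) blocks_mono[of Q "idx TYPE('n) q - {p}"] assms S p by blast
      moreover have "(\<Sum>r\<in>S - {p}. v r) \<in> blocks s (idx TYPE('n) q - {p})"
      proof (rule cfun.subspace_sum[OF subspace_blocks])
        fix r assume "r \<in> S - {p}"
        then have "r \<in> idx TYPE('n) q - {p}" using S assms by blast
        then show "v r \<in> blocks s (idx TYPE('n) q - {p})" using S(3)[of r] block_subset_blocks by (metis subsetD)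
      qed
      ultimately have "v p \<in> blocks s (idx TYPE('n) q - {p})"
        using cfun.subspace_diff[OF subspace_blocks] by metis
      then show ?thesis
        using comp_HS_trivial[of p q "v p" s] S p assms by blast
    qed
    then show ?thesis using S(4) by simp
  qed
  then show ?thesis using cfun.subspace_0[OF subspace_blocks] by blast
qed

lemma blocks_Un: "subspace_sum (blocks s P) (blocks s Q) = blocks s (P \<union> Q)"
  unfolding blocks_def subspace_sum_def UN_Un cfun.span_Un by blast

section \<open>Moves inside a stable subspace\<close>

lemma unscale:
  assumes "cfun.subspace N" "fscale c F \<in> N" "c \<noteq> 0"
  shows "F \<in> N"
  using cfun.subspace_scale[OF assms(1,2), of "1 / c"] assms(3) by simp

lemma par_b_minus_neq_0:
  assumes "N \<ge> 1" "l \<ge> 1 \<or> d \<ge> 1"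
  shows "par_b N l d - 1 - of_nat l \<noteq> 0"
proof -
  have "Re (par_b N l d - 1 - of_nat l) > 0" using assms by (auto simp: par_b_def)
  then show ?thesis by (metis less_irrefl zero_complex.simps(1))
qed

lemma lift_coeff_neq_0: "N \<ge> 1 \<Longrightarrow> lift_coeff N l d \<noteq> 0"
  using par_b_minus_neq_0[of N l d] par_b_neq_1[of N l d] by (auto simp: lift_coeff_def)

lemma idx_next:
  assumes "(m, l, k) \<in> idx T q" "next_index T k k' \<or> next_index T k' k"
  shows "(m + 2, l', k') \<in> idx T q" "(m - 2, l', k') \<in> idx T q"
  using assms cong_next_index[OF assms(2)] by (auto simp: idx_def next_index_def)

lemma idx_shift_4:
  assumes "(m, l, k) \<in> idx T q"
  shows "(m + 4, l, k) \<in> idx T q" "(m - 4, l, k) \<in> idx T q"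
proof -
  have "[m = 2 * k + q] (mod 4)" using assms by (simp add: idx_def)
  then have "[m + 4 = 2 * k + q] (mod 4)" "[m - 4 = 2 * k + q] (mod 4)"
    unfolding cong_iff_dvd_diff by presburger+
  then show "(m + 4, l, k) \<in> idx T q" "(m - 4, l, k) \<in> idx T q" using assms by (simp_all add: idx_def)
qed

lemma sum_fscale_bfun:
  assumes "\<And>y. (\<Sum>j\<in>S. f j y) = c' * h y"
  shows "(\<Sum>j\<in>S. fscale c (bfun s m l d (f j))) = fscale (c * c') (bfun s m l d h)"
proof -
  have "(\<Sum>j\<in>S. fscale c (bfun s m l d (f j))) = fscale c (bfun s m l d (\<lambda>y. \<Sum>j\<in>S. f j y))"
    by (simp add: bfun_sum cfun.scale_sum_right)
  then show ?thesis by (simp add: assms bfun_cmult)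
qed

text \<open>Summing \<open>E\<^sub>j\<close> over the partial derivatives of a harmonic polynomial cancels the terms of lower degree.\<close>

lemma sum_E_plus:
  fixes h :: "real ^ 'n::finite \<Rightarrow> complex"
  assumes h: "harmonic_poly (Suc d) h"
  shows "(\<Sum>j\<in>UNIV. op_E_plus s j (bfun s m l d (pdiff j h))) =
    fscale (2 * \<i> * of_nat l * of_nat (Suc d)) (bfun s (m + 2) (l - 1) (Suc d) h) +
    fscale (2 * \<i> * (lift_coeff CARD('n) l d * (par_a CARD('n) m l d / par_b CARD('n) l d) * (2 * \<i> * s)) * of_nat (Suc d))
      (bfun s (m + 2) l (Suc d) h)"
proof -
  have d: "(\<Sum>j\<in>UNIV. h_down j d (pdiff j h) y) = 0 * h y" for y
    using sum_h_up_pdiff(2)[OF h] by simp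
  note u = sum_h_up_pdiff(1)[OF h]
  note E = op_E_plus_bfun[OF harmonic_poly_pdiff[OF h]]
  show ?thesis
    unfolding E sum.distrib sum_fscale_bfun[OF u] sum_fscale_bfun[OF d] by simp
qed

lemma sum_E_minus:
  fixes h :: "real ^ 'n::finite \<Rightarrow> complex"
  assumes h: "harmonic_poly (Suc d) h"
  shows "(\<Sum>j\<in>UNIV. op_E_minus s j (bfun s m l d (pdiff j h))) =
    fscale (- 2 * \<i> * of_nat l * of_nat (Suc d)) (bfun s (m - 2) (l - 1) (Suc d) h) +
    fscale (2 * \<i> * (lift_coeff CARD('n) l d * ((par_b CARD('n) l d - par_a CARD('n) m l d) / par_b CARD('n) l d) * (2 * \<i> * s)) * of_nat (Suc d))
      (bfun s (m - 2) l (Suc d) h)"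
proof -
  have d: "(\<Sum>j\<in>UNIV. h_down j d (pdiff j h) y) = 0 * h y" for y
    using sum_h_up_pdiff(2)[OF h] by simp
  note u = sum_h_up_pdiff(1)[OF h]
  note E = op_E_minus_bfun[OF harmonic_poly_pdiff[OF h]]
  show ?thesis
    unfolding E sum.distrib sum_fscale_bfun[OF u] sum_fscale_bfun[OF d] by simp
qed

text \<open>For l = 0 the truncated \<open>l - 1\<close> makes the two indices coincide, and no
  separation is possible. The first coefficient is zero in exactly that case.\<close>

lemma stable_split:
  fixes N :: "'n::finite func set"
  assumes N: "cfun.subspace N" "op_stable s N"
    and p: "(m, l - 1, k) \<in> idx TYPE('n) q" "(m, l, k) \<in> idx TYPE('n) q" and h: "h \<in> harm_space k" "nat \<bar>k\<bar> = d"
    and F: "fscale c1 (bfun s m (l - 1) d h) + fscale c2 (bfun s m l d h) \<in> N"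
    and c1: "c1 = 0 \<longleftrightarrow> l = 0"
  shows "(l \<noteq> 0 \<longrightarrow> bfun s m (l - 1) d h \<in> N) \<and> (c2 \<noteq> 0 \<longrightarrow> bfun s m l d h \<in> N)"
proof -
  let ?F1 = "fscale c1 (bfun s m (l - 1) d h)" and ?F2 = "fscale c2 (bfun s m l d h)"
  have block: "?F1 \<in> block s (m, l - 1, k)" "?F2 \<in> block s (m, l, k)"
    using h by (auto intro!: block_fscale bfun_in_block)
  show ?thesis
  proof (cases "l = 0")
    case True
    then show ?thesis using F c1 unscale[OF N(1), of c2] by auto
  next
    case False
    then have "l - 1 \<noteq> l" by simp
    then have ne: "(m, l - 1, k) \<in> idx TYPE('n) q - {(m, l, k)}" "(m, l, k) \<in> idx TYPE('n) q - {(m, l - 1, k)}"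
      using p by auto
    have "?F1 \<in> blocks s (idx TYPE('n) q - {(m, l, k)})" "?F2 \<in> blocks s (idx TYPE('n) q - {(m, l - 1, k)})"
      by (rule subsetD[OF block_subset_blocks[OF ne(1)] block(1)], rule subsetD[OF block_subset_blocks[OF ne(2)] block(2)])
    then have "?F1 \<in> N" "?F2 \<in> N"
      using stable_project[OF N p(1) block(1), of ?F2] stable_project[OF N p(2) block(2), of ?F1] F
      by (auto simp: add.commute)
    then show ?thesis using False c1 unscale[OF N(1)] by blast
  qed
qed

text \<open>A single E applied to a member of the block mixes four targets and need not give every h
  of the next degree. The sum of E_j over the partial derivatives of h gives multiples of h itself
  and leaves only the two values of l, which \<open>stable_split\<close> tells apart.\<close>

lemma stable_raise:
  fixes N :: "'n::finite func set"
  assumes s: "s \<noteq> 0" and N: "cfun.subspace N" "op_stable s N"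
    and p: "(m, l, k) \<in> idx TYPE('n) q" and k: "next_index TYPE('n) k k'"
    and sub: "block s (m, l, k) \<subseteq> N"
  shows "wt_plus CARD('n) (m, l, k) \<noteq> 0 \<Longrightarrow> block s (m + 2, l, k') \<subseteq> N"
    and "wt_minus CARD('n) (m, l, k) \<noteq> 0 \<Longrightarrow> block s (m - 2, l, k') \<subseteq> N"
    and "l \<ge> 1 \<Longrightarrow> block s (m + 2, l - 1, k') \<subseteq> N"
    and "l \<ge> 1 \<Longrightarrow> block s (m - 2, l - 1, k') \<subseteq> N"
proof -
  define d where "d = nat \<bar>k\<bar>"
  have d': "nat \<bar>k'\<bar> = Suc d" using nat_next_index[OF k] by (simp add: d_def)
  have n: "CARD('n) \<ge> 1" by (simp add: Suc_leI)
  note idx' = idx_next[OF p disjI1[OF k]]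
  have pd: "bfun s m l d (pdiff j h) \<in> N" if "h \<in> harm_space k'" for j h
    using sub bfun_in_block[OF harm_space_pdiff[OF k that]] by (auto simp: d_def)
  have key: "((l \<noteq> 0 \<longrightarrow> bfun s (m + 2) (l - 1) (Suc d) h \<in> N) \<and>
      (wt_plus CARD('n) (m, l, k) \<noteq> 0 \<longrightarrow> bfun s (m + 2) l (Suc d) h \<in> N)) \<and>
      ((l \<noteq> 0 \<longrightarrow> bfun s (m - 2) (l - 1) (Suc d) h \<in> N) \<and>
      (wt_minus CARD('n) (m, l, k) \<noteq> 0 \<longrightarrow> bfun s (m - 2) l (Suc d) h \<in> N))"
    if h: "h \<in> harm_space k'" for h
  proof
    have hp: "harmonic_poly (Suc d) h" using harm_space_harmonic[OF h] d' by simp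
    have "(\<Sum>j\<in>UNIV. op_E_plus s j (bfun s m l d (pdiff j h))) \<in> N"
      "(\<Sum>j\<in>UNIV. op_E_minus s j (bfun s m l d (pdiff j h))) \<in> N"
      using N(2) pd[OF h] unfolding op_stable_def by (auto intro!: cfun.subspace_sum[OF N(1)])
    note sums = this[unfolded sum_E_plus[OF hp] sum_E_minus[OF hp]]
    show "(l \<noteq> 0 \<longrightarrow> bfun s (m + 2) (l - 1) (Suc d) h \<in> N) \<and>
      (wt_plus CARD('n) (m, l, k) \<noteq> 0 \<longrightarrow> bfun s (m + 2) l (Suc d) h \<in> N)"
      using stable_split[OF N idx'(1) idx'(1) h d' sums(1)] s lift_coeff_neq_0[OF n] par_b_neq_0[OF n]
      by (auto simp: par_a_eq d_def simp del: of_nat_Suc)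
    show "(l \<noteq> 0 \<longrightarrow> bfun s (m - 2) (l - 1) (Suc d) h \<in> N) \<and>
      (wt_minus CARD('n) (m, l, k) \<noteq> 0 \<longrightarrow> bfun s (m - 2) l (Suc d) h \<in> N)"
      using stable_split[OF N idx'(2) idx'(2) h d' sums(2)] s lift_coeff_neq_0[OF n] par_b_neq_0[OF n]
        par_b_a_eq[of "CARD('n)" l k m]
      by (auto simp: d_def simp del: of_nat_Suc)
  qed
  show "wt_plus CARD('n) (m, l, k) \<noteq> 0 \<Longrightarrow> block s (m + 2, l, k') \<subseteq> N"
    "wt_minus CARD('n) (m, l, k) \<noteq> 0 \<Longrightarrow> block s (m - 2, l, k') \<subseteq> N"
    "l \<ge> 1 \<Longrightarrow> block s (m + 2, l - 1, k') \<subseteq> N"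
    "l \<ge> 1 \<Longrightarrow> block s (m - 2, l - 1, k') \<subseteq> N"
    using key by (auto simp: block_iff d')
qed

text \<open>Only one nonzero function F is assumed to lie in N, so the conclusion is again about one
  function. Some partial derivative of a nonconstant h is nonzero, and projecting E_j F for that j
  yields it. That the whole target block lies in N follows later from
  \<open>block_irreducible\<close>.\<close>

lemma stable_lower:
  fixes N :: "'n::finite func set"
  assumes s: "s \<noteq> 0" and N: "cfun.subspace N" "op_stable s N"
    and p: "(m, l, k) \<in> idx TYPE('n) q" and k: "next_index TYPE('n) k' k"
    and F: "F \<in> block s (m, l, k)" "F \<in> N" "F \<noteq> 0"
  shows "\<exists>G \<in> block s (m + 2, l, k'). G \<in> N \<and> G \<noteq> 0"
    and "\<exists>G \<in> block s (m - 2, l, k'). G \<in> N \<and> G \<noteq> 0"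
    and "l \<ge> 1 \<Longrightarrow> wt_plus CARD('n) (m, l, k) \<noteq> 0 \<Longrightarrow> \<exists>G \<in> block s (m + 2, l + 1, k'). G \<in> N \<and> G \<noteq> 0"
    and "l \<ge> 1 \<Longrightarrow> wt_minus CARD('n) (m, l, k) \<noteq> 0 \<Longrightarrow> \<exists>G \<in> block s (m - 2, l + 1, k'). G \<in> N \<and> G \<noteq> 0"
proof -
  obtain h where h: "h \<in> harm_space k" and Fh: "F = bfun s m l (nat \<bar>k\<bar>) h" using F(1) by (auto simp: block_iff)
  have d: "nat \<bar>k\<bar> = Suc (nat \<bar>k'\<bar>)" using nat_next_index[OF k] .
  have n: "CARD('n) \<ge> 1" by (simp add: Suc_leI)
  have hp: "harmonic_poly (nat \<bar>k\<bar>) h" using harm_space_harmonic[OF h] .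
  have "h \<noteq> (\<lambda>y. 0)" using F(3) Fh bfun_zero by metis
  then obtain j where j: "pdiff j h \<noteq> (\<lambda>y. 0)" using exists_pdiff_nonzero hp d by metis
  let ?g = "h_down j (nat \<bar>k\<bar>) h"
  have g: "?g \<in> harm_space k'" by (rule harm_space_h_down[OF k h])
  have "?g \<noteq> (\<lambda>y. 0)"
    using j pdiff_eq_h_down[OF hp, of j] by (auto simp: fun_eq_iff)
  then have gn0: "bfun s m' l' (nat \<bar>k'\<bar>) ?g \<noteq> 0" for m' l'
    using bfun_neq_0[OF harm_space_harmonic[OF g]] by blast
  have gc: "bfun s m' l' (nat \<bar>k'\<bar>) ?g \<in> block s (m', l', k')" for m' l'
    using g by (auto intro: bfun_in_block)
  have K: "k \<in> harm_indices TYPE('n)" using p by (simp add: idx_def)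
  note idx' = idx_next[OF p disjI2[OF k]]
  have up: "bfun s (m + 2) l' (nat \<bar>k\<bar> + 1) (h_up j (nat \<bar>k\<bar>) h) \<in> blocks s (idx TYPE('n) q - {(m + 2, l'', k')})"
    "bfun s (m - 2) l' (nat \<bar>k\<bar> + 1) (h_up j (nat \<bar>k\<bar>) h) \<in> blocks s (idx TYPE('n) q - {(m - 2, l'', k')})" for l' l''
  proof -
    \<comment> \<open>Successors of k have a larger absolute value than its predecessor k', so the
      raised terms never meet the target block, whatever their l.\<close>
    have "k'' \<noteq> k'" if "next_index TYPE('n) k k''" for k''
      using that k by (auto simp: next_index_def)
    then show "bfun s (m + 2) l' (nat \<bar>k\<bar> + 1) (h_up j (nat \<bar>k\<bar>) h) \<in> blocks s (idx TYPE('n) q - {(m + 2, l'', k')})"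
      "bfun s (m - 2) l' (nat \<bar>k\<bar> + 1) (h_up j (nat \<bar>k\<bar>) h) \<in> blocks s (idx TYPE('n) q - {(m - 2, l'', k')})"
      using idx_next[OF p disjI1] by (intro bfun_h_up_in_blocks[OF K h]; simp)+
  qed
  have down: "bfun s m' l' (nat \<bar>k'\<bar>) ?g \<in> blocks s (idx TYPE('n) q - {(m', l'', k')})"
    if "l' \<noteq> l''" "(m', l', k') \<in> idx TYPE('n) q" for m' l' l''
    using block_subset_blocks[of "(m', l', k')" "idx TYPE('n) q - {(m', l'', k')}" s] gc that by blast
  have d1: "nat \<bar>k\<bar> - 1 = nat \<bar>k'\<bar>" using d by simp
  note sHS = cfun.subspace_add[OF subspace_blocks] cfun.subspace_scale[OF subspace_blocks]
  have Ep: "op_E_plus s j F \<in> N" and Em: "op_E_minus s j F \<in> N" using N(2) F(2) by (auto simp: op_stable_def)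
  let ?D = "nat \<bar>k\<bar>"
  let ?a = "par_a CARD('n) m l ?D" and ?b = "par_b CARD('n) l ?D"
  {
    fix cu1 cu2 cd1 cd2 m'
    assume m': "m' = m + 2 \<or> m' = m - 2"
      and sum: "fscale cu1 (bfun s m' (l - 1) (?D + 1) (h_up j ?D h)) + fscale cu2 (bfun s m' l (?D + 1) (h_up j ?D h)) +
        fscale cd1 (bfun s m' l (?D - 1) ?g) + fscale cd2 (bfun s m' (l + 1) (?D - 1) ?g) \<in> N"
    have m'_idx: "(m', l', k') \<in> idx TYPE('n) q" for l' using idx' m' by auto
    have up': "bfun s m' l' (?D + 1) (h_up j ?D h) \<in> blocks s (idx TYPE('n) q - {(m', l'', k')})" for l' l''
      using up m' by auto
    let ?U = "fscale cu1 (bfun s m' (l - 1) (?D + 1) (h_up j ?D h)) + fscale cu2 (bfun s m' l (?D + 1) (h_up j ?D h))"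
    have "fscale cd1 (bfun s m' l (nat \<bar>k'\<bar>) ?g) \<in> N"
    proof (rule stable_project[OF N m'_idx[of l] block_fscale[OF gc]])
      show "?U + fscale cd2 (bfun s m' (l + 1) (nat \<bar>k'\<bar>) ?g) \<in> blocks s (idx TYPE('n) q - {(m', l, k')})"
        by (intro sHS up' down m'_idx) simp
      show "fscale cd1 (bfun s m' l (nat \<bar>k'\<bar>) ?g) + (?U + fscale cd2 (bfun s m' (l + 1) (nat \<bar>k'\<bar>) ?g)) \<in> N"
        using sum unfolding d1 by (simp add: add_ac)
    qed
    moreover have "fscale cd2 (bfun s m' (l + 1) (nat \<bar>k'\<bar>) ?g) \<in> N"
    proof (rule stable_project[OF N m'_idx[of "l + 1"] block_fscale[OF gc]])
      show "?U + fscale cd1 (bfun s m' l (nat \<bar>k'\<bar>) ?g) \<in> blocks s (idx TYPE('n) q - {(m', l + 1, k')})"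
        by (intro sHS up' down m'_idx) simp
      show "fscale cd2 (bfun s m' (l + 1) (nat \<bar>k'\<bar>) ?g) + (?U + fscale cd1 (bfun s m' l (nat \<bar>k'\<bar>) ?g)) \<in> N"
        using sum unfolding d1 by (simp add: add_ac)
    qed
    ultimately have "(cd1 \<noteq> 0 \<longrightarrow> bfun s m' l (nat \<bar>k'\<bar>) ?g \<in> N) \<and> (cd2 \<noteq> 0 \<longrightarrow> bfun s m' (l + 1) (nat \<bar>k'\<bar>) ?g \<in> N)"
      using unscale[OF N(1)] by blast
  }
  note key = this
  have nz: "?b - 1 - of_nat l \<noteq> 0" "?b - 1 \<noteq> 0" "?b \<noteq> 0"
    using par_b_minus_neq_0[OF n, of l ?D] par_b_neq_1[OF n, of l ?D] par_b_neq_0[OF n] d by auto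
  note kp = key[OF disjI1[OF refl] Ep[unfolded Fh op_E_plus_bfun[OF hp]]]
  note km = key[OF disjI2[OF refl] Em[unfolded Fh op_E_minus_bfun[OF hp]]]
  show "\<exists>G \<in> block s (m + 2, l, k'). G \<in> N \<and> G \<noteq> 0"
    using kp nz gc gn0 by (intro bexI[of _ "bfun s (m + 2) l (nat \<bar>k'\<bar>) ?g"]) auto
  show "\<exists>G \<in> block s (m - 2, l, k'). G \<in> N \<and> G \<noteq> 0"
    using km nz gc gn0 by (intro bexI[of _ "bfun s (m - 2) l (nat \<bar>k'\<bar>) ?g"]) auto
  show "\<exists>G \<in> block s (m + 2, l + 1, k'). G \<in> N \<and> G \<noteq> 0" if "l \<ge> 1" "wt_plus CARD('n) (m, l, k) \<noteq> 0"
    using kp nz gc gn0 s that by (intro bexI[of _ "bfun s (m + 2) (l + 1) (nat \<bar>k'\<bar>) ?g"]) (auto simp: par_a_eq)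
  show "\<exists>G \<in> block s (m - 2, l + 1, k'). G \<in> N \<and> G \<noteq> 0" if "l \<ge> 1" "wt_minus CARD('n) (m, l, k) \<noteq> 0"
    using km nz gc gn0 s that par_b_a_eq[of "CARD('n)" l k m]
    by (intro bexI[of _ "bfun s (m - 2) (l + 1) (nat \<bar>k'\<bar>) ?g"]) auto
qed

lemma block_dim_1:
  fixes F :: "'n::finite func"
  assumes "k = 0 \<or> CARD('n) = 2" "F \<in> block s (m, l, k)" "F \<noteq> 0" "G \<in> block s (m, l, k)"
  shows "\<exists>c. G = fscale c F"
proof -
  obtain f g where f: "f \<in> harm_space k" "F = bfun s m l (nat \<bar>k\<bar>) f" and g: "g \<in> harm_space k" "G = bfun s m l (nat \<bar>k\<bar>) g"
    using assms by (auto simp: block_iff)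
  have "\<exists>c e w. f = (\<lambda>y :: real ^ 'n. c * w y) \<and> g = (\<lambda>y. e * w y)"
  proof (cases "k = 0")
    case True
    then have "f = (\<lambda>y. f 0 * 1)" "g = (\<lambda>y. g 0 * 1)"
      using harmonic_poly_0[of f] harmonic_poly_0[of g] harm_space_harmonic[OF f(1)] harm_space_harmonic[OF g(1)] by auto
    then show ?thesis by (intro exI[of _ "f 0"] exI[of _ "g 0"] exI[of _ "\<lambda>_. 1"]) simp
  next
    case False
    then have "CARD('n) = 2" using assms by simp
    then obtain c e where "f = (\<lambda>y. c * planar_of k y ^ nat \<bar>k\<bar>)" "g = (\<lambda>y. e * planar_of k y ^ nat \<bar>k\<bar>)"
      using f(1) g(1) unfolding harm_space_2[OF \<open>CARD('n) = 2\<close>] by blast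
    then show ?thesis
      by (intro exI[of _ c] exI[of _ e] exI[of _ "\<lambda>y. planar_of k y ^ nat \<bar>k\<bar>"]) simp
  qed
  then obtain c e w where w: "f = (\<lambda>y :: real ^ 'n. c * w y)" "g = (\<lambda>y. e * w y)" by blast
  have "c \<noteq> 0" using assms(3) f w by (auto simp: bfun_zero)
  then have "g = (\<lambda>y. (e / c) * f y)" using w by simp
  then show ?thesis using f(2) g(2) bfun_cmult by metis
qed

text \<open>Induction on |k|: descend to both (m + 2, l, k') and (m - 2, l, k'), fill these blocks
  by the induction hypothesis, and return from one of them. Where both returns are blocked, the
  blocks are one-dimensional anyway.\<close>

lemma block_irreducible:
  fixes N :: "'n::finite func set"
  assumes s: "s \<noteq> 0" and N: "cfun.subspace N" "op_stable s N"
    and "(m, l, k) \<in> idx TYPE('n) q" "F \<in> block s (m, l, k)" "F \<in> N" "F \<noteq> 0"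
  shows "block s (m, l, k) \<subseteq> N"
  using assms(4-)
proof (induction "nat \<bar>k\<bar>" arbitrary: m k F)
  case 0
  then have "k = 0" by simp
  then show ?case using block_dim_1[of k F s m l] 0 cfun.subspace_scale[OF N(1)] by blast
next
  case (Suc d)
  have n: "CARD('n) \<ge> 1" by (simp add: Suc_leI)
  show ?case
  proof (cases "CARD('n) = 2")
    case True
    then show ?thesis using block_dim_1[of k F s m l] Suc.prems cfun.subspace_scale[OF N(1)] by blast
  next
    case False
    have k0: "k \<noteq> 0" using Suc.hyps(2) by auto
    define k' where "k' = k - sgn k"
    have k': "next_index TYPE('n) k' k"
      using next_index_pred[of k "TYPE('n)"] Suc.prems(1) k0 by (simp add: idx_def k'_def)
    have d: "d = nat \<bar>k'\<bar>" using nat_next_index[OF k'] Suc.hyps(2) by simp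
    obtain G G' where G: "G \<in> block s (m + 2, l, k')" "G \<in> N" "G \<noteq> 0"
      and G': "G' \<in> block s (m - 2, l, k')" "G' \<in> N" "G' \<noteq> 0"
      using stable_lower(1,2)[OF s N Suc.prems(1) k' Suc.prems(2-4)] by blast
    note idx' = idx_next[OF Suc.prems(1) disjI2[OF k'], of l]
    have sub: "block s (m + 2, l, k') \<subseteq> N" "block s (m - 2, l, k') \<subseteq> N"
      using Suc.hyps(1)[OF d idx'(1) G] Suc.hyps(1)[OF d idx'(2) G'] by auto
    \<comment> \<open>The two weights add up to 8l + 4|k'| + 2n - 4. If both vanish, then n = 2 and
      l = k' = 0, and n = 2 has been dealt with by dimension.\<close>
    have "wt_minus CARD('n) (m + 2, l, k') \<noteq> 0 \<or> wt_plus CARD('n) (m - 2, l, k') \<noteq> 0"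
    proof (rule ccontr)
      assume "\<not> ?thesis"
      then have "8 * int l + 4 * \<bar>k'\<bar> + 2 * int CARD('n) = 4"
        by (simp add: wt_plus_def wt_minus_def)
      moreover have c: "c = 2" if "8 * a + 4 * x + 2 * c = 4" "a \<ge> 0" "x \<ge> 0" "c \<ge> 1" for a x c :: int
        using that by presburger
      ultimately have "int CARD('n) = 2" using n by (intro c[of "int l" "\<bar>k'\<bar>"]) auto
      then show False using False by linarith
    qed
    then show ?thesis
      using stable_raise(2)[OF s N idx'(1) k' sub(1)] stable_raise(1)[OF s N idx'(2) k' sub(2)] by auto
  qed
qed

lemma stable_moves_closed:
  fixes N :: "'n::finite func set"
  assumes s: "s \<noteq> 0" and N: "cfun.subspace N" "op_stable s N"
  shows "moves_closed TYPE('n) {p \<in> idx TYPE('n) q. block s p \<subseteq> N}"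
proof -
  have n: "CARD('n) \<ge> 1" by (simp add: Suc_leI)
  have low: "block s p' \<subseteq> N" if "\<exists>G \<in> block s p'. G \<in> N \<and> G \<noteq> 0" "p' \<in> idx TYPE('n) q" for p'
    using block_irreducible[OF s N] that by (cases p') blast
  have main: "block s (m + 4, l, k) \<subseteq> N \<or> wt_plus CARD('n) (m, l, k) = 0"
    "block s (m - 4, l, k) \<subseteq> N \<or> wt_minus CARD('n) (m, l, k) = 0"
    if p: "(m, l, k) \<in> idx TYPE('n) q" "block s (m, l, k) \<subseteq> N" for m l k
  proof -
    obtain F :: "'n func" where F: "F \<in> block s (m, l, k)" "F \<noteq> 0" using block_nontrivial[OF p(1)] by blast
    then obtain h where h: "h \<in> harm_space k" "F = bfun s m l (nat \<bar>k\<bar>) h" by (auto simp: block_iff)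
    have hp: "cpoly h" "homog (nat \<bar>k\<bar>) h" using harm_space_harmonic[OF h(1)] by (auto simp: harmonic_poly_iff)
    have "h \<noteq> (\<lambda>y. 0)" using F(2) h bfun_zero by metis
    then have nz: "bfun s m' l (nat \<bar>k\<bar>) h \<noteq> 0" for m' using bfun_neq_0[OF harm_space_harmonic[OF h(1)]] by blast
    have "op_eta_plus s F \<in> N" "op_eta_minus s F \<in> N" using N(2) F p by (auto simp: op_stable_def)
    note * = this(1)[unfolded h op_eta_plus_bfun[OF hp] par_a_eq] this(2)[unfolded h op_eta_minus_bfun[OF hp] par_b_a_eq]
    have "bfun s (m + 4) l (nat \<bar>k\<bar>) h \<in> N \<or> wt_plus CARD('n) (m, l, k) = 0"
      "bfun s (m - 4) l (nat \<bar>k\<bar>) h \<in> N \<or> wt_minus CARD('n) (m, l, k) = 0"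
      using unscale[OF N(1) *(1)] unscale[OF N(1) *(2)] by auto
    moreover have "block s (m', l, k) \<subseteq> N" if "bfun s m' l (nat \<bar>k\<bar>) h \<in> N" "(m', l, k) \<in> idx TYPE('n) q" for m'
      by (rule low[OF bexI[of _ "bfun s m' l (nat \<bar>k\<bar>) h"] that(2)]) (use that nz bfun_in_block[OF h(1) refl] in auto)
    ultimately show "block s (m + 4, l, k) \<subseteq> N \<or> wt_plus CARD('n) (m, l, k) = 0"
      "block s (m - 4, l, k) \<subseteq> N \<or> wt_minus CARD('n) (m, l, k) = 0"
      using idx_shift_4[OF p(1)] by blast+
  qed
  let ?R = "{p \<in> idx TYPE('n) q. block s p \<subseteq> N}"
  {
    fix m l k
    assume "(m, l, k) \<in> ?R"
    then have p: "(m, l, k) \<in> idx TYPE('n) q" "block s (m, l, k) \<subseteq> N" by auto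
    obtain F :: "'n func" where F: "F \<in> block s (m, l, k)" "F \<noteq> 0" using block_nontrivial[OF p(1)] by blast
    have FN: "F \<in> N" using F p by blast
    have eta: "wt_plus CARD('n) (m, l, k) \<noteq> 0 \<Longrightarrow> (m + 4, l, k) \<in> ?R"
      "wt_minus CARD('n) (m, l, k) \<noteq> 0 \<Longrightarrow> (m - 4, l, k) \<in> ?R"
      using main[OF p] idx_shift_4[OF p(1)] by auto
    have up: "wt_plus CARD('n) (m, l, k) \<noteq> 0 \<Longrightarrow> (m + 2, l, k') \<in> ?R"
      "wt_minus CARD('n) (m, l, k) \<noteq> 0 \<Longrightarrow> (m - 2, l, k') \<in> ?R"
      "l \<ge> 1 \<Longrightarrow> (m + 2, l - 1, k') \<in> ?R" "l \<ge> 1 \<Longrightarrow> (m - 2, l - 1, k') \<in> ?R"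
      if "next_index TYPE('n) k k'" for k'
      using stable_raise[OF s N p(1) that p(2)] idx_next[OF p(1) disjI1[OF that]] by auto
    have down: "(m + 2, l, k') \<in> ?R" "(m - 2, l, k') \<in> ?R"
      "l \<ge> 1 \<Longrightarrow> wt_plus CARD('n) (m, l, k) \<noteq> 0 \<Longrightarrow> (m + 2, l + 1, k') \<in> ?R"
      "l \<ge> 1 \<Longrightarrow> wt_minus CARD('n) (m, l, k) \<noteq> 0 \<Longrightarrow> (m - 2, l + 1, k') \<in> ?R"
      if "next_index TYPE('n) k' k" for k'
      unfolding mem_Collect_eq
      using low stable_lower[OF s N p(1) that F(1) FN F(2)] idx_next[OF p(1) disjI2[OF that]] by blast+
    note eta up down
  }
  note R = this
  show ?thesis
    unfolding moves_closed_def by (intro allI impI conjI R)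
qed

text \<open>Each nonzero component of a member of N lies in N by separation, and then its whole
  block does by \<open>block_irreducible\<close>.\<close>

lemma stable_eq_blocks:
  fixes N :: "'n::finite func set"
  assumes s: "s \<noteq> 0" and N: "cfun.subspace N" "op_stable s N" "N \<subseteq> blocks s (idx TYPE('n) q)"
  shows "N = blocks s {p \<in> idx TYPE('n) q. block s p \<subseteq> N}" (is "N = blocks s ?R")
proof
  show "blocks s ?R \<subseteq> N" by (rule blocks_least[OF N(1)]) auto
  show "N \<subseteq> blocks s ?R"
  proof
    fix F assume F: "F \<in> N"
    then obtain S v where S: "finite S" "S \<subseteq> idx TYPE('n) q" "\<And>p. v p \<in> block s p" "F = (\<Sum>p\<in>S. v p)"
      using blocks_expand N(3) by (metis subsetD)
    have "v p \<in> blocks s ?R" if p: "p \<in> S" for p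
    proof (cases "v p = 0")
      case True
      then show ?thesis using cfun.subspace_0[OF subspace_blocks] by simp
    next
      case False
      have "v p \<in> N"
        using stable_separate[OF N(1,2) S(1,2) p] S(3,4) F by simp
      then have "block s p \<subseteq> N"
        using block_irreducible[OF s N(1,2)] False S(2,3) p by (cases p) blast
      then show ?thesis using block_subset_blocks[of p ?R s] S p by blast
    qed
    then show "F \<in> blocks s ?R" unfolding S(4) by (intro cfun.subspace_sum[OF subspace_blocks])
  qed
qed

section \<open>The submodules as closed sets of indices\<close>

text \<open>The value -1 marks the region closed under moves because A cannot pass 0, the value 1
  the corresponding region for C, and 0 the rest. The two regions are disjoint since A + C > 0 on
  all indices, so the order of the tests is immaterial there.\<close>

definition wt_class :: "int \<Rightarrow> int \<Rightarrow> int" where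
  "wt_class A C = (if 4 dvd A \<and> A \<le> 0 then -1 else if 4 dvd C \<and> C \<le> 0 then 1 else 0)"

definition cls :: "nat \<Rightarrow> int \<times> nat \<times> int \<Rightarrow> int" where
  "cls N p = wt_class (wt_plus N p) (wt_minus N p)"

lemma wt_sum: "wt_plus N (m, l, k) + wt_minus N (m, l, k) = 8 * int l + 4 * \<bar>k\<bar> + 2 * int N"
  by (simp add: wt_plus_def wt_minus_def)

lemma wt_sum_pos: "N \<ge> 1 \<Longrightarrow> wt_plus N p + wt_minus N p > 0"
  by (cases p) (simp add: wt_plus_def wt_minus_def)

lemma even_abs_add: "\<exists>t. k + \<bar>k\<bar> = 2 * t" for k :: int
  by (cases "k \<ge> 0") (auto intro: exI[of _ k] exI[of _ 0])

text \<open>Modulo 4 the terms 2|k| and 2k agree, also up to sign, so \<open>wt_plus\<close> is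
  congruent to q + N on all of \<open>idx\<close>: whether a is integral depends on q alone.\<close>

lemma wt_plus_dvd:
  assumes "(m, l, k) \<in> idx T q"
  shows "4 dvd wt_plus N (m, l, k) \<longleftrightarrow> [q = - int N] (mod 4)"
proof -
  obtain t where "k + \<bar>k\<bar> = 2 * t" using even_abs_add by blast
  then have "m + 4 * int l + 2 * \<bar>k\<bar> + int N = (m - (2 * k + q)) + (q - (- int N)) + 4 * (int l + t)" by simp
  moreover have "4 dvd m - (2 * k + q)" using assms by (simp add: idx_def cong_iff_dvd_diff)
  ultimately show ?thesis
    unfolding wt_plus_def prod.case cong_iff_dvd_diff by (metis dvd_add_right_iff dvd_add_times_triv_right_iff mult.commute)
qed

lemma wt_minus_dvd:
  assumes "(m, l, k) \<in> idx T q"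
  shows "4 dvd wt_minus N (m, l, k) \<longleftrightarrow> [q = int N] (mod 4)"
proof -
  obtain t where "k + \<bar>k\<bar> = 2 * t" using even_abs_add by blast
  then have "4 * int l + 2 * \<bar>k\<bar> + int N - m = - (m - (2 * k + q)) + (int N - q) + 4 * (int l + t - k)" by simp
  moreover have "4 dvd - (m - (2 * k + q))" using assms by (simp only: idx_def cong_iff_dvd_diff dvd_minus_iff mem_Collect_eq prod.case)
  ultimately have "4 dvd wt_minus N (m, l, k) \<longleftrightarrow> 4 dvd int N - q"
    unfolding wt_minus_def prod.case by (metis dvd_add_right_iff dvd_add_times_triv_right_iff mult.commute)
  then show ?thesis unfolding cong_iff_dvd_diff by (metis dvd_minus_iff minus_diff_eq)
qed

lemma wt_class_down:
  assumes "A + C > 0"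
  shows "wt_class A (C + 4) = wt_class A C \<or> wt_class (A + 4) C = wt_class A C"
  using assms unfolding wt_class_def by presburger

text \<open>In class -1 lower A, in class 1 lower C. In class 0 lowering A works unless A = 4, and
  lowering C works then unless C = 4; at (4, 4) both sources lie in other classes.\<close>

lemma wt_class_up:
  assumes "A + C \<ge> 6" "\<not> (A = 4 \<and> C = 4)"
  shows "wt_class (A - 4) C = wt_class A C \<and> A - 4 \<noteq> 0 \<or> wt_class A (C - 4) = wt_class A C \<and> C - 4 \<noteq> 0"
  using assms unfolding wt_class_def by presburger

lemma wt_next:
  assumes "next_index T k k'"
  shows "wt_plus N (m - 2, l, k) = wt_plus N (m, l, k') - 4" "wt_minus N (m - 2, l, k) = wt_minus N (m, l, k')"
    "wt_plus N (m + 2, l, k) = wt_plus N (m, l, k')" "wt_minus N (m + 2, l, k) = wt_minus N (m, l, k') - 4"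
    "wt_plus N (m - 2, l, k') = wt_plus N (m, l, k)" "wt_minus N (m - 2, l, k') = wt_minus N (m, l, k) + 4"
    "wt_plus N (m + 2, l, k') = wt_plus N (m, l, k) + 4" "wt_minus N (m + 2, l, k') = wt_minus N (m, l, k)"
  using assms by (auto simp: next_index_def wt_plus_def wt_minus_def)

lemma wt_Suc: "wt_plus N (m, l + 1, k) = wt_plus N (m, l, k) + 4" "wt_minus N (m, l + 1, k) = wt_minus N (m, l, k) + 4"
  by (simp_all add: wt_plus_def wt_minus_def)

section \<open>Connectivity of the index set\<close>

text \<open>Connectivity is proved for whole rows, that is all m of one class at fixed l and k,
  because a step between rows may have to start from either m - 2 or m + 2 depending on the
  target.\<close>

definition full :: "'n::finite itself \<Rightarrow> int \<Rightarrow> (int \<times> nat \<times> int) set \<Rightarrow> int \<Rightarrow> nat \<Rightarrow> int \<Rightarrow> bool" where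
  "full T q R c l k \<longleftrightarrow> (\<forall>m. (m, l, k) \<in> idx T q \<and> cls CARD('n) (m, l, k) = c \<longrightarrow> (m, l, k) \<in> R)"

lemma fullD: "full TYPE('n::finite) q R c l k \<Longrightarrow> (m, l, k) \<in> idx TYPE('n) q \<Longrightarrow> cls CARD('n) (m, l, k) = c \<Longrightarrow> (m, l, k) \<in> R"
  by (simp add: full_def)

text \<open>The moves by 4 in m stop only where A = 0 on the way up or C = 0 on the way down. Beyond
  these points the class is a different one, so indices of equal class are never separated by
  them.\<close>

lemma full_layer:
  assumes R: "moves_closed TYPE('n::finite) R" and p: "(m, l, k) \<in> R" "(m, l, k) \<in> idx TYPE('n) q"
  shows "full TYPE('n) q R (cls CARD('n) (m, l, k)) l k"
  unfolding full_def
proof (intro allI impI, elim conjE)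
  fix m'
  assume p': "(m', l, k) \<in> idx TYPE('n) q" and c: "cls CARD('n) (m', l, k) = cls CARD('n) (m, l, k)"
  have "[m = m'] (mod 4)" using p(2) p' by (auto simp: idx_def intro: cong_trans cong_sym)
  then have dvd: "4 dvd m - m'" by (simp add: cong_iff_dvd_diff)
  note R' = R[unfolded moves_closed_def, rule_format]
  show "(m', l, k) \<in> R"
  proof (cases "m' \<ge> m")
    case True
    obtain u where "m - m' = 4 * u" using dvd by (elim dvdE)
    then obtain t :: nat where t: "m' = m + 4 * int t" using True by (intro that[of "nat (- u)"]) simp
    have "(m + 4 * int i, l, k) \<in> R" if "i \<le> t" for i
      using that
    proof (induction i)
      case (Suc i)
      have "wt_plus CARD('n) (m + 4 * int i, l, k) \<noteq> 0"
      proof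
        assume 0: "wt_plus CARD('n) (m + 4 * int i, l, k) = 0"
        then have A: "wt_plus CARD('n) (m, l, k) = - 4 * int i" by (simp add: wt_plus_def)
        then have "cls CARD('n) (m, l, k) = -1" by (simp add: cls_def wt_class_def)
        moreover have "wt_plus CARD('n) (m', l, k) > 0" using A t Suc.prems by (simp add: wt_plus_def)
        then have "cls CARD('n) (m', l, k) \<noteq> -1" by (simp add: cls_def wt_class_def)
        ultimately show False using c by simp
      qed
      then have "(m + 4 * int i + 4, l, k) \<in> R" using R'[of "m + 4 * int i" l k] Suc by simp
      then show ?case by (simp add: algebra_simps)
    qed (use p in simp)
    then show ?thesis using t by simp
  next
    case False
    obtain u where "m - m' = 4 * u" using dvd by (elim dvdE)
    then obtain t :: nat where t: "m' = m - 4 * int t" using False by (intro that[of "nat u"]) simp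
    have "(m - 4 * int i, l, k) \<in> R" if "i \<le> t" for i
      using that
    proof (induction i)
      case (Suc i)
      have "wt_minus CARD('n) (m - 4 * int i, l, k) \<noteq> 0"
      proof
        assume 0: "wt_minus CARD('n) (m - 4 * int i, l, k) = 0"
        then have A: "wt_minus CARD('n) (m, l, k) = - 4 * int i" by (simp add: wt_minus_def)
        have "CARD('n) \<ge> 1" by (simp add: Suc_leI)
        then have "wt_plus CARD('n) (m, l, k) > 0" using A wt_sum_pos[of "CARD('n)" "(m, l, k)"] by simp
        then have "cls CARD('n) (m, l, k) = 1" using A by (simp add: cls_def wt_class_def)
        moreover have "wt_minus CARD('n) (m', l, k) > 0" using A t Suc.prems by (simp add: wt_minus_def)
        then have "cls CARD('n) (m', l, k) \<noteq> 1" by (simp add: cls_def wt_class_def)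
        ultimately show False using c by simp
      qed
      then have "(m - 4 * int i - 4, l, k) \<in> R" using R'[of "m - 4 * int i" l k] Suc by simp
      then show ?case by (simp add: algebra_simps)
    qed (use p in simp)
    then show ?thesis using t by simp
  qed
qed

text \<open>The moves to a smaller |k| are unconditional, so it is enough that one of the two
  sources has the class of the target, which is \<open>wt_class_down\<close>.\<close>

lemma full_down:
  assumes R: "moves_closed TYPE('n::finite) R" and f: "full TYPE('n) q R c l k" and k: "next_index TYPE('n) k' k"
  shows "full TYPE('n) q R c l k'"
  unfolding full_def
proof (intro allI impI, elim conjE)
  fix m assume p: "(m, l, k') \<in> idx TYPE('n) q" "cls CARD('n) (m, l, k') = c"
  have "CARD('n) \<ge> 1" by (simp add: Suc_leI)
  then consider "cls CARD('n) (m - 2, l, k) = c" | "cls CARD('n) (m + 2, l, k) = c"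
    using wt_class_down[OF wt_sum_pos, of "CARD('n)" "(m, l, k')"] p(2) unfolding cls_def wt_next[OF k] by blast
  then show "(m, l, k') \<in> R"
  proof cases
    case 1
    then have "(m - 2, l, k) \<in> R" using fullD[OF f] idx_next[OF p(1)] k by blast
    then have "(m - 2 + 2, l, k') \<in> R" using R k unfolding moves_closed_def by blast
    then show ?thesis by simp
  next
    case 2
    then have "(m + 2, l, k) \<in> R" using fullD[OF f] idx_next[OF p(1)] k by blast
    then have "(m + 2 - 2, l, k') \<in> R" using R k unfolding moves_closed_def by blast
    then show ?thesis by simp
  qed
qed

lemma full_lower_l:
  assumes R: "moves_closed TYPE('n::finite) R" and f: "full TYPE('n) q R c (l + 1) k" and k: "next_index TYPE('n) k k'"
  shows "full TYPE('n) q R c l k'"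
  unfolding full_def
proof (intro allI impI, elim conjE)
  fix m assume p: "(m, l, k') \<in> idx TYPE('n) q" "cls CARD('n) (m, l, k') = c"
  have "CARD('n) \<ge> 1" by (simp add: Suc_leI)
  then consider "cls CARD('n) (m - 2, l + 1, k) = c" | "cls CARD('n) (m + 2, l + 1, k) = c"
    using wt_class_down[OF wt_sum_pos, of "CARD('n)" "(m, l, k')"] p(2)
    unfolding cls_def wt_Suc wt_next[OF k] by auto
  then show "(m, l, k') \<in> R"
  proof cases
    case 1
    then have "(m - 2, l + 1, k) \<in> R" using fullD[OF f] idx_next[OF p(1)] k by blast
    then have "(m - 2 + 2, l + 1 - 1, k') \<in> R" using R k unfolding moves_closed_def by (metis le_add2)
    then show ?thesis by simp
  next
    case 2
    then have "(m + 2, l + 1, k) \<in> R" using fullD[OF f] idx_next[OF p(1)] k by blast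
    then have "(m + 2 - 2, l + 1 - 1, k') \<in> R" using R k unfolding moves_closed_def by (metis le_add2)
    then show ?thesis by simp
  qed
qed

text \<open>Moves to a larger |k| require a nonzero weight at the source, and the source must have
  the right class; \<open>wt_class_up\<close> provides this except at A = C = 4. The sum A + C then
  forces n = 2 and l = k = 0, with q congruent to 2 and class 0, the excluded case.\<close>

lemma full_up:
  assumes R: "moves_closed TYPE('n::finite) R" and f: "full TYPE('n) q R c l k" and k: "next_index TYPE('n) k k'"
    and ex: "\<not> (CARD('n) = 2 \<and> l = 0 \<and> k = 0 \<and> [q = 2] (mod 4) \<and> c = 0)"
  shows "full TYPE('n) q R c l k'"
  unfolding full_def
proof (intro allI impI, elim conjE)
  fix m assume p: "(m, l, k') \<in> idx TYPE('n) q" "cls CARD('n) (m, l, k') = c"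
  have n: "CARD('n) \<ge> 1" by (simp add: Suc_leI)
  have k1: "\<bar>k'\<bar> = \<bar>k\<bar> + 1" using k by (simp add: next_index_def)
  let ?A = "wt_plus CARD('n) (m, l, k')" and ?C = "wt_minus CARD('n) (m, l, k')"
  have "int CARD('n) \<ge> 1" using n by simp
  then have "?A + ?C \<ge> 6" using wt_sum[of "CARD('n)" m l k'] k1 abs_ge_zero[of k] by linarith
  moreover have "\<not> (?A = 4 \<and> ?C = 4)"
  proof
    assume *: "?A = 4 \<and> ?C = 4"
    then have "8 * int l + 4 * \<bar>k\<bar> + 2 * int CARD('n) = 4" using wt_sum[of "CARD('n)" m l k'] k1 by simp
    moreover have ints: "c = 2 \<and> a = 0 \<and> x = 0" if "8 * a + 4 * x + 2 * c = 4" "a \<ge> 0" "x \<ge> 0" "c \<ge> 1" for a x c :: int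
      using that by presburger
    ultimately have "int CARD('n) = 2 \<and> int l = 0 \<and> \<bar>k\<bar> = 0" using n by (intro ints) auto
    moreover have "[q = int CARD('n)] (mod 4)" using wt_minus_dvd[OF p(1), of "CARD('n)"] * by simp
    moreover have "c = 0" using p(2) * by (simp add: cls_def wt_class_def)
    ultimately show False using ex by simp
  qed
  ultimately consider "cls CARD('n) (m - 2, l, k) = c" "wt_plus CARD('n) (m - 2, l, k) \<noteq> 0"
    | "cls CARD('n) (m + 2, l, k) = c" "wt_minus CARD('n) (m + 2, l, k) \<noteq> 0"
    using wt_class_up[of ?A ?C] p(2) unfolding cls_def wt_next[OF k] by blast
  then show "(m, l, k') \<in> R"
  proof cases
    case 1
    then have "(m - 2, l, k) \<in> R" using fullD[OF f] idx_next[OF p(1)] k by blast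
    then have "(m - 2 + 2, l, k') \<in> R" using R k 1 unfolding moves_closed_def by blast
    then show ?thesis by simp
  next
    case 2
    then have "(m + 2, l, k) \<in> R" using fullD[OF f] idx_next[OF p(1)] k by blast
    then have "(m + 2 - 2, l, k') \<in> R" using R k 2 unfolding moves_closed_def by blast
    then show ?thesis by simp
  qed
qed

lemma full_raise_l:
  assumes R: "moves_closed TYPE('n::finite) R" and f: "full TYPE('n) q R c l k" and k: "next_index TYPE('n) k' k"
    and l: "l \<ge> 1"
  shows "full TYPE('n) q R c (l + 1) k'"
  unfolding full_def
proof (intro allI impI, elim conjE)
  fix m assume p: "(m, l + 1, k') \<in> idx TYPE('n) q" "cls CARD('n) (m, l + 1, k') = c"
  let ?A = "wt_plus CARD('n) (m, l + 1, k')" and ?C = "wt_minus CARD('n) (m, l + 1, k')"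
  \<comment> \<open>For l \<ge> 1 the weights at the target are too large for the exceptional pair
    (4, 4).\<close>
  have "?A + ?C \<ge> 16" unfolding wt_sum using l by simp
  then have "?A + ?C \<ge> 6" "\<not> (?A = 4 \<and> ?C = 4)" by auto
  then consider "cls CARD('n) (m - 2, l, k) = c" "wt_plus CARD('n) (m - 2, l, k) \<noteq> 0"
    | "cls CARD('n) (m + 2, l, k) = c" "wt_minus CARD('n) (m + 2, l, k) \<noteq> 0"
    using wt_class_up[of ?A ?C] p(2) unfolding cls_def wt_next[OF k] wt_Suc by auto
  then show "(m, l + 1, k') \<in> R"
  proof cases
    case 1
    then have "(m - 2, l, k) \<in> R" using fullD[OF f] idx_next[OF p(1)] k by blast
    then have "(m - 2 + 2, l + 1, k') \<in> R" using R k 1 l unfolding moves_closed_def by blast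
    then show ?thesis by simp
  next
    case 2
    then have "(m + 2, l, k) \<in> R" using fullD[OF f] idx_next[OF p(1)] k by blast
    then have "(m + 2 - 2, l + 1, k') \<in> R" using R k 2 l unfolding moves_closed_def by blast
    then show ?thesis by simp
  qed
qed

lemma next_0_1: "next_index T 0 1"
  by (auto simp: next_index_def harm_indices_def)

lemma full_zero:
  assumes R: "moves_closed TYPE('n::finite) R"
  shows "k \<in> harm_indices TYPE('n) \<Longrightarrow> full TYPE('n) q R c l k \<Longrightarrow> full TYPE('n) q R c l 0"
proof (induction "nat \<bar>k\<bar>" arbitrary: k)
  case (Suc d)
  then have "k \<noteq> 0" by auto
  note k' = next_index_pred[OF Suc.prems(1) this]
  show ?case
    using Suc.hyps(1)[OF _ _ full_down[OF R Suc.prems(2) k']] nat_next_index[OF k'] Suc.hyps(2) k'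
    by (simp add: next_index_def)
qed simp

lemma full_from_zero:
  assumes R: "moves_closed TYPE('n::finite) R" and f: "full TYPE('n) q R c l 0"
    and ex: "\<not> (CARD('n) = 2 \<and> l = 0 \<and> [q = 2] (mod 4) \<and> c = 0)"
  shows "k \<in> harm_indices TYPE('n) \<Longrightarrow> full TYPE('n) q R c l k"
proof (induction "nat \<bar>k\<bar>" arbitrary: k)
  case 0
  then show ?case using f by simp
next
  case (Suc d)
  then have "k \<noteq> 0" by auto
  note k' = next_index_pred[OF Suc.prems this]
  have "full TYPE('n) q R c l (k - sgn k)"
    using Suc.hyps(1)[of "k - sgn k"] nat_next_index[OF k'] Suc.hyps(2) k' by (simp add: next_index_def)
  then show ?case using full_up[OF R _ k'] ex by blast
qed

text \<open>Lowering l passes through k = 1 at the smaller l, from where one returns to k =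
  0.\<close>

lemma full_less_l:
  assumes R: "moves_closed TYPE('n::finite) R" and f: "full TYPE('n) q R c l 0"
  shows "l' \<le> l \<Longrightarrow> full TYPE('n) q R c l' 0"
proof (induction "l - l'" arbitrary: l')
  case (Suc d)
  then have "full TYPE('n) q R c (l' + 1) 0" by (intro Suc.hyps(1)) auto
  from full_down[OF R full_lower_l[OF R this next_0_1] next_0_1] show ?case .
qed (use f in simp)

text \<open>Each increase of l by 1 goes from k = 0 to k = 1 and back to k = 0 at l + 1. Both halves
  need l \<ge> 1: the first to avoid the exceptional case, the second because its coefficient
  contains l.\<close>

lemma full_greater_l:
  assumes R: "moves_closed TYPE('n::finite) R" and f: "full TYPE('n) q R c l 0" "l \<ge> 1"
  shows "full TYPE('n) q R c (l + i) 0"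
proof (induction i)
  case (Suc i)
  have "full TYPE('n) q R c (l + i) 1" using full_up[OF R Suc next_0_1] f(2) by simp
  then show ?case using full_raise_l[OF R _ next_0_1, of q c "l + i"] f(2) by simp
qed (use f in simp)

text \<open>Any two rows are joined through k = 0: descend to k = 0, change l there, and climb to
  k'. The climb at l' = 0 is the only part that can meet the exceptional case.\<close>

lemma closed_connected:
  assumes R: "moves_closed TYPE('n::finite) R" and p: "(m, l, k) \<in> R" "(m, l, k) \<in> idx TYPE('n) q"
    and p': "(m', l', k') \<in> idx TYPE('n) q" "cls CARD('n) (m', l', k') = cls CARD('n) (m, l, k)"
    and l: "l' = 0 \<or> l \<ge> 1"
    and ex: "\<not> (CARD('n) = 2 \<and> l' = 0 \<and> [q = 2] (mod 4) \<and> cls CARD('n) (m, l, k) = 0)"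
  shows "(m', l', k') \<in> R"
proof -
  let ?c = "cls CARD('n) (m, l, k)"
  have K: "k \<in> harm_indices TYPE('n)" "k' \<in> harm_indices TYPE('n)" using p(2) p'(1) by (auto simp: idx_def)
  have f0: "full TYPE('n) q R ?c l 0" by (rule full_zero[OF R K(1) full_layer[OF R p]])
  have "full TYPE('n) q R ?c l' 0"
  proof (cases "l' \<le> l")
    case True
    then show ?thesis by (rule full_less_l[OF R f0])
  next
    case False
    then show ?thesis using full_greater_l[OF R f0, of "l' - l"] l by simp
  qed
  then have "full TYPE('n) q R ?c l' k'" using full_from_zero[OF R _ _ K(2)] ex by blast
  then show ?thesis by (rule fullD[OF _ p'])
qed

text \<open>The exceptional case of \<open>closed_connected\<close>: for \<open>n = 2\<close>, \<open>q \<equiv> 2\<close> there is no index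
  with \<open>k = 0\<close>, and only the reflection \<open>k \<mapsto> - k\<close> connects the two signs of \<open>k\<close>.\<close>

lemma closed_connected_sym:
  assumes n: "CARD('n::finite) = 2" and q: "[q = 2] (mod 4)"
    and R: "moves_closed TYPE('n) R" "\<And>m l k. (m, l, k) \<in> R \<Longrightarrow> (m, l, - k) \<in> R"
    and p: "(m, 0, k) \<in> R" "(m, 0, k) \<in> idx TYPE('n) q" "cls CARD('n) (m, 0, k) = 0"
    and p': "(m', 0, k') \<in> idx TYPE('n) q" "cls CARD('n) (m', 0, k') = 0"
  shows "(m', 0, k') \<in> R"
proof -
  have K: "harm_indices TYPE('n) = UNIV" using n by (simp add: harm_indices_def)
  have q': "[q = - 2] (mod 4)" using q unfolding cong_iff_dvd_diff by presburger
  \<comment> \<open>At k = l = 0 the weights sum to 2n = 4 and are multiples of 4. In class 0 both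
    would be positive, hence at least 4 each.\<close>
  have nz: "k \<noteq> 0" if p: "(m, 0, k) \<in> idx TYPE('n) q" "cls CARD('n) (m, 0, k) = 0" for m k
  proof
    assume k: "k = 0"
    have "4 dvd wt_plus CARD('n) (m, 0, k)" "4 dvd wt_minus CARD('n) (m, 0, k)"
      using wt_plus_dvd[OF p(1)] wt_minus_dvd[OF p(1)] q q' n by auto
    moreover from this have "wt_plus CARD('n) (m, 0, k) > 0" "wt_minus CARD('n) (m, 0, k) > 0"
      using p(2) by (auto simp: cls_def wt_class_def split: if_splits)
    moreover have "wt_plus CARD('n) (m, 0, k) + wt_minus CARD('n) (m, 0, k) = 4"
      unfolding wt_sum using k n by simp
    ultimately show False by presburger
  qed
  have down: "full TYPE('n) q R 0 0 (sgn k)" if "k \<noteq> 0" "full TYPE('n) q R 0 0 k" for k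
    using that
  proof (induction "nat \<bar>k\<bar>" arbitrary: k rule: less_induct)
    case less
    show ?case
    proof (cases "\<bar>k\<bar> = 1")
      case True
      then have "sgn k = k" by (auto simp: sgn_if)
      then show ?thesis using less.prems by simp
    next
      case False
      have "k \<in> harm_indices TYPE('n)" using K by simp
      note k' = next_index_pred[OF this less.prems(1)]
      have "nat \<bar>k - sgn k\<bar> < nat \<bar>k\<bar>" "k - sgn k \<noteq> 0" "sgn (k - sgn k) = sgn k"
        using less.prems(1) False by (auto simp: sgn_if split: if_splits)
      then show ?thesis using less.hyps[of "k - sgn k"] full_down[OF R(1) less.prems(2) k'] by simp
    qed
  qed
  have up: "full TYPE('n) q R 0 0 k" if "k \<noteq> 0" "full TYPE('n) q R 0 0 (sgn k)" for k
    using that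
  proof (induction "nat \<bar>k\<bar>" arbitrary: k rule: less_induct)
    case less
    show ?case
    proof (cases "\<bar>k\<bar> = 1")
      case True
      then have "sgn k = k" by (auto simp: sgn_if)
      then show ?thesis using less.prems by simp
    next
      case False
      have "k \<in> harm_indices TYPE('n)" using K by simp
      note k' = next_index_pred[OF this less.prems(1)]
      have *: "nat \<bar>k - sgn k\<bar> < nat \<bar>k\<bar>" "k - sgn k \<noteq> 0" "sgn (k - sgn k) = sgn k"
        using less.prems(1) False by (auto simp: sgn_if split: if_splits)
      then have "full TYPE('n) q R 0 0 (k - sgn k)" using less.hyps[of "k - sgn k"] less.prems(2) by simp
      then show ?thesis using full_up[OF R(1) _ k'] * by blast
    qed
  qed
  \<comment> \<open>Congruence and weights depend on k only through 2k modulo 4 and |k|, so the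
    reflection carries the class-0 row at k onto the one at -k.\<close>
  have flip: "full TYPE('n) q R 0 0 (- k)" if "full TYPE('n) q R 0 0 k" for k
  proof -
    have "(m, 0, k) \<in> idx TYPE('n) q" "cls CARD('n) (m, 0, k) = 0"
      if "(m, 0, - k) \<in> idx TYPE('n) q" "cls CARD('n) (m, 0, - k) = 0" for m
    proof -
      have "[m = 2 * (- k) + q] (mod 4)" using that by (simp only: idx_def mem_Collect_eq prod.case)
      then have "[m = 2 * k + q] (mod 4)" unfolding cong_iff_dvd_diff by presburger
      then show "(m, 0, k) \<in> idx TYPE('n) q" using K by (simp add: idx_def)
      show "cls CARD('n) (m, 0, k) = 0" using that(2) by (simp add: cls_def wt_plus_def wt_minus_def)
    qed
    then show ?thesis using that R(2) unfolding full_def by blast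
  qed
  have "full TYPE('n) q R 0 0 k" using full_layer[OF R(1) p(1,2)] p(3) by simp
  then have f: "full TYPE('n) q R 0 0 (sgn k)" using down nz[OF p(2,3)] by blast
  have "sgn k' = sgn k \<or> sgn k' = - sgn k"
    using nz[OF p(2,3)] nz[OF p'] by (auto simp: sgn_if)
  then have "full TYPE('n) q R 0 0 (sgn k')" using f flip[OF f] by auto
  then show ?thesis using up[of k'] nz[OF p'] fullD[OF _ p'] by blast
qed

section \<open>The closed index sets of the theorem\<close>

definition idx_zero :: "'n::finite itself \<Rightarrow> int \<Rightarrow> (int \<times> nat \<times> int) set" where
  "idx_zero T q = {(m, l, k) \<in> idx T q. l = 0}"

definition idx_plus :: "'n::finite itself \<Rightarrow> int \<Rightarrow> (int \<times> nat \<times> int) set" where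
  "idx_plus T q = {p \<in> idx T q. cls CARD('n) p = 1}"

definition idx_minus :: "'n::finite itself \<Rightarrow> int \<Rightarrow> (int \<times> nat \<times> int) set" where
  "idx_minus T q = {p \<in> idx T q. cls CARD('n) p = -1}"

lemma cls_minus_iff: "cls N p = -1 \<longleftrightarrow> 4 dvd wt_plus N p \<and> wt_plus N p \<le> 0"
  by (auto simp: cls_def wt_class_def)

lemma cls_plus_iff: "N \<ge> 1 \<Longrightarrow> cls N p = 1 \<longleftrightarrow> 4 dvd wt_minus N p \<and> wt_minus N p \<le> 0"
  using wt_sum_pos[of N p] by (auto simp: cls_def wt_class_def)

lemma moves_closed_Un: "moves_closed T P \<Longrightarrow> moves_closed T Q \<Longrightarrow> moves_closed T (P \<union> Q)"
  unfolding moves_closed_def Un_iff by (intro allI impI; elim disjE) (blast intro: disjI1 disjI2)+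

lemma moves_closed_Int: "moves_closed T P \<Longrightarrow> moves_closed T Q \<Longrightarrow> moves_closed T (P \<inter> Q)"
  unfolding moves_closed_def Int_iff by (intro allI impI; elim conjE) (intro conjI allI impI; blast)

lemma moves_closed_empty: "moves_closed T {}"
  by (simp add: moves_closed_def)

lemma moves_closed_l0: "moves_closed T {(m, l, k). l = 0}"
  by (simp add: moves_closed_def)

lemma idx_zero_eq: "idx_zero T q = idx T q \<inter> {(m, l, k). l = 0}"
  by (auto simp: idx_zero_def)

lemma moves_closed_idx_zero: "moves_closed TYPE('n::finite) (idx_zero TYPE('n) q)"
  unfolding idx_zero_eq by (intro moves_closed_Int moves_closed_idx moves_closed_l0)

lemma wt_shift_4:
  "wt_plus N (m + 4, l, k) = wt_plus N (m, l, k) + 4" "wt_plus N (m - 4, l, k) = wt_plus N (m, l, k) - 4"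
  "wt_minus N (m + 4, l, k) = wt_minus N (m, l, k) - 4" "wt_minus N (m - 4, l, k) = wt_minus N (m, l, k) + 4"
  by (simp_all add: wt_plus_def wt_minus_def)

lemma wt_pred: "l \<ge> 1 \<Longrightarrow> wt_plus N (m, l - 1, k) = wt_plus N (m, l, k) - 4"
  "l \<ge> 1 \<Longrightarrow> wt_minus N (m, l - 1, k) = wt_minus N (m, l, k) - 4"
  by (simp_all add: wt_plus_def wt_minus_def)

text \<open>Every move either lowers the relevant weight by 4, leaves it, or raises it by 4 under
  the condition that it is not 0. The condition is what keeps a nonpositive multiple of 4
  nonpositive.\<close>

definition nonpos4 :: "int \<Rightarrow> bool" where
  "nonpos4 A \<longleftrightarrow> 4 dvd A \<and> A \<le> 0"

lemma nonpos4_step: "nonpos4 A \<Longrightarrow> nonpos4 (A - 4)" "nonpos4 A \<Longrightarrow> A \<noteq> 0 \<Longrightarrow> nonpos4 (A + 4)"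
  unfolding nonpos4_def by presburger+

lemma moves_closed_idx_minus: "moves_closed TYPE('n::finite) (idx_minus TYPE('n) q)"
proof -
  have "moves_closed TYPE('n) {p. nonpos4 (wt_plus CARD('n) p)}"
    unfolding moves_closed_def mem_Collect_eq
    by (intro allI impI conjI;
      simp only: wt_shift_4 wt_next wt_pred wt_Suc nonpos4_step diff_add_cancel add_diff_cancel_right' simp_thms)
  moreover have "idx_minus TYPE('n) q = idx TYPE('n) q \<inter> {p. nonpos4 (wt_plus CARD('n) p)}"
    by (auto simp: idx_minus_def cls_minus_iff nonpos4_def)
  ultimately show ?thesis by (simp add: moves_closed_Int moves_closed_idx)
qed

lemma moves_closed_idx_plus: "moves_closed TYPE('n::finite) (idx_plus TYPE('n) q)"
proof -
  have n: "CARD('n) \<ge> 1" by (simp add: Suc_leI)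
  have "moves_closed TYPE('n) {p. nonpos4 (wt_minus CARD('n) p)}"
    unfolding moves_closed_def mem_Collect_eq
    by (intro allI impI conjI;
      simp only: wt_shift_4 wt_next wt_pred wt_Suc nonpos4_step diff_add_cancel add_diff_cancel_right' simp_thms)
  moreover have "idx_plus TYPE('n) q = idx TYPE('n) q \<inter> {p. nonpos4 (wt_minus CARD('n) p)}"
    by (auto simp: idx_plus_def cls_plus_iff[OF n] nonpos4_def)
  ultimately show ?thesis by (simp add: moves_closed_Int moves_closed_idx)
qed

section \<open>Quotients and composition series\<close>

text \<open>The correspondence between submodules of the quotient and submodules between V1 and V2.
  Additivity of the action is asked for on V2 only, as the operators are not additive on all
  functions; it makes the action on cosets independent of representatives.\<close>

lemma quotient_irreducible:
  fixes M :: "('x, 'n::finite func) gmod"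
  assumes M: "gm_zero M = 0" "gm_add M = (+)" "gm_scale M = fscale"
    and V1: "gm_submodule M V1" and V2: "gm_submodule M V2" and less: "V1 \<subset> V2"
    and lin: "\<And>x a b. x \<in> gm_ops M \<Longrightarrow> a \<in> V2 \<Longrightarrow> b \<in> V2 \<Longrightarrow> gm_act M x (a + b) = gm_act M x a + gm_act M x b"
    and between: "\<And>N. gm_submodule M N \<Longrightarrow> V1 \<subseteq> N \<Longrightarrow> N \<subseteq> V2 \<Longrightarrow> N = V1 \<or> N = V2"
  shows "gm_irreducible (gm_quotient (gm_restrict M V2) V1)"
proof -
  define cs where "cs a = {a + v | v. v \<in> V1}" for a
  have cos: "gm_coset (gm_restrict M V2) V1 = cs"
    by (simp add: gm_coset_def gm_restrict_def cs_def M fun_eq_iff)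
  have s1: "cfun.subspace V1" and s2: "cfun.subspace V2"
    using V1 V2 by (auto simp: gm_submodule_def cfun.subspace_def M)
  have self: "a \<in> cs a" for a
    using cfun.subspace_0[OF s1] by (auto simp: cs_def intro!: exI[of _ 0])
  have eq: "cs a = cs b" if "a - b \<in> V1" for a b
  proof -
    have "cs a \<subseteq> cs b" if "a - b \<in> V1" for a b
    proof
      fix x assume "x \<in> cs a"
      then obtain v where v: "v \<in> V1" "x = a + v" by (auto simp: cs_def)
      then have "x = b + ((a - b) + v)" "(a - b) + v \<in> V1" using that cfun.subspace_add[OF s1] by auto
      then show "x \<in> cs b" unfolding cs_def by blast
    qed
    moreover have "b - a \<in> V1" using cfun.subspace_neg[OF s1 that] by simp
    ultimately show ?thesis using that by blast
  qed
  have mem: "x - a \<in> V1" if "x \<in> cs a" for x a using that by (auto simp: cs_def)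
  have zero: "cs a = V1" if "a \<in> V1" for a
    using eq[of a 0] that by (simp add: cs_def)
  let ?Q = "gm_quotient (gm_restrict M V2) V1"
  have V12: "V1 \<subseteq> V2" using less by blast
  have in2: "x \<in> V2" if "x \<in> cs a" "a \<in> V2" for x a
    using that V12 cfun.subspace_add[OF s2] by (auto simp: cs_def)
  have add: "gm_add ?Q (cs a) (cs b) = cs (a + b)" for a b
  proof -
    have "cs (x + y) = cs (a + b)" if "x \<in> cs a" "y \<in> cs b" for x y
      using cfun.subspace_add[OF s1 mem[OF that(1)] mem[OF that(2)]] by (intro eq) (simp add: algebra_simps)
    then have "gm_add ?Q (cs a) (cs b) = (\<Union>x\<in>cs a. \<Union>y\<in>cs b. cs (a + b))"
      by (simp add: gm_quotient_def cos) (simp add: gm_restrict_def M)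
    then show ?thesis using self by auto
  qed
  have scale: "gm_scale ?Q c (cs a) = cs (fscale c a)" for c a
  proof -
    have "cs (fscale c x) = cs (fscale c a)" if "x \<in> cs a" for x
      using cfun.subspace_scale[OF s1 mem[OF that]] by (intro eq) (simp add: cfun.scale_right_diff_distrib)
    then have "gm_scale ?Q c (cs a) = (\<Union>x\<in>cs a. cs (fscale c a))"
      by (simp add: gm_quotient_def cos) (simp add: gm_restrict_def M)
    then show ?thesis using self by auto
  qed
  have act: "gm_act ?Q x (cs a) = cs (gm_act M x a)" if x: "x \<in> gm_ops M" and a: "a \<in> V2" for x a
  proof -
    have "cs (gm_act M x y) = cs (gm_act M x a)" if y: "y \<in> cs a" for y
    proof (rule eq)
      obtain v where v: "v \<in> V1" "y = a + v" using y by (auto simp: cs_def)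
      then have "gm_act M x y = gm_act M x a + gm_act M x v" using lin[OF x a] V12 by blast
      then show "gm_act M x y - gm_act M x a \<in> V1" using V1 x v by (simp add: gm_submodule_def)
    qed
    then have "gm_act ?Q x (cs a) = (\<Union>y\<in>cs a. cs (gm_act M x a))"
      by (simp add: gm_quotient_def cos) (simp add: gm_restrict_def)
    then show ?thesis using self by auto
  qed
  have carrier: "gm_carrier ?Q = cs ` V2" and zeroQ: "gm_zero ?Q = V1" and ops: "gm_ops ?Q = gm_ops M"
    by (simp_all add: gm_quotient_def cos) (simp_all add: gm_restrict_def)
  show ?thesis
    unfolding gm_irreducible_def
  proof (intro conjI allI impI)
    obtain a where a: "a \<in> V2" "a \<notin> V1" using less by blast
    then have "cs a \<noteq> V1" using self by blast
    then show "gm_carrier ?Q \<noteq> {gm_zero ?Q}" using a unfolding carrier zeroQ by blast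
  next
    fix \<N> assume sub: "gm_submodule ?Q \<N>"
    note sub' = sub[unfolded gm_submodule_def carrier zeroQ ops]
    define N where "N = {a \<in> V2. cs a \<in> \<N>}"
    have "gm_submodule M N"
      unfolding gm_submodule_def
    proof (intro conjI ballI allI)
      show "N \<subseteq> gm_carrier M" using V2 by (auto simp: N_def gm_submodule_def)
      show "gm_zero M \<in> N" using sub' zero[OF cfun.subspace_0[OF s1]] cfun.subspace_0[OF s2] by (simp add: N_def M)
      show "gm_add M a b \<in> N" if "a \<in> N" "b \<in> N" for a b
        using that sub' cfun.subspace_add[OF s2] by (simp add: N_def M add[symmetric])
      show "gm_scale M c a \<in> N" if "a \<in> N" for c a
        using that sub' cfun.subspace_scale[OF s2] by (simp add: N_def M scale[symmetric])
      show "gm_act M x a \<in> N" if "x \<in> gm_ops M" "a \<in> N" for x a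
      proof -
        have a: "a \<in> V2" "cs a \<in> \<N>" using that by (auto simp: N_def)
        have "gm_act ?Q x (cs a) \<in> \<N>" using sub' that(1) a(2) by simp
        moreover have "gm_act M x a \<in> V2" using V2 that(1) a(1) by (simp add: gm_submodule_def)
        ultimately show ?thesis unfolding act[OF that(1) a(1)] by (simp add: N_def)
      qed
    qed
    moreover have "V1 \<subseteq> N"
    proof
      fix a assume "a \<in> V1"
      then show "a \<in> N" using conjunct1[OF conjunct2[OF sub']] zero[of a] V12 by (auto simp: N_def)
    qed
    moreover have "N \<subseteq> V2" by (auto simp: N_def)
    ultimately consider "N = V1" | "N = V2" using between by blast
    then show "\<N> = {gm_zero ?Q} \<or> \<N> = gm_carrier ?Q"
    proof cases
      case 1
      have "X = V1" if X: "X \<in> \<N>" for X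
      proof -
        obtain a where a: "a \<in> V2" "X = cs a" using subsetD[OF conjunct1[OF sub'] X] by blast
        have "a \<in> N" unfolding N_def using X a by simp
        then have "a \<in> V1" unfolding 1 .
        then show ?thesis unfolding a(2) by (rule zero)
      qed
      moreover have "V1 \<in> \<N>" using sub' by simp
      ultimately show ?thesis unfolding zeroQ by blast
    next
      case 2
      have "cs a \<in> \<N>" if "a \<in> V2" for a
        using that unfolding 2[symmetric] by (simp add: N_def)
      moreover have "\<N> \<subseteq> cs ` V2" using sub' by simp
      ultimately show ?thesis unfolding carrier by blast
    qed
  qed
qed

definition good :: "'n::finite itself \<Rightarrow> int \<Rightarrow> bool \<Rightarrow> (int \<times> nat \<times> int) set \<Rightarrow> bool" where
  "good T q b P \<longleftrightarrow> P \<subseteq> idx T q \<and> moves_closed T P \<and> (b \<longrightarrow> (\<forall>m l k. (m, l, k) \<in> P \<longrightarrow> (m, l, - k) \<in> P))"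

text \<open>The flag \<open>b\<close> distinguishes \<open>schr_O_module\<close> for \<open>n = 2\<close> from \<open>schr_module\<close>.\<close>

definition index_module :: "('x, 'n::finite func) gmod \<Rightarrow> complex \<Rightarrow> int \<Rightarrow> bool \<Rightarrow> bool" where
  "index_module M s q b \<longleftrightarrow> gm_zero M = 0 \<and> gm_add M = (+) \<and> gm_scale M = fscale \<and>
     gm_carrier M = blocks s (idx TYPE('n) q) \<and>
     (\<forall>N. gm_submodule M N \<longleftrightarrow> (\<exists>P. good TYPE('n) q b P \<and> N = blocks s P)) \<and>
     (\<forall>x\<in>gm_ops M. \<forall>F\<in>blocks s (idx TYPE('n) q). \<forall>G\<in>blocks s (idx TYPE('n) q).
        gm_act M x (F + G) = gm_act M x F + gm_act M x G)"

lemma index_moduleD: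
  fixes M :: "('x, 'n::finite func) gmod"
  assumes "index_module M s q b"
  shows "gm_zero M = 0" "gm_add M = (+)" "gm_scale M = fscale" "gm_carrier M = blocks s (idx TYPE('n) q)"
    "\<forall>N. gm_submodule M N \<longleftrightarrow> (\<exists>P. good TYPE('n) q b P \<and> N = blocks s P)"
    "\<forall>x\<in>gm_ops M. \<forall>F\<in>blocks s (idx TYPE('n) q). \<forall>G\<in>blocks s (idx TYPE('n) q).
        gm_act M x (F + G) = gm_act M x F + gm_act M x G"
  using assms unfolding index_module_def by - (elim conjE; assumption)+

lemma blocks_subset_iff:
  assumes "P \<subseteq> idx TYPE('n::finite) q" "Q \<subseteq> idx TYPE('n) q"
  shows "(blocks s P :: 'n func set) \<subseteq> blocks s Q \<longleftrightarrow> P \<subseteq> Q"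
proof
  assume sub: "(blocks s P :: 'n func set) \<subseteq> blocks s Q"
  show "P \<subseteq> Q"
  proof
    fix p assume p: "p \<in> P"
    then have "(block s p :: 'n func set) \<subseteq> blocks s Q" using block_subset_blocks[OF p] sub by blast
    moreover have "p \<in> idx TYPE('n) q" using p assms by blast
    ultimately show "p \<in> Q" using block_subset_HS_iff assms(2) by blast
  qed
qed (rule blocks_mono)

lemma blocks_empty: "blocks s {} = {0}"
  by (simp add: blocks_def)

definition good_step :: "'n::finite itself \<Rightarrow> int \<Rightarrow> bool \<Rightarrow> (int \<times> nat \<times> int) set \<Rightarrow> (int \<times> nat \<times> int) set \<Rightarrow> bool" where
  "good_step T q b P Q \<longleftrightarrow> P \<subset> Q \<and> (\<forall>R. good T q b R \<longrightarrow> P \<subseteq> R \<longrightarrow> R \<subseteq> Q \<longrightarrow> R = P \<or> R = Q)"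

lemma composition_series_blocks:
  fixes M :: "('x, 'n::finite func) gmod"
  assumes M: "index_module M s q b"
    and Ps: "Ps \<noteq> []" "hd Ps = {}" "last Ps = idx TYPE('n) q" "\<And>P. P \<in> set Ps \<Longrightarrow> good TYPE('n) q b P"
    and step: "\<And>i. Suc i < length Ps \<Longrightarrow> good_step TYPE('n) q b (Ps ! i) (Ps ! Suc i)"
  shows "gm_composition_series M (map (blocks s) Ps)"
  unfolding gm_composition_series_def
proof (intro conjI allI impI ballI)
  note M' = index_moduleD[OF M]
  have sub: "gm_submodule M (blocks s P)" if "P \<in> set Ps" for P
    using M'(5) Ps(4)[OF that] by blast
  show "map (blocks s) Ps \<noteq> []" using Ps by simp
  show "hd (map (blocks s) Ps) = {gm_zero M}" using Ps M'(1) by (simp add: hd_map blocks_empty)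
  show "last (map (blocks s) Ps) = gm_carrier M" using Ps M'(4) by (simp add: last_map)
  show "gm_submodule M V" if "V \<in> set (map (blocks s) Ps)" for V using that sub by auto
  fix i assume "Suc i < length (map (blocks s) Ps)"
  then have i: "Suc i < length Ps" by simp
  let ?P = "Ps ! i" and ?Q = "Ps ! Suc i"
  have PQ: "?P \<in> set Ps" "?Q \<in> set Ps" using i by auto
  have idxPQ: "?P \<subseteq> idx TYPE('n) q" "?Q \<subseteq> idx TYPE('n) q" using Ps(4) PQ by (auto simp: good_def)
  note st = step[OF i, unfolded good_step_def]
  have less: "(blocks s ?P :: 'n func set) \<subset> blocks s ?Q"
    using blocks_subset_iff[OF idxPQ, of s] blocks_subset_iff[OF idxPQ(2,1), of s] conjunct1[OF st]
    by (simp add: less_le_not_le)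
  then show "map (blocks s) Ps ! i \<subset> (map (blocks s) Ps ! Suc i :: 'n func set)" using i by simp
  have "gm_irreducible (gm_quotient (gm_restrict M (blocks s ?Q)) (blocks s ?P))"
  proof (rule quotient_irreducible[OF _ _ _ sub[OF PQ(1)] sub[OF PQ(2)] less])
    show "gm_act M x (F + G) = gm_act M x F + gm_act M x G"
      if "x \<in> gm_ops M" "F \<in> blocks s ?Q" "G \<in> blocks s ?Q" for x F G
      using bspec[OF bspec[OF bspec[OF M'(6) that(1)]]] that(2,3) blocks_mono[OF idxPQ(2), of s] by blast
    fix N assume N: "gm_submodule M N" "blocks s ?P \<subseteq> N" "N \<subseteq> blocks s ?Q"
    then obtain R where R: "good TYPE('n) q b R" "N = blocks s R" using M'(5) by blast
    have "R \<subseteq> idx TYPE('n) q" using R by (simp add: good_def)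
    then have "?P \<subseteq> R" "R \<subseteq> ?Q"
      using N R(2) blocks_subset_iff[OF idxPQ(1), of R s] blocks_subset_iff[OF _ idxPQ(2), of R s] by auto
    then show "N = blocks s ?P \<or> N = blocks s ?Q" using st R by blast
  qed (use M'(1-3) in auto)
  then show "gm_irreducible (gm_quotient (gm_restrict M (map (blocks s) Ps ! Suc i)) (map (blocks s) Ps ! i))"
    using i by simp
qed

text \<open>The difference of Q and P consists of a single class, with l = 0 throughout or l \<ge> 1
  throughout, so a closed set that contains one index of the difference contains all of it. The last
  premise demands the symmetry in k only where the exceptional case occurs; p0 shows that the step
  is proper.\<close>

lemma good_stepI:
  assumes "p0 \<in> Q" "p0 \<notin> P" "P \<subseteq> Q" "Q \<subseteq> idx TYPE('n::finite) q"
    and cls: "\<And>m l k. (m, l, k) \<in> Q \<Longrightarrow> (m, l, k) \<notin> P \<Longrightarrow> cls CARD('n) (m, l, k) = c \<and> (l = 0 \<longleftrightarrow> z)"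
    and ex: "CARD('n) = 2 \<Longrightarrow> z \<Longrightarrow> [q = 2] (mod 4) \<Longrightarrow> c = 0 \<Longrightarrow> b"
  shows "good_step TYPE('n) q b P Q"
  unfolding good_step_def
proof (intro conjI allI impI)
  show "P \<subset> Q" using assms by blast
  fix R assume R: "good TYPE('n) q b R" "P \<subseteq> R" "R \<subseteq> Q"
  show "R = P \<or> R = Q"
  proof (cases "R = P")
    case False
    then obtain m l k where p: "(m, l, k) \<in> R" "(m, l, k) \<notin> P" using R(2) by auto
    have pQ: "(m, l, k) \<in> Q" using p R(3) by blast
    have "(m', l', k') \<in> R" if p': "(m', l', k') \<in> Q" "(m', l', k') \<notin> P" for m' l' k'
    proof (cases "CARD('n) = 2 \<and> z \<and> [q = 2] (mod 4) \<and> c = 0")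
      case True
      then have "b" using ex by blast
      moreover have "l = 0" "l' = 0" using cls[OF pQ p(2)] cls[OF p'] True by auto
      ultimately show ?thesis
        using closed_connected_sym[where 'n='n, of q R m k m' k'] True R(1) p pQ p' assms(4) cls[OF pQ p(2)] cls[OF p']
        by (auto simp: good_def)
    next
      case False
      show ?thesis
      proof (rule closed_connected[of R m l k q m' l' k'])
        show "moves_closed TYPE('n) R" using R(1) by (simp add: good_def)
        show "(m, l, k) \<in> idx TYPE('n) q" "(m', l', k') \<in> idx TYPE('n) q" using pQ p' assms(4) by auto
        show "l' = 0 \<or> 1 \<le> l" using cls[OF pQ p(2)] cls[OF p'] by auto
      qed (use False p cls[OF pQ p(2)] cls[OF p'] in auto)
    qed
    then have "Q \<subseteq> R" using R(2) by auto
    then show ?thesis using R(3) by blast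
  qed simp
qed

section \<open>From Lie algebra submodules to closed index sets\<close>

lemma linear_op_plus: "linear_op S \<Longrightarrow> linear_op T \<Longrightarrow> linear_op (\<lambda>F. S F + T F)"
  by (simp add: linear_op_def cfun.scale_right_distrib)

lemma linear_op_scale: "linear_op T \<Longrightarrow> linear_op (\<lambda>F. fscale c (T F))"
  by (simp add: linear_op_def cfun.scale_right_distrib mult.commute)

lemma linear_op_sum: "(\<And>i. i \<in> I \<Longrightarrow> linear_op (T i)) \<Longrightarrow> linear_op (\<lambda>F. \<Sum>i\<in>I. T i F)"
  by (simp add: linear_op_def sum.distrib cfun.scale_sum_right)

lemma linear_op_ident: "linear_op (\<lambda>F. F)"
  by (simp add: linear_op_def)

lemma linear_op_schr_act: "linear_op (schr_act s x)"
proof -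
  obtain X A u v w where x: "x = (X, A, u, v, w)" by (cases x)
  show ?thesis
    unfolding x schr_act_def prod.case act_sl2_def act_heis_def Let_def
    by (intro linear_op_plus linear_op_scale linear_op_sum linear_op_kappa linear_op_eta_plus
        linear_op_eta_minus linear_op_so linear_op_E_plus linear_op_E_minus linear_op_ident)
qed

text \<open>The algebra is real while the listed operators belong to its complexification. As N is a
  complex subspace, each operator can be recovered as a complex combination of actions of real
  elements.\<close>

lemma op_stable_iff:
  fixes N :: "'n::finite func set"
  assumes N: "cfun.subspace N"
  shows "op_stable s N \<longleftrightarrow> (\<forall>x\<in>schr_algebra. \<forall>F\<in>N. schr_act s x F \<in> N)"
proof
  assume "op_stable s N"
  then show "\<forall>x\<in>schr_algebra. \<forall>F\<in>N. schr_act s x F \<in> N"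
    unfolding op_stable_def schr_algebra_def schr_act_def act_sl2_def act_heis_def Let_def
    by (auto intro!: cfun.subspace_add[OF N] cfun.subspace_scale[OF N] cfun.subspace_sum[OF N])
next
  assume act: "\<forall>x\<in>schr_algebra. \<forall>F\<in>N. schr_act s x F \<in> N"
  have so0: "op_so 0 F = 0" for F :: "'n func"
    by (simp add: op_so_def fun_eq_iff zero_fun_apply)
  have heis0: "act_heis s 0 0 0 F = 0" for F :: "'n func"
    by (simp add: act_heis_def)
  have sl0: "act_sl2 s 0 F = 0" for F :: "'n func"
    by (simp add: act_sl2_def)
  have sl: "act_sl2 s X F \<in> N" if "F \<in> N" "trace X = 0" for F X
  proof -
    have "(X, 0, 0, 0, 0) \<in> schr_algebra" using that by (simp add: schr_algebra_def transpose_def vec_eq_iff)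
    then have "schr_act s (X, 0, 0, 0, 0) F \<in> N" using act that by blast
    then show ?thesis by (simp add: schr_act_def so0 heis0)
  qed
  have so: "op_so A F \<in> N" if "F \<in> N" "transpose A = - A" for F A
  proof -
    have "(0, A, 0, 0, 0) \<in> schr_algebra" using that by (simp add: schr_algebra_def trace_def)
    then have "schr_act s (0, A, 0, 0, 0) F \<in> N" using act that by blast
    then show ?thesis by (simp add: schr_act_def sl0 heis0)
  qed
  have he: "act_heis s u v 0 F \<in> N" if "F \<in> N" for F u v
  proof -
    have "(0, 0, u, v, 0) \<in> schr_algebra" by (simp add: schr_algebra_def trace_def transpose_def vec_eq_iff)
    then have "schr_act s (0, 0, u, v, 0) F \<in> N" using act that by blast
    then show ?thesis by (simp add: schr_act_def sl0 so0)
  qed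
  note add = cfun.subspace_add[OF N] and sc = cfun.subspace_scale[OF N]
  have kappa: "op_kappa F \<in> N" if "F \<in> N" for F
  proof -
    have "act_sl2 s (vector [vector [0, 1], vector [-1, 0]]) F = fscale \<i> (op_kappa F)"
      by (simp add: act_sl2_def Let_def)
    then have "fscale \<i> (op_kappa F) \<in> N"
      using sl[OF that, of "vector [vector [0, 1], vector [-1, 0]]"] by (simp add: trace_def sum_2)
    then show ?thesis by (rule unscale[OF N]) simp
  qed
  have eta: "op_eta_plus s F \<in> N \<and> op_eta_minus s F \<in> N" if "F \<in> N" for F
  proof -
    \<comment> \<open>h acts as the sum of the two operators, and e+ + e- as -i times their
      difference; half the sum and difference of suitable multiples isolates each.\<close>
    have "act_sl2 s (vector [vector [1, 0], vector [0, -1]]) F = op_eta_plus s F + op_eta_minus s F"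
      by (simp add: act_sl2_def Let_def)
    then have 1: "op_eta_plus s F + op_eta_minus s F \<in> N"
      using sl[OF that, of "vector [vector [1, 0], vector [0, -1]]"] by (simp add: trace_def sum_2)
    have "act_sl2 s (vector [vector [0, 1], vector [1, 0]]) F = fscale (- \<i>) (op_eta_plus s F) + fscale \<i> (op_eta_minus s F)"
      by (simp add: act_sl2_def Let_def)
    then have 2: "fscale (- \<i>) (op_eta_plus s F) + fscale \<i> (op_eta_minus s F) \<in> N"
      using sl[OF that, of "vector [vector [0, 1], vector [1, 0]]"] by (simp add: trace_def sum_2)
    have "fscale (1/2) (op_eta_plus s F + op_eta_minus s F) + fscale (\<i>/2) (fscale (- \<i>) (op_eta_plus s F) + fscale \<i> (op_eta_minus s F)) = op_eta_plus s F"
      "fscale (1/2) (op_eta_plus s F + op_eta_minus s F) + fscale (- \<i>/2) (fscale (- \<i>) (op_eta_plus s F) + fscale \<i> (op_eta_minus s F)) = op_eta_minus s F"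
      by (simp_all add: fscale_def fun_eq_iff plus_fun_apply field_simps)
    then show ?thesis using add[OF sc[OF 1] sc[OF 2]] by metis
  qed
  have E: "op_E_plus s j F \<in> N \<and> op_E_minus s j F \<in> N" if "F \<in> N" for F j
  proof -
    have pick: "(\<Sum>i\<in>UNIV. fscale (c * of_real (axis j 1 $ i)) (G i)) = fscale c (G j)" for c and G :: "'n \<Rightarrow> 'n func"
    proof -
      have "(\<Sum>i\<in>UNIV. fscale (c * of_real (axis j 1 $ i)) (G i)) = (\<Sum>i\<in>UNIV. if i = j then fscale c (G i) else 0)"
        by (intro sum.cong) (auto simp: axis_def)
      then show ?thesis by simp
    qed
    have "act_heis s 0 (axis j 1) 0 F = (\<Sum>i\<in>UNIV. fscale (1/2 * of_real (axis j 1 $ i)) (op_E_minus s i F)) +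
        (\<Sum>i\<in>UNIV. fscale (1/2 * of_real (axis j 1 $ i)) (op_E_plus s i F))"
      by (simp add: act_heis_def sum.distrib sum_negf sum_subtractf)
    then have 1: "fscale (1/2) (op_E_minus s j F) + fscale (1/2) (op_E_plus s j F) \<in> N"
      using he[OF that, of 0 "axis j 1"] unfolding pick by simp
    have "act_heis s (axis j 1) 0 0 F = (\<Sum>i\<in>UNIV. fscale (- \<i>/2 * of_real (axis j 1 $ i)) (op_E_minus s i F)) +
        (\<Sum>i\<in>UNIV. fscale (\<i>/2 * of_real (axis j 1 $ i)) (op_E_plus s i F))"
      by (simp add: act_heis_def sum.distrib sum_negf sum_subtractf)
    then have 2: "fscale (- \<i>/2) (op_E_minus s j F) + fscale (\<i>/2) (op_E_plus s j F) \<in> N"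
      using he[OF that, of "axis j 1" 0] unfolding pick by simp
    have "fscale 1 (fscale (1/2) (op_E_minus s j F) + fscale (1/2) (op_E_plus s j F)) +
        fscale (- \<i>) (fscale (- \<i>/2) (op_E_minus s j F) + fscale (\<i>/2) (op_E_plus s j F)) = op_E_plus s j F"
      "fscale 1 (fscale (1/2) (op_E_minus s j F) + fscale (1/2) (op_E_plus s j F)) +
        fscale \<i> (fscale (- \<i>/2) (op_E_minus s j F) + fscale (\<i>/2) (op_E_plus s j F)) = op_E_minus s j F"
      by (simp_all add: fscale_def fun_eq_iff plus_fun_apply field_simps)
    then show ?thesis using add[OF sc[OF 1] sc[OF 2]] by metis
  qed
  show "op_stable s N" unfolding op_stable_def using kappa eta E so by blast
qed

lemma submodule_schr_iff:
  "gm_submodule (schr_module s W) N \<longleftrightarrow> N \<subseteq> W \<and> cfun.subspace N \<and> op_stable s N"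
proof -
  have "gm_submodule (schr_module s W) N \<longleftrightarrow>
      N \<subseteq> W \<and> cfun.subspace N \<and> (\<forall>x\<in>schr_algebra. \<forall>F\<in>N. schr_act s x F \<in> N)"
    by (auto simp: gm_submodule_def schr_module_def cfun.subspace_def)
  then show ?thesis using op_stable_iff by blast
qed

lemma index_module_schr:
  assumes "s \<noteq> 0"
  shows "index_module (schr_module s (blocks s (idx TYPE('n::finite) q) :: 'n func set)) s q False"
proof -
  let ?M = "schr_module s (blocks s (idx TYPE('n) q) :: 'n func set)"
  have "gm_submodule ?M N \<longleftrightarrow> (\<exists>P. good TYPE('n) q False P \<and> N = blocks s P)" for N
  proof
    assume "gm_submodule ?M N"
    then have N: "cfun.subspace N" "op_stable s N" "N \<subseteq> blocks s (idx TYPE('n) q)"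
      by (auto simp: submodule_schr_iff)
    show "\<exists>P. good TYPE('n) q False P \<and> N = blocks s P"
      using stable_eq_blocks[OF assms N] stable_moves_closed[OF assms N(1,2), of q]
      by (intro exI[of _ "{p \<in> idx TYPE('n) q. block s p \<subseteq> N}"]) (auto simp: good_def)
  next
    assume "\<exists>P. good TYPE('n) q False P \<and> N = blocks s P"
    then obtain P where P: "P \<subseteq> idx TYPE('n) q" "moves_closed TYPE('n) P" "N = blocks s P"
      by (auto simp: good_def)
    then show "gm_submodule ?M N"
      unfolding submodule_schr_iff P(3) using blocks_mono[OF P(1)] subspace_blocks op_stable_blocks[OF P(1,2)] by blast
  qed
  moreover have "schr_act s x (F + G) = schr_act s x F + schr_act s x G"
    if "F \<in> blocks s (idx TYPE('n) q)" "G \<in> blocks s (idx TYPE('n) q)" for x and F G :: "'n func"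
    using linear_op_schr_act[of s x] diffable_blocks that unfolding linear_op_def by blast
  ultimately show ?thesis
    unfolding index_module_def by (simp add: schr_module_def)
qed

lemma matrix_inv_orthogonal:
  fixes u :: "real ^ 'n ^ 'n::finite"
  assumes "orthogonal_matrix u"
  shows "matrix_inv u = transpose u"
proof -
  have u: "u ** transpose u = mat 1" "transpose u ** u = mat 1" using assms by (auto simp: orthogonal_matrix_def)
  have "u ** matrix_inv u = mat 1 \<and> matrix_inv u ** u = mat 1"
    unfolding matrix_inv_def by (rule someI[of _ "transpose u"]) (use u in simp)
  then have "transpose u ** (u ** matrix_inv u) = transpose u" by simp
  then show ?thesis by (simp add: matrix_mul_assoc u)
qed

lemma norm_orthogonal:
  fixes B :: "real ^ 'n ^ 'n::finite"
  assumes "orthogonal_matrix B"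
  shows "norm (B *v y) = norm y"
proof -
  have "orthogonal_transformation ((*v) B)"
    using assms by (simp add: orthogonal_transformation_matrix)
  then show ?thesis by (rule orthogonal_transformation_norm)
qed

lemma bfun_orthogonal:
  fixes B :: "real ^ 'n ^ 'n::finite"
  assumes "orthogonal_matrix B"
  shows "(\<lambda>\<theta> y. bfun s m l d h \<theta> (B *v y)) = bfun s m l d (\<lambda>y. h (B *v y))"
  by (simp add: bfun_def norm_orthogonal[OF assms])

text \<open>In the plane an orthogonal map sends \<open>harm_space k\<close> into itself or into
  \<open>harm_space (- k)\<close> and fixes the radial factor, so symmetry of P in k is sufficient
  for invariance.\<close>

lemma blocks_orthogonal:
  fixes B :: "real ^ 'n ^ 'n::finite"
  assumes n: "CARD('n) = 2" and B: "orthogonal_matrix B" and P: "\<And>m l k. (m, l, k) \<in> P \<Longrightarrow> (m, l, - k) \<in> P"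
    and F: "F \<in> blocks s P"
  shows "(\<lambda>\<theta> y. F \<theta> (B *v y)) \<in> blocks s P"
proof -
  let ?W = "{F. (\<lambda>\<theta> y. F \<theta> (B *v y)) \<in> blocks s P}"
  have "cfun.subspace ?W"
  proof -
    have e: "(\<lambda>\<theta> y. (F + G) \<theta> (B *v y)) = (\<lambda>\<theta> y. F \<theta> (B *v y)) + (\<lambda>\<theta> y. G \<theta> (B *v y))"
      "(\<lambda>\<theta> y. fscale c F \<theta> (B *v y)) = fscale c (\<lambda>\<theta> y. F \<theta> (B *v y))"
      "(\<lambda>\<theta> y. (0 :: 'n func) \<theta> (B *v y)) = 0" for F G :: "'n func" and c
      by (simp_all add: fun_eq_iff plus_fun_apply zero_fun_apply fscale_def)
    show ?thesis
      unfolding cfun.subspace_def mem_Collect_eq e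
      by (intro conjI ballI allI cfun.subspace_0[OF subspace_blocks] cfun.subspace_add[OF subspace_blocks]
          cfun.subspace_scale[OF subspace_blocks]) auto
  qed
  then have "blocks s P \<subseteq> ?W"
  proof (rule blocks_least)
    fix p assume p: "p \<in> P"
    show "block s p \<subseteq> ?W"
    proof
      fix F :: "'n func" assume Fp: "F \<in> block s p"
      obtain m l k where pe: "p = (m, l, k)" by (cases p)
      then obtain h where h: "h \<in> harm_space k" "F = bfun s m l (nat \<bar>k\<bar>) h" using Fp by (auto simp: block_iff)
      from harm_space_orthogonal[OF n B h(1)]
      have "bfun s m l (nat \<bar>k\<bar>) (\<lambda>y. h (B *v y)) \<in> block s (m, l, k) \<or>
          bfun s m l (nat \<bar>k\<bar>) (\<lambda>y. h (B *v y)) \<in> block s (m, l, - k)"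
        using bfun_in_block by fastforce
      moreover have "block s (m, l, k) \<subseteq> (blocks s P :: 'n func set)" "block s (m, l, - k) \<subseteq> (blocks s P :: 'n func set)"
        using block_subset_blocks[of "(m, l, k)" P s] block_subset_blocks[of "(m, l, - k)" P s] P[of m l k] p pe by auto
      ultimately show "F \<in> ?W" unfolding mem_Collect_eq h(2) bfun_orthogonal[OF B] by blast
    qed
  qed
  then show ?thesis using F by blast
qed

text \<open>Changes the sign of the second planar coordinate, which for n = 2 is complex conjugation
  of \<open>planar\<close>. This one element suffices to derive the symmetry of an invariant index
  set.\<close>

definition reflection :: "real ^ 'n ^ 'n::finite" where
  "reflection = (\<chi> i j. if i = j then if i = from_nat_into UNIV 1 then -1 else 1 else 0)"

lemma reflection_mult: "reflection *v y = (\<chi> i. if i = from_nat_into UNIV 1 then - y $ i else y $ i)"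
  by (simp add: vec_eq_iff reflection_def matrix_vector_mult_def if_distrib[of "\<lambda>x. x * _"] cong: if_cong)

lemma transpose_reflection: "transpose reflection = reflection"
  by (auto simp: vec_eq_iff transpose_def reflection_def)

lemma orthogonal_reflection: "orthogonal_matrix (reflection :: real ^ 'n ^ 'n::finite)"
proof -
  have "(reflection ** reflection) *v y = y" for y :: "real ^ 'n"
    unfolding matrix_vector_mul_assoc[symmetric] reflection_mult by (simp add: vec_eq_iff)
  then have "(reflection ** reflection :: real ^ 'n ^ 'n) = mat 1"
    by (metis matrix_eq matrix_vector_mul_lid)
  then show ?thesis by (simp add: orthogonal_matrix transpose_reflection)
qed

lemma planar_of_reflection:
  assumes "CARD('n::finite) = 2" "k \<noteq> 0"
  shows "planar_of k (reflection *v y) = planar_of (- k) (y :: real ^ 'n)"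
  using from_nat_into_neq[where 'n='n] assms
  by (auto simp: planar_of_eq reflection_mult i_of_def)

lemma idx_uminus: "CARD('n::finite) = 2 \<Longrightarrow> (m, l, k) \<in> idx TYPE('n) q \<Longrightarrow> (m, l, - k) \<in> idx TYPE('n) q"
proof -
  assume n: "CARD('n) = 2" and "(m, l, k) \<in> idx TYPE('n) q"
  then have "[m = 2 * k + q] (mod 4)" by (simp only: idx_def mem_Collect_eq prod.case)
  then have "[m = 2 * (- k) + q] (mod 4)" unfolding cong_iff_dvd_diff by presburger
  then show ?thesis using n by (simp only: idx_def harm_indices_def mem_Collect_eq prod.case) simp
qed

lemma ball_Plus: "(\<forall>x\<in>A <+> B. P x) \<longleftrightarrow> (\<forall>a\<in>A. P (Inl a)) \<and> (\<forall>b\<in>B. P (Inr b))"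
  by auto

lemma index_module_schr_O:
  assumes s: "s \<noteq> 0" and n: "CARD('n::finite) = 2"
  shows "index_module (schr_O_module s (blocks s (idx TYPE('n) q) :: 'n func set)) s q True"
proof -
  let ?M = "schr_O_module s (blocks s (idx TYPE('n) q) :: 'n func set)"
  let ?L = "schr_module s (blocks s (idx TYPE('n) q) :: 'n func set)"
  have sub: "gm_submodule ?M N \<longleftrightarrow> gm_submodule ?L N \<and>
      (\<forall>u. orthogonal_matrix u \<longrightarrow> (\<forall>F\<in>N. (\<lambda>\<theta> y. F \<theta> (matrix_inv u *v y)) \<in> N))" for N
    by (simp add: gm_submodule_def schr_O_module_def schr_module_def ball_Plus conj_assoc)
  have "gm_submodule ?M N \<longleftrightarrow> (\<exists>P. good TYPE('n) q True P \<and> N = blocks s P)" for N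
  proof
    assume N: "gm_submodule ?M N"
    let ?R = "{p \<in> idx TYPE('n) q. block s p \<subseteq> N}"
    have L: "cfun.subspace N" "op_stable s N" "N \<subseteq> blocks s (idx TYPE('n) q)"
      using N by (auto simp: sub submodule_schr_iff)
    have "(m, l, - k) \<in> ?R" if "(m, l, k) \<in> ?R" for m l k
    proof (cases "k = 0")
      case False
      have "F \<in> N" if F: "F \<in> block s (m, l, - k)" for F :: "'n func"
      proof -
        obtain c where c: "F = bfun s m l (nat \<bar>k\<bar>) (\<lambda>y. c * planar_of (- k) y ^ nat \<bar>k\<bar>)"
          using F by (auto simp: block_iff harm_space_2[OF n])
        let ?G = "bfun s m l (nat \<bar>k\<bar>) (\<lambda>y :: real ^ 'n. c * planar_of k y ^ nat \<bar>k\<bar>)"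
        have "?G \<in> block s (m, l, k)" by (intro bfun_in_block) (auto simp: harm_space_2[OF n])
        then have "?G \<in> N" using \<open>(m, l, k) \<in> ?R\<close> by blast
        then have "(\<lambda>\<theta> y. ?G \<theta> (reflection *v y)) \<in> N"
          using N orthogonal_reflection unfolding sub
          by (metis matrix_inv_orthogonal transpose_reflection)
        then show ?thesis unfolding bfun_orthogonal[OF orthogonal_reflection] c
          by (simp add: planar_of_reflection[OF n False])
      qed
      then show ?thesis using that idx_uminus[OF n] by auto
    qed (use that in simp)
    then show "\<exists>P. good TYPE('n) q True P \<and> N = blocks s P"
      using stable_eq_blocks[OF s L] stable_moves_closed[OF s L(1,2), of q]
      by (intro exI[of _ ?R]) (auto simp: good_def)
  next
    assume "\<exists>P. good TYPE('n) q True P \<and> N = blocks s P"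
    then obtain P where P: "good TYPE('n) q True P" "N = blocks s P" by blast
    then have "good TYPE('n) q False P" by (simp add: good_def)
    then have "gm_submodule ?L N" using index_moduleD(5)[OF index_module_schr[OF s, of q]] P(2) by blast
    moreover have "(\<lambda>\<theta> y. F \<theta> (matrix_inv u *v y)) \<in> N" if "orthogonal_matrix u" "F \<in> N" for u F
      using blocks_orthogonal[OF n, of "matrix_inv u" P F s] that P
      by (auto simp: good_def matrix_inv_orthogonal)
    ultimately show "gm_submodule ?M N" by (simp add: sub)
  qed
  moreover have "schr_act s x (F + G) = schr_act s x F + schr_act s x G"
    if "F \<in> blocks s (idx TYPE('n) q)" "G \<in> blocks s (idx TYPE('n) q)" for x and F G :: "'n func"
    using linear_op_schr_act[of s x] diffable_blocks that unfolding linear_op_def by blast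
  ultimately show ?thesis
    unfolding index_module_def by (auto simp: schr_O_module_def fun_eq_iff plus_fun_apply)
qed

section \<open>The spaces of the theorem as spans of blocks\<close>

lemma span_UN_span: "cfun.span (\<Union>i\<in>I. cfun.span (B i)) = cfun.span (\<Union>i\<in>I. B i)"
proof
  have "cfun.span (B i) \<subseteq> cfun.span (\<Union>i\<in>I. B i)" if "i \<in> I" for i
    using that by (intro cfun.span_mono) auto
  then show "cfun.span (\<Union>i\<in>I. cfun.span (B i)) \<subseteq> cfun.span (\<Union>i\<in>I. B i)"
    by (intro cfun.span_minimal) auto
  show "cfun.span (\<Union>i\<in>I. B i) \<subseteq> cfun.span (\<Union>i\<in>I. cfun.span (B i))"
    using cfun.span_superset by (intro cfun.span_mono) blast
qed

text \<open>Under the congruence all values of \<open>wt_minus\<close> are multiples of 4, so class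
  1 reduces to the inequality that defines the spaces.\<close>

lemma idx_plus_iff:
  assumes "[q = int CARD('n::finite)] (mod 4)"
  shows "(m, l, k) \<in> idx_plus TYPE('n) q \<longleftrightarrow> (m, l, k) \<in> idx TYPE('n) q \<and> m \<ge> 2 * \<bar>k\<bar> + 4 * int l + int CARD('n)"
proof -
  have n: "CARD('n) \<ge> 1" by (simp add: Suc_leI)
  show ?thesis using wt_minus_dvd[of m l k "TYPE('n)" q "CARD('n)"] assms
    by (auto simp: idx_plus_def cls_plus_iff[OF n] wt_minus_def)
qed

lemma idx_minus_iff:
  assumes "[q = - int CARD('n::finite)] (mod 4)"
  shows "(m, l, k) \<in> idx_minus TYPE('n) q \<longleftrightarrow> (m, l, k) \<in> idx TYPE('n) q \<and> m \<le> - (2 * \<bar>k\<bar> + 4 * int l + int CARD('n))"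
  using wt_plus_dvd[of m l k "TYPE('n)" q "CARD('n)"] assms
  by (auto simp: idx_minus_def cls_minus_iff wt_plus_def)

lemma blocks_eq_span:
  "blocks s P = cfun.span {basic_fun s m l k h | m l k h. (m, l, k) \<in> P \<and> h \<in> harm_space k}"
  unfolding blocks_def by (rule arg_cong[where f = cfun.span]) (auto simp: block_def)

lemma span_UN_UN_span: "cfun.span (\<Union>i\<in>I. \<Union>j\<in>J. cfun.span (B i j)) = cfun.span (\<Union>i\<in>I. \<Union>j\<in>J. B i j)"
proof -
  have "(\<Union>i\<in>I. \<Union>j\<in>J. cfun.span (B i j)) = (\<Union>p\<in>I \<times> J. cfun.span (B (fst p) (snd p)))"
    "(\<Union>i\<in>I. \<Union>j\<in>J. B i j) = (\<Union>p\<in>I \<times> J. B (fst p) (snd p))"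
    by (auto 4 4)
  then show ?thesis by (simp only: span_UN_span)
qed

lemma H_all_eq: "H_all s q = (blocks s (idx TYPE('n::finite) q) :: 'n func set)"
  unfolding H_all_def H_comp_def blocks_eq_span span_UN_UN_span
  by (rule arg_cong[where f = cfun.span]) (auto simp: idx_def)

lemma H_zero_eq: "H_zero s q = (blocks s (idx_zero TYPE('n::finite) q) :: 'n func set)"
  unfolding H_zero_def H_comp_def blocks_eq_span span_UN_span
  by (rule arg_cong[where f = cfun.span]) (auto simp: idx_def idx_zero_def)

lemma H_plus_eq:
  assumes q: "[q = int CARD('n::finite)] (mod 4)"
  shows "H_zero_plus s q = (blocks s (idx_zero TYPE('n) q \<inter> idx_plus TYPE('n) q) :: 'n func set)"
    and "H_plus s q = (blocks s (idx_plus TYPE('n) q - idx_zero TYPE('n) q) :: 'n func set)"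
proof -
  show "H_zero_plus s q = (blocks s (idx_zero TYPE('n) q \<inter> idx_plus TYPE('n) q) :: 'n func set)"
    unfolding H_zero_plus_def H_comp_plus_def blocks_eq_span span_UN_span
    by (rule arg_cong[where f = cfun.span]) (auto simp: idx_plus_iff[OF q] idx_def idx_zero_def)
  have "(m, l, k) \<in> idx_plus TYPE('n) q - idx_zero TYPE('n) q \<longleftrightarrow> k \<in> harm_indices TYPE('n) \<and> l \<in> {1..} \<and>
      [m = 2 * k + q] (mod 4) \<and> m \<ge> 2 * \<bar>k\<bar> + 4 * int l + int CARD('n)" for m l k
    by (auto simp: idx_plus_iff[OF q] idx_def idx_zero_def)
  then show "H_plus s q = (blocks s (idx_plus TYPE('n) q - idx_zero TYPE('n) q) :: 'n func set)"
    unfolding H_plus_def H_comp_plus_def blocks_eq_span span_UN_UN_span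
    by (intro arg_cong[where f = cfun.span]) auto
qed

lemma H_minus_eq:
  assumes q: "[q = - int CARD('n::finite)] (mod 4)"
  shows "H_zero_minus s q = (blocks s (idx_zero TYPE('n) q \<inter> idx_minus TYPE('n) q) :: 'n func set)"
    and "H_minus s q = (blocks s (idx_minus TYPE('n) q - idx_zero TYPE('n) q) :: 'n func set)"
proof -
  show "H_zero_minus s q = (blocks s (idx_zero TYPE('n) q \<inter> idx_minus TYPE('n) q) :: 'n func set)"
    unfolding H_zero_minus_def H_comp_minus_def blocks_eq_span span_UN_span
    by (rule arg_cong[where f = cfun.span]) (auto simp: idx_minus_iff[OF q] idx_def idx_zero_def)
  have "(m, l, k) \<in> idx_minus TYPE('n) q - idx_zero TYPE('n) q \<longleftrightarrow> k \<in> harm_indices TYPE('n) \<and> l \<in> {1..} \<and>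
      [m = 2 * k + q] (mod 4) \<and> m \<le> - (2 * \<bar>k\<bar> + 4 * int l + int CARD('n))" for m l k
    by (auto simp: idx_minus_iff[OF q] idx_def idx_zero_def)
  then show "H_minus s q = (blocks s (idx_minus TYPE('n) q - idx_zero TYPE('n) q) :: 'n func set)"
    unfolding H_minus_def H_comp_minus_def blocks_eq_span span_UN_UN_span
    by (intro arg_cong[where f = cfun.span]) auto
qed

section \<open>Assembling the composition series\<close>

lemma good_sets:
  assumes "b \<longrightarrow> CARD('n::finite) = 2"
  shows "good TYPE('n) q b {}" "good TYPE('n) q b (idx TYPE('n) q)" "good TYPE('n) q b (idx_zero TYPE('n) q)"
    "good TYPE('n) q b (idx_plus TYPE('n) q)" "good TYPE('n) q b (idx_minus TYPE('n) q)"
proof -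
  have cls: "cls N (m, l, - k) = cls N (m, l, k)" for N m l k
    by (simp add: cls_def wt_plus_def wt_minus_def)
  show "good TYPE('n) q b {}" "good TYPE('n) q b (idx TYPE('n) q)" "good TYPE('n) q b (idx_zero TYPE('n) q)"
    "good TYPE('n) q b (idx_plus TYPE('n) q)" "good TYPE('n) q b (idx_minus TYPE('n) q)"
    using assms idx_uminus[where 'n='n, of _ _ _ q] moves_closed_empty[of "TYPE('n)"] moves_closed_idx[where 'n='n, of q]
      moves_closed_idx_zero[where 'n='n, of q] moves_closed_idx_plus[where 'n='n, of q] moves_closed_idx_minus[where 'n='n, of q]
    by (auto simp: good_def idx_zero_def idx_plus_def idx_minus_def cls)
qed

lemma good_Un: "good T q b P \<Longrightarrow> good T q b Q \<Longrightarrow> good T q b (P \<union> Q)"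
  by (auto simp: good_def moves_closed_Un)

lemma good_Int: "good T q b P \<Longrightarrow> good T q b Q \<Longrightarrow> good T q b (P \<inter> Q)"
  by (auto simp: good_def moves_closed_Int)

lemma cls_cases: "cls N p = -1 \<or> cls N p = 0 \<or> cls N p = 1"
  by (simp add: cls_def wt_class_def)

lemma cls_neq_minus:
  "\<not> [q = - int CARD('n::finite)] (mod 4) \<Longrightarrow> (m, l, k) \<in> idx TYPE('n) q \<Longrightarrow> cls CARD('n) (m, l, k) \<noteq> -1"
  using wt_plus_dvd[of m l k "TYPE('n)" q "CARD('n)"] by (simp add: cls_minus_iff)

lemma cls_neq_plus:
  "\<not> [q = int CARD('n::finite)] (mod 4) \<Longrightarrow> (m, l, k) \<in> idx TYPE('n) q \<Longrightarrow> cls CARD('n) (m, l, k) \<noteq> 1"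
  using wt_minus_dvd[of m l k "TYPE('n)" q "CARD('n)"] by (auto simp: cls_def wt_class_def)

text \<open>The first index has C = 0, the boundary of class 1. The second has A = 2n + 4l and C =
  4l + 4, both positive; k = 1 is taken because for n = 2, l = 0 class 0 contains no index with k =
  0.\<close>

lemma plus_witness:
  assumes "[q = int CARD('n::finite)] (mod 4)"
  shows "(int CARD('n) + 4 * int l, l, 0) \<in> idx TYPE('n) q" "cls CARD('n) (int CARD('n) + 4 * int l, l, 0) = 1"
    "(int CARD('n) - 2, l, 1) \<in> idx TYPE('n) q" "cls CARD('n) (int CARD('n) - 2, l, 1) = 0"
proof -
  have n: "CARD('n) \<ge> 1" by (simp add: Suc_leI)
  have K: "0 \<in> harm_indices TYPE('n)" "1 \<in> harm_indices TYPE('n)" by (auto simp: harm_indices_def)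
  have "[int CARD('n) + 4 * int l = 2 * 0 + q] (mod 4)" "[int CARD('n) - 2 = 2 * 1 + q] (mod 4)"
    using assms unfolding cong_iff_dvd_diff by presburger+
  then show "(int CARD('n) + 4 * int l, l, 0) \<in> idx TYPE('n) q" "(int CARD('n) - 2, l, 1) \<in> idx TYPE('n) q"
    using K by (simp_all add: idx_def)
  show "cls CARD('n) (int CARD('n) + 4 * int l, l, 0) = 1"
    by (simp add: cls_plus_iff[OF n] wt_minus_def)
  show "cls CARD('n) (int CARD('n) - 2, l, 1) = 0"
  proof -
    have "2 * int CARD('n) + 4 * int l > 0" using n by linarith
    then show ?thesis by (simp add: cls_def wt_class_def wt_plus_def wt_minus_def)
  qed
qed

lemma minus_witness:
  assumes "[q = - int CARD('n::finite)] (mod 4)"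
  shows "(- int CARD('n) - 4 * int l, l, 0) \<in> idx TYPE('n) q" "cls CARD('n) (- int CARD('n) - 4 * int l, l, 0) = -1"
    "(2 - int CARD('n), l, 1) \<in> idx TYPE('n) q" "cls CARD('n) (2 - int CARD('n), l, 1) = 0"
proof -
  have n: "CARD('n) \<ge> 1" by (simp add: Suc_leI)
  have K: "0 \<in> harm_indices TYPE('n)" "1 \<in> harm_indices TYPE('n)" by (auto simp: harm_indices_def)
  have "[- int CARD('n) - 4 * int l = 2 * 0 + q] (mod 4)" "[2 - int CARD('n) = 2 * 1 + q] (mod 4)"
    using assms unfolding cong_iff_dvd_diff by presburger+
  then show "(- int CARD('n) - 4 * int l, l, 0) \<in> idx TYPE('n) q" "(2 - int CARD('n), l, 1) \<in> idx TYPE('n) q"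
    using K by (simp_all add: idx_def)
  show "cls CARD('n) (- int CARD('n) - 4 * int l, l, 0) = -1"
    by (simp add: cls_minus_iff wt_plus_def)
  show "cls CARD('n) (2 - int CARD('n), l, 1) = 0"
  proof -
    have "2 * int CARD('n) + 4 * int l > 0" using n by linarith
    then show ?thesis by (simp add: cls_def wt_class_def wt_plus_def wt_minus_def)
  qed
qed

lemma restrict_submodule:
  "gm_submodule M N \<Longrightarrow> gm_submodule (gm_restrict M N) N' \<longleftrightarrow> N' \<subseteq> N \<and> gm_submodule M N'"
  by (auto simp: gm_submodule_def gm_restrict_def)

text \<open>Without either congruence every index has class 0, so from any index a closed set
  reaches all indices with l = 0: every nonzero submodule contains this one. The exceptional case
  would need n = 2 and q congruent to 2, that is q congruent to n.\<close>

lemma unique_irreducible: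
  fixes M :: "('x, 'n::finite func) gmod"
  assumes M: "index_module M s q b"
    and b: "b \<longrightarrow> CARD('n) = 2"
    and q: "\<not> [q = int CARD('n)] (mod 4)" "\<not> [q = - int CARD('n)] (mod 4)"
  shows "{N. gm_submodule M N \<and> gm_irreducible (gm_restrict M N)} = {blocks s (idx_zero TYPE('n) q)}"
proof -
  note M' = index_moduleD[OF M]
  note good0 = good_sets(3)[OF b, of q]
  let ?Z = "idx_zero TYPE('n) q"
  have cls0: "cls CARD('n) (m, l, k) = 0" if "(m, l, k) \<in> idx TYPE('n) q" for m l k
    using cls_cases[of "CARD('n)" "(m, l, k)"] cls_neq_minus[OF q(2) that] cls_neq_plus[OF q(1) that] by auto
  have all: "?Z \<subseteq> R" if R: "good TYPE('n) q b R" and p: "(m, l, k) \<in> R" for R m l k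
  proof
    fix p' assume "p' \<in> ?Z"
    then obtain m' k' where p': "p' = (m', 0, k')" "(m', 0, k') \<in> idx TYPE('n) q" by (auto simp: idx_zero_def)
    have p_idx: "(m, l, k) \<in> idx TYPE('n) q" using R p by (auto simp: good_def)
    show "p' \<in> R"
      unfolding p'(1)
    proof (rule closed_connected[OF _ p p_idx p'(2)])
      show "moves_closed TYPE('n) R" using R by (simp add: good_def)
      show "\<not> (CARD('n) = 2 \<and> 0 = 0 \<and> [q = 2] (mod 4) \<and> cls CARD('n) (m, l, k) = 0)"
        using q(1) by auto
    qed (simp_all add: cls0[OF p_idx] cls0[OF p'(2)])
  qed
  have nz: "blocks s R \<noteq> ({0} :: 'n func set) \<longleftrightarrow> R \<noteq> {}" if "good TYPE('n) q b R" for R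
    using blocks_subset_iff[of R q "{}" s] that by (auto simp: good_def blocks_empty)
  have sub: "gm_submodule M (blocks s R)" if "good TYPE('n) q b R" for R using M'(5) that by blast
  have "?Z \<noteq> {}"
  proof -
    have "(q, 0, 0) \<in> ?Z" by (simp add: idx_zero_def idx_def harm_indices_def)
    then show ?thesis by blast
  qed
  have irr: "gm_irreducible (gm_restrict M (blocks s ?Z))"
    unfolding gm_irreducible_def restrict_submodule[OF sub[OF good0]]
  proof (intro conjI allI impI)
    show "gm_carrier (gm_restrict M (blocks s ?Z)) \<noteq> {gm_zero (gm_restrict M (blocks s ?Z))}"
      using nz[OF good0] \<open>?Z \<noteq> {}\<close> by (simp add: gm_restrict_def M'(1))
    fix N assume N: "N \<subseteq> blocks s ?Z \<and> gm_submodule M N"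
    then obtain R where R: "good TYPE('n) q b R" "N = blocks s R" using M'(5) by blast
    have "R \<subseteq> ?Z" using N R blocks_subset_iff[of R q ?Z s] good0 by (auto simp: good_def)
    have "R = {} \<or> R = ?Z"
    proof (cases "R = {}")
      case False
      then obtain m l k where "(m, l, k) \<in> R" by auto
      then show ?thesis using all[OF R(1)] \<open>R \<subseteq> ?Z\<close> by blast
    qed simp
    then show "N = {gm_zero (gm_restrict M (blocks s ?Z))} \<or> N = gm_carrier (gm_restrict M (blocks s ?Z))"
      using R(2) by (auto simp: gm_restrict_def M'(1) blocks_empty)
  qed
  have "N = blocks s ?Z" if N: "gm_submodule M N" "gm_irreducible (gm_restrict M N)" for N
  proof -
    obtain R where R: "good TYPE('n) q b R" "N = blocks s R" using M'(5) N by blast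
    have irrN: "N \<noteq> {0}" "\<And>N'. N' \<subseteq> N \<Longrightarrow> gm_submodule M N' \<Longrightarrow> N' = {0} \<or> N' = N"
      using N(2) unfolding gm_irreducible_def restrict_submodule[OF N(1)]
      by (simp_all add: gm_restrict_def M'(1))
    then have "R \<noteq> {}" using R(2) by (auto simp: blocks_empty)
    then obtain m l k where "(m, l, k) \<in> R" by auto
    then have "blocks s ?Z \<subseteq> N" unfolding R(2) by (intro blocks_mono all[OF R(1)])
    then show ?thesis using irrN(2)[OF _ sub[OF good0]] nz[OF good0] \<open>?Z \<noteq> {}\<close> by blast
  qed
  then show ?thesis using irr sub[OF good0] by blast
qed

text \<open>Treats both signs at once: P is the only closed class that occurs, u runs through
  indices in it, and v gives indices of class 0. The four differences are distinguished by class and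
  by l = 0 or l \<ge> 1.\<close>

lemma series_one:
  fixes M :: "('x, 'n::finite func) gmod"
  assumes M: "index_module M s q b" and b: "b \<longrightarrow> CARD('n) = 2"
    and P: "good TYPE('n) q b P" "P = {p \<in> idx TYPE('n) q. cls CARD('n) p = c}"
    and n2: "CARD('n) \<noteq> 2"
    and cc: "\<And>m l k. (m, l, k) \<in> idx TYPE('n) q \<Longrightarrow> cls CARD('n) (m, l, k) \<noteq> c \<Longrightarrow> cls CARD('n) (m, l, k) = 0"
    and w: "\<And>l. (u l, l, 0) \<in> idx TYPE('n) q" "\<And>l. cls CARD('n) (u l, l, 0) = c"
      "\<And>l. (v, l, 1) \<in> idx TYPE('n) q" "\<And>l. cls CARD('n) (v, l, 1) = 0" and c: "c \<noteq> 0"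
  shows "gm_composition_series M (map (blocks s) [{}, idx_zero TYPE('n) q \<inter> P, idx_zero TYPE('n) q,
    idx_zero TYPE('n) q \<union> P, idx TYPE('n) q])"
    (is "gm_composition_series M (map _ [{}, ?Z \<inter> P, ?Z, ?Z \<union> P, ?I])")
proof (rule composition_series_blocks[OF M])
  note gs = good_sets[OF b, of q] P(1)
  show "good TYPE('n) q b S" if "S \<in> set [{}, ?Z \<inter> P, ?Z, ?Z \<union> P, ?I]" for S
    using that by (auto intro!: good_Un good_Int gs)
  have s1: "good_step TYPE('n) q b {} (?Z \<inter> P)"
    by (rule good_stepI[of "(u 0, 0, 0)" _ _ q c True]) (use w n2 in \<open>auto simp: idx_zero_def P(2)\<close>)
  have s2: "good_step TYPE('n) q b (?Z \<inter> P) ?Z"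
    by (rule good_stepI[of "(v, 0, 1)" _ _ q 0 True]) (use w n2 cc c in \<open>auto simp: idx_zero_def P(2)\<close>)
  have s3: "good_step TYPE('n) q b ?Z (?Z \<union> P)"
    by (rule good_stepI[of "(u 1, 1, 0)" _ _ q c False]) (use w n2 in \<open>auto simp: idx_zero_def P(2)\<close>)
  have s4: "good_step TYPE('n) q b (?Z \<union> P) ?I"
    by (rule good_stepI[of "(v, 1, 1)" _ _ q 0 False]) (use w n2 cc c in \<open>auto simp: idx_zero_def P(2)\<close>)
  fix i assume "Suc i < length [{}, ?Z \<inter> P, ?Z, ?Z \<union> P, ?I]"
  then have "i = 0 \<or> i = 1 \<or> i = 2 \<or> i = 3" by auto
  then show "good_step TYPE('n) q b ([{}, ?Z \<inter> P, ?Z, ?Z \<union> P, ?I] ! i) ([{}, ?Z \<inter> P, ?Z, ?Z \<union> P, ?I] ! Suc i)"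
    using s1 s2 s3 s4 by (elim disjE) (simp_all add: numeral_2_eq_2 numeral_3_eq_3)
qed simp_all

text \<open>For n = 2 the numbers n and -n agree modulo 4, so exactly one congruence cannot hold.
  This keeps the exceptional case out of the series with a single sign.\<close>

lemma card_neq_2:
  assumes "[q = int CARD('n::finite)] (mod 4) \<noteq> [q = - int CARD('n)] (mod 4)"
  shows "CARD('n) \<noteq> 2"
  using assms unfolding cong_iff_dvd_diff by (intro notI) (simp, presburger)

lemma series_plus:
  fixes M :: "('x, 'n::finite func) gmod"
  assumes M: "index_module M s q b" and b: "b \<longrightarrow> CARD('n) = 2"
    and q: "[q = int CARD('n)] (mod 4)" "\<not> [q = - int CARD('n)] (mod 4)"
  shows "gm_composition_series M (map (blocks s) [{}, idx_zero TYPE('n) q \<inter> idx_plus TYPE('n) q, idx_zero TYPE('n) q,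
    idx_zero TYPE('n) q \<union> idx_plus TYPE('n) q, idx TYPE('n) q])"
proof (rule series_one[OF M b good_sets(4)[OF b] idx_plus_def card_neq_2[of q] _ plus_witness[OF q(1)]])
  fix m l k assume p: "(m, l, k) \<in> idx TYPE('n) q" "cls CARD('n) (m, l, k) \<noteq> 1"
  then show "cls CARD('n) (m, l, k) = 0"
    using cls_cases[of "CARD('n)" "(m, l, k)"] cls_neq_minus[OF q(2) p(1)] by simp
qed (use q in simp_all)

lemma series_minus:
  fixes M :: "('x, 'n::finite func) gmod"
  assumes M: "index_module M s q b" and b: "b \<longrightarrow> CARD('n) = 2"
    and q: "\<not> [q = int CARD('n)] (mod 4)" "[q = - int CARD('n)] (mod 4)"
  shows "gm_composition_series M (map (blocks s) [{}, idx_zero TYPE('n) q \<inter> idx_minus TYPE('n) q, idx_zero TYPE('n) q,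
    idx_zero TYPE('n) q \<union> idx_minus TYPE('n) q, idx TYPE('n) q])"
proof (rule series_one[OF M b good_sets(5)[OF b] idx_minus_def card_neq_2[of q] _ minus_witness[OF q(2)]])
  fix m l k assume p: "(m, l, k) \<in> idx TYPE('n) q" "cls CARD('n) (m, l, k) \<noteq> -1"
  then show "cls CARD('n) (m, l, k) = 0"
    using cls_cases[of "CARD('n)" "(m, l, k)"] cls_neq_plus[OF q(1) p(1)] by simp
qed (use q in simp_all)

text \<open>Three classes, each with l = 0 and with l \<ge> 1, give the six factors. For n = 2 the
  symmetry flag is required to hold, which means the module with the action of O(2).\<close>

lemma series_both:
  fixes M :: "('x, 'n::finite func) gmod"
  assumes M: "index_module M s q b" and b: "b \<longleftrightarrow> CARD('n) = 2"
    and q: "[q = int CARD('n)] (mod 4)" "[q = - int CARD('n)] (mod 4)"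
  shows "gm_composition_series M (map (blocks s) [{}, idx_zero TYPE('n) q \<inter> idx_minus TYPE('n) q,
    idx_zero TYPE('n) q \<inter> idx_plus TYPE('n) q \<union> idx_zero TYPE('n) q \<inter> idx_minus TYPE('n) q, idx_zero TYPE('n) q,
    idx_zero TYPE('n) q \<union> idx_minus TYPE('n) q, idx_zero TYPE('n) q \<union> idx_minus TYPE('n) q \<union> idx_plus TYPE('n) q, idx TYPE('n) q])"
    (is "gm_composition_series M (map _ [{}, ?Z \<inter> ?N, ?Z \<inter> ?P \<union> ?Z \<inter> ?N, ?Z, ?Z \<union> ?N, ?Z \<union> ?N \<union> ?P, ?I])")
proof (rule composition_series_blocks[OF M])
  have b': "b \<longrightarrow> CARD('n) = 2" using b by simp
  note gs = good_sets[OF b', of q]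
  let ?L = "[{}, ?Z \<inter> ?N, ?Z \<inter> ?P \<union> ?Z \<inter> ?N, ?Z, ?Z \<union> ?N, ?Z \<union> ?N \<union> ?P, ?I]"
  show "good TYPE('n) q b S" if "S \<in> set ?L" for S
    using that by (auto intro!: good_Un good_Int gs)
  note cc = cls_cases[of "CARD('n)"]
  note w = plus_witness[OF q(1), of 0] plus_witness[OF q(1), of 1] minus_witness[OF q(2), of 0] minus_witness[OF q(2), of 1]
  have s1: "good_step TYPE('n) q b {} (?Z \<inter> ?N)"
    by (rule good_stepI[of "(- int CARD('n) - 4 * int 0, 0, 0)" _ _ q "-1" True])
      (use w in \<open>auto simp: idx_zero_def idx_minus_def\<close>)
  have s2: "good_step TYPE('n) q b (?Z \<inter> ?N) (?Z \<inter> ?P \<union> ?Z \<inter> ?N)"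
    by (rule good_stepI[of "(int CARD('n) + 4 * int 0, 0, 0)" _ _ q 1 True])
      (use w in \<open>auto simp: idx_zero_def idx_minus_def idx_plus_def\<close>)
  \<comment> \<open>The only step with class 0 and l = 0, hence the only one where n = 2 calls on
    the symmetry in k.\<close>
  have s3: "good_step TYPE('n) q b (?Z \<inter> ?P \<union> ?Z \<inter> ?N) ?Z"
    by (rule good_stepI[of "(int CARD('n) - 2, 0, 1)" _ _ q 0 True])
      (use w cc b in \<open>auto simp: idx_zero_def idx_minus_def idx_plus_def\<close>)
  have s4: "good_step TYPE('n) q b ?Z (?Z \<union> ?N)"
    by (rule good_stepI[of "(- int CARD('n) - 4 * int 1, 1, 0)" _ _ q "-1" False])
      (use w in \<open>auto simp: idx_zero_def idx_minus_def\<close>)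
  have s5: "good_step TYPE('n) q b (?Z \<union> ?N) (?Z \<union> ?N \<union> ?P)"
    by (rule good_stepI[of "(int CARD('n) + 4 * int 1, 1, 0)" _ _ q 1 False])
      (use w in \<open>auto simp: idx_zero_def idx_minus_def idx_plus_def\<close>)
  have s6: "good_step TYPE('n) q b (?Z \<union> ?N \<union> ?P) ?I"
    by (rule good_stepI[of "(int CARD('n) - 2, 1, 1)" _ _ q 0 False])
      (use w cc in \<open>auto simp: idx_zero_def idx_minus_def idx_plus_def\<close>)
  fix i assume "Suc i < length ?L"
  then have "i = 0 \<or> i = 1 \<or> i = 2 \<or> i = 3 \<or> i = 4 \<or> i = 5" by auto
  then show "good_step TYPE('n) q b (?L ! i) (?L ! Suc i)"
    using s1 s2 s3 s4 s5 s6 by (elim disjE) (simp_all add: eval_nat_numeral)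
qed simp_all

theorem theorem3:
  fixes s :: complex and q :: int
  assumes "s \<noteq> 0"
  shows
    "let n = int CARD('n::finite);
         H = (H_all s q :: 'n func set); H0 = H_zero s q;
         H0p = H_zero_plus s q; H0m = H_zero_minus s q;
         Hp = H_plus s q; Hm = H_minus s q;
         M = schr_module s H;
         series4 = [{0}, H0m, subspace_sum H0p H0m, H0, subspace_sum H0 Hm,
           subspace_sum (subspace_sum H0 Hm) Hp, H]
     in
       gm_submodule M H \<and>
       (\<not> [q = n] (mod 4) \<and> \<not> [q = - n] (mod 4) \<longrightarrow>
          {N. gm_submodule M N \<and> gm_irreducible (gm_restrict M N)} = {H0}) \<and>
       ([q = n] (mod 4) \<and> \<not> [q = - n] (mod 4) \<longrightarrow>
          sum_is_direct H0 Hp \<and>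
          gm_composition_series M [{0}, H0p, H0, subspace_sum H0 Hp, H]) \<and>
       (\<not> [q = n] (mod 4) \<and> [q = - n] (mod 4) \<longrightarrow>
          sum_is_direct H0 Hm \<and>
          gm_composition_series M [{0}, H0m, H0, subspace_sum H0 Hm, H]) \<and>
       ([q = n] (mod 4) \<and> [q = - n] (mod 4) \<longrightarrow>
          sum_is_direct H0p H0m \<and>
          sum_is_direct H0 Hm \<and> sum_is_direct (subspace_sum H0 Hm) Hp \<and>
          (n \<noteq> 2 \<longrightarrow> gm_composition_series M series4) \<and>
          (n = 2 \<longrightarrow> gm_composition_series (schr_O_module s H) series4))"
proof -
  let ?I = "idx TYPE('n) q" and ?Z = "idx_zero TYPE('n) q" and ?P = "idx_plus TYPE('n) q" and ?N = "idx_minus TYPE('n) q"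
  let ?M = "schr_module s (blocks s ?I :: 'n func set)"
  note M = index_module_schr[OF assms, where 'n='n and q=q]
  note gs = good_sets[of False, where 'n='n and q=q, simplified]
  have sub: "gm_submodule ?M (blocks s ?I)" using index_moduleD(5)[OF M] gs(2) by blast
  have idx: "?Z \<subseteq> ?I" "?P \<subseteq> ?I" "?N \<subseteq> ?I" by (auto simp: idx_zero_def idx_plus_def idx_minus_def)
  have PN: "?P \<inter> ?N = {}" by (auto simp: idx_plus_def idx_minus_def)
  have direct: "sum_is_direct (blocks s A :: 'n func set) (blocks s B)" if "A \<subseteq> ?I" "B \<subseteq> ?I" "A \<inter> B = {}" for A B
    unfolding sum_is_direct_def by (rule blocks_disjoint[OF that])
  have d0p: "sum_is_direct (blocks s ?Z :: 'n func set) (blocks s (?P - ?Z))"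
    and d0m: "sum_is_direct (blocks s ?Z :: 'n func set) (blocks s (?N - ?Z))"
    and dpm: "sum_is_direct (blocks s (?Z \<inter> ?P) :: 'n func set) (blocks s (?Z \<inter> ?N))"
    and d3: "sum_is_direct (blocks s (?Z \<union> ?N) :: 'n func set) (blocks s (?P - ?Z))"
    by (rule direct; use idx PN in blast)+
  note u = H_all_eq H_zero_eq blocks_Un Un_Diff_cancel
  have case1: "{N. gm_submodule ?M N \<and> gm_irreducible (gm_restrict ?M N)} = {H_zero s q}"
    if "\<not> [q = int CARD('n)] (mod 4)" "\<not> [q = - int CARD('n)] (mod 4)"
    unfolding u using unique_irreducible[OF M _ that] by simp
  have case2: "sum_is_direct (H_zero s q :: 'n func set) (H_plus s q) \<and>
      gm_composition_series ?M [{0}, H_zero_plus s q, H_zero s q, subspace_sum (H_zero s q) (H_plus s q), blocks s ?I]"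
    if "[q = int CARD('n)] (mod 4)" "\<not> [q = - int CARD('n)] (mod 4)"
    unfolding u H_plus_eq[OF that(1)]
    using d0p series_plus[OF M _ that] by (simp add: blocks_empty)
  have case3: "sum_is_direct (H_zero s q :: 'n func set) (H_minus s q) \<and>
      gm_composition_series ?M [{0}, H_zero_minus s q, H_zero s q, subspace_sum (H_zero s q) (H_minus s q), blocks s ?I]"
    if "\<not> [q = int CARD('n)] (mod 4)" "[q = - int CARD('n)] (mod 4)"
    unfolding u H_minus_eq[OF that(2)]
    using d0m series_minus[OF M _ that] by (simp add: blocks_empty)
  \<comment> \<open>\<open>H_plus\<close> omits l = 0, while the index set of the series contains
    all of class 1; the missing part already lies in the l = 0 set.\<close>
  have ZNP: "?Z \<union> ?N \<union> (?P - ?Z) = ?Z \<union> ?N \<union> ?P" by blast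
  have case4: "sum_is_direct (H_zero_plus s q :: 'n func set) (H_zero_minus s q) \<and>
      sum_is_direct (H_zero s q :: 'n func set) (H_minus s q) \<and>
      sum_is_direct (subspace_sum (H_zero s q) (H_minus s q) :: 'n func set) (H_plus s q) \<and>
      (CARD('n) \<noteq> 2 \<longrightarrow> gm_composition_series ?M [{0}, H_zero_minus s q,
         subspace_sum (H_zero_plus s q) (H_zero_minus s q), H_zero s q, subspace_sum (H_zero s q) (H_minus s q),
         subspace_sum (subspace_sum (H_zero s q) (H_minus s q)) (H_plus s q), blocks s ?I]) \<and>
      (CARD('n) = 2 \<longrightarrow> gm_composition_series (schr_O_module s (blocks s ?I :: 'n func set)) [{0}, H_zero_minus s q,
         subspace_sum (H_zero_plus s q) (H_zero_minus s q), H_zero s q, subspace_sum (H_zero s q) (H_minus s q),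
         subspace_sum (subspace_sum (H_zero s q) (H_minus s q)) (H_plus s q), blocks s ?I])"
    if q: "[q = int CARD('n)] (mod 4)" "[q = - int CARD('n)] (mod 4)"
    unfolding u H_plus_eq[OF q(1)] H_minus_eq[OF q(2)] ZNP
    using d0m dpm d3 series_both[OF M _ q] series_both[OF index_module_schr_O[OF assms] _ q]
    by (simp add: blocks_empty)
  have n2: "int CARD('n) = 2 \<longleftrightarrow> CARD('n) = 2" by simp
  show ?thesis
    unfolding Let_def H_all_eq n2 using sub case1 case2 case3 case4 by blast
qed

end
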